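(* Let $n\ge1$. Let $P_n$ be the proper part of the Segre product poset $B_n\circ_{\rho}B_n=\{(S,T): S,T\subseteq[n],\ |S|=|T|\}$ (ordered componentwise by inclusion, minimum and maximum removed), with the action of $\mathcal{S}_n\times\mathcal{S}_n$ given by $(\sigma,\tau)\cdot(S,T)=(\sigma(S),\tau(T))$, inducing a representation on the reduced top homology $\widetilde{H}_{n-2}(P_n)$. Let $$W_n(q)=\sum_{(\sigma,\omega)\in\mathcal{D}_n}q^{\mathrm{inv}(\sigma)+\mathrm{inv}(\omega)},$$ where $\mathcal{D}_n$ is the set of pairs $(\sigma,\omega)\in\mathcal{S}_n\times\mathcal{S}_n$ having no common ascent. Then $$ps\big(ch(\widetilde{H}_{n-2}(P_n))\big)=\frac{W_n(q)}{\prod_{i=1}^{n}(1-q^i)^2}.$$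
   Context: An ascent of $\sigma\in\mathcal{S}_n$ is $i\in[n-1]$ with $\sigma(i)<\sigma(i+1)$; $\mathrm{inv}(\sigma)=|\{(i,j):1\le i<j\le n,\ \sigma(i)>\sigma(j)\}|$. For a class function $\chi$ on $\mathcal{S}_m\times\mathcal{S}_n$, its product Frobenius characteristic is $ch(\chi)=\sum_{\mu\vdash m,\lambda\vdash n}z_\mu^{-1}z_\lambda^{-1}\chi(\mu,\lambda)p_\mu(x)p_\lambda(y)$, a symmetric function in variables $x=(x_1,x_2,\dots)$ and $y=(y_1,y_2,\dots)$ ($p_\mu$ power sums, $z_\mu$ centralizer sizes, $\chi(\mu,\lambda)$ the value on cycle type $(\mu,\lambda)$); for a representation it is that of its character. When $n=1$, $P_1=\emptyset$ and $\widetilde H_{-1}(\emptyset)$ is the trivial representation. The stable principal specialization $ps$ of such a symmetric function substitutes $x_i=y_i=q^{i-1}$ for all $i\ge1$. *)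

theory Defs
  imports
    Complex_Main
    "HOL-Library.FuncSet"
    "HOL-Library.Multiset"
    "HOL-Library.Product_Order"
    "HOL-Combinatorics.Orbits"
    "HOL-Algebra.Module"
    "HOL-Algebra.AbelCoset"
    "HOL-Computational_Algebra.Formal_Power_Series"
begin

section \<open>Traces on finite-dimensional complex vector spaces\<close>

text \<open>
  Vector spaces are \<open>module\<close> records over the complex numbers; the ring multiplication and unit
  of the record are irrelevant and left undefined.
\<close>

definition quotient_module ::
    "(complex, 'b) module \<Rightarrow> 'b set \<Rightarrow> (complex, 'b set) module" where
  "quotient_module M N =
     \<lparr>carrier = a_rcosets\<^bsub>M\<^esub> N, monoid.mult = undefined, one = undefined,
      zero = N, add = set_add M,
      smult = (\<lambda>a C. \<Union>v\<in>C. N +>\<^bsub>M\<^esub> (a \<odot>\<^bsub>M\<^esub> v))\<rparr>"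

definition is_coords ::
    "(complex, 'b) module \<Rightarrow> 'b set \<Rightarrow> 'b \<Rightarrow> ('b \<Rightarrow> complex) \<Rightarrow> bool" where
  "is_coords M E v a \<longleftrightarrow>
     a \<in> extensional E \<and> v = finsum M (\<lambda>e. a e \<odot>\<^bsub>M\<^esub> e) E"

definition is_basis :: "(complex, 'b) module \<Rightarrow> 'b set \<Rightarrow> bool" where
  "is_basis M E \<longleftrightarrow>
     finite E \<and> E \<subseteq> carrier M \<and> (\<forall>v\<in>carrier M. \<exists>!a. is_coords M E v a)"

definition coords :: "(complex, 'b) module \<Rightarrow> 'b set \<Rightarrow> 'b \<Rightarrow> 'b \<Rightarrow> complex" where
  "coords M E v = (THE a. is_coords M E v a)"

definition linear_trace :: "(complex, 'b) module \<Rightarrow> ('b \<Rightarrow> 'b) \<Rightarrow> complex" where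
  "linear_trace M f = (let E = (SOME E. is_basis M E) in \<Sum>e\<in>E. coords M E (f e) e)"

section \<open>Reduced homology of posets\<close>

text \<open>
  A \<open>k\<close>-simplex of the order complex is a strictly increasing list of \<open>k + 1\<close> elements; the empty
  list is the unique simplex of dimension \<open>-1\<close>, which makes the homology below the reduced one.
\<close>

definition order_simplices :: "'a::order set \<Rightarrow> int \<Rightarrow> 'a list set" where
  "order_simplices P k = {xs. sorted_wrt (<) xs \<and> set xs \<subseteq> P \<and> int (length xs) = k + 1}"

definition poset_chains :: "'a::order set \<Rightarrow> int \<Rightarrow> ('a list \<Rightarrow> complex) set" where
  "poset_chains P k = {c. finite {xs. c xs \<noteq> 0} \<and> {xs. c xs \<noteq> 0} \<subseteq> order_simplices P k}"

definition boundary :: "('a list \<Rightarrow> complex) \<Rightarrow> 'a list \<Rightarrow> complex" where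
  "boundary c = (\<lambda>ys. \<Sum>xs | c xs \<noteq> 0. \<Sum>i<length xs.
      if take i xs @ drop (Suc i) xs = ys then (-1) ^ i * c xs else 0)"

definition cycle_module :: "'a::order set \<Rightarrow> int \<Rightarrow> (complex, 'a list \<Rightarrow> complex) module" where
  "cycle_module P k =
     \<lparr>carrier = {c \<in> poset_chains P k. boundary c = (\<lambda>_. 0)},
      monoid.mult = undefined, one = undefined,
      zero = (\<lambda>_. 0), add = (\<lambda>c d xs. c xs + d xs), smult = (\<lambda>a c xs. a * c xs)\<rparr>"

definition reduced_homology ::
    "'a::order set \<Rightarrow> int \<Rightarrow> (complex, ('a list \<Rightarrow> complex) set) module" where
  "reduced_homology P k = quotient_module (cycle_module P k) (boundary ` poset_chains P (k + 1))"

definition chain_map :: "('a \<Rightarrow> 'b) \<Rightarrow> ('a list \<Rightarrow> complex) \<Rightarrow> 'b list \<Rightarrow> complex" where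
  "chain_map f c = (\<lambda>ys. \<Sum>xs | c xs \<noteq> 0 \<and> map f xs = ys. c xs)"

text \<open>
  An automorphism of the poset maps the space of boundaries onto itself, so the class of a cycle
  \<open>z\<close>, which is a coset, is mapped onto the class of \<open>chain_map f z\<close>.
\<close>

definition homology_map ::
    "('a \<Rightarrow> 'a) \<Rightarrow> ('a list \<Rightarrow> complex) set \<Rightarrow> ('a list \<Rightarrow> complex) set" where
  "homology_map f C = chain_map f ` C"

section \<open>The Segre product of two Boolean lattices\<close>

definition segre_poset :: "nat \<Rightarrow> (nat set \<times> nat set) set" where
  "segre_poset n = {(S, T). S \<subseteq> {1..n} \<and> T \<subseteq> {1..n} \<and> card S = card T}"

definition segre_proper_part :: "nat \<Rightarrow> (nat set \<times> nat set) set" where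
  "segre_proper_part n = segre_poset n - {({}, {}), ({1..n}, {1..n})}"

definition segre_action ::
    "(nat \<Rightarrow> nat) \<Rightarrow> (nat \<Rightarrow> nat) \<Rightarrow> nat set \<times> nat set \<Rightarrow> nat set \<times> nat set" where
  "segre_action \<sigma> \<tau> = (\<lambda>(S, T). (\<sigma> ` S, \<tau> ` T))"

definition top_homology_character :: "nat \<Rightarrow> (nat \<Rightarrow> nat) \<Rightarrow> (nat \<Rightarrow> nat) \<Rightarrow> complex" where
  "top_homology_character n \<sigma> \<tau> =
     linear_trace (reduced_homology (segre_proper_part n) (int n - 2))
       (homology_map (segre_action \<sigma> \<tau>))"

section \<open>Power series in two sets of variables\<close>

text \<open>
  The variables \<open>XVar i\<close> and \<open>YVar i\<close> with \<open>i \<ge> 1\<close> stand for $x_i$ and $y_i$ (index 0 is never used).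
  A monomial is a multiset of variables, and a power series in infinitely many variables is given
  by its coefficient function on monomials.
\<close>

datatype var = XVar nat | YVar nat

type_synonym series = "var multiset \<Rightarrow> complex"

definition series_one :: series where
  "series_one M = (if M = {#} then 1 else 0)"

definition series_mult :: "series \<Rightarrow> series \<Rightarrow> series" where
  "series_mult f g M = (\<Sum>A | A \<subseteq># M. f A * g (M - A))"

definition power_sum :: "(nat \<Rightarrow> var) \<Rightarrow> nat \<Rightarrow> series" where
  "power_sum v k M = (if \<exists>i\<ge>1. M = replicate_mset k (v i) then 1 else 0)"

definition power_sum_partition :: "(nat \<Rightarrow> var) \<Rightarrow> nat list \<Rightarrow> series" where
  "power_sum_partition v \<mu> = foldr (\<lambda>k. series_mult (power_sum v k)) \<mu> series_one"

section \<open>The product Frobenius characteristic\<close>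

definition partitions :: "nat \<Rightarrow> nat list set" where
  "partitions n = {\<mu>. sorted_wrt (\<ge>) \<mu> \<and> 0 \<notin> set \<mu> \<and> sum_list \<mu> = n}"

definition z_partition :: "nat list \<Rightarrow> nat" where
  "z_partition \<mu> = (\<Prod>i\<in>set \<mu>. i ^ count_list \<mu> i * fact (count_list \<mu> i))"

definition cycle_type :: "nat \<Rightarrow> (nat \<Rightarrow> nat) \<Rightarrow> nat list" where
  "cycle_type n \<sigma> =
     rev (sorted_list_of_multiset (image_mset card (mset_set (orbit \<sigma> ` {1..n}))))"

definition perm_of_type :: "nat \<Rightarrow> nat list \<Rightarrow> nat \<Rightarrow> nat" where
  "perm_of_type n \<mu> = (SOME \<sigma>. \<sigma> permutes {1..n} \<and> cycle_type n \<sigma> = \<mu>)"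

definition frobenius_char ::
    "nat \<Rightarrow> nat \<Rightarrow> ((nat \<Rightarrow> nat) \<Rightarrow> (nat \<Rightarrow> nat) \<Rightarrow> complex) \<Rightarrow> series" where
  "frobenius_char m n \<chi> = (\<lambda>M. \<Sum>\<mu>\<in>partitions m. \<Sum>\<nu>\<in>partitions n.
      \<chi> (perm_of_type m \<mu>) (perm_of_type n \<nu>)
        / (of_nat (z_partition \<mu>) * of_nat (z_partition \<nu>))
        * series_mult (power_sum_partition XVar \<mu>) (power_sum_partition YVar \<nu>) M)"

section \<open>Stable principal specialization\<close>

fun principal_value :: "var \<Rightarrow> complex fps" where
  "principal_value (XVar i) = fps_X ^ (i - 1)"
| "principal_value (YVar i) = fps_X ^ (i - 1)"

definition specialize_monomial :: "series \<Rightarrow> var multiset \<Rightarrow> complex fps" where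
  "specialize_monomial f M = fps_const (f M) * (\<Prod>v\<in>#M. principal_value v)"

text \<open>
  The coefficientwise sum of all specialized monomials. For a series of bounded degree, only
  finitely many monomials contribute to a given power of \<open>q\<close>.
\<close>

definition principal_specialization :: "series \<Rightarrow> complex fps" where
  "principal_specialization f = Abs_fps (\<lambda>d.
     \<Sum>M | fps_nth (specialize_monomial f M) d \<noteq> 0. fps_nth (specialize_monomial f M) d)"

section \<open>Pairs of permutations without common ascent\<close>

definition ascents :: "nat \<Rightarrow> (nat \<Rightarrow> nat) \<Rightarrow> nat set" where
  "ascents n \<sigma> = {i \<in> {1..<n}. \<sigma> i < \<sigma> (i + 1)}"

definition inversions :: "nat \<Rightarrow> (nat \<Rightarrow> nat) \<Rightarrow> nat" where
  "inversions n \<sigma> = card {(i, j). 1 \<le> i \<and> i < j \<and> j \<le> n \<and> \<sigma> i > \<sigma> j}"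

definition no_common_ascent :: "nat \<Rightarrow> ((nat \<Rightarrow> nat) \<times> (nat \<Rightarrow> nat)) set" where
  "no_common_ascent n = {(\<sigma>, \<omega>). \<sigma> permutes {1..n} \<and> \<omega> permutes {1..n} \<and>
     ascents n \<sigma> \<inter> ascents n \<omega> = {}}"

definition W_poly :: "nat \<Rightarrow> complex fps" where
  "W_poly n = (\<Sum>(\<sigma>, \<omega>)\<in>no_common_ascent n. fps_X ^ (inversions n \<sigma> + inversions n \<omega>))"

end

theory Submission
  imports Defs "HOL-Library.Function_Algebras" "HOL-Combinatorics.Cycles"
begin

text \<open>
  For a chain \<open>c\<close> of pairs \<open>(S, T)\<close> let \<open>I(c)\<close> be the set of pairs \<open>x > y\<close> that some
  member of \<open>c\<close> separates (\<open>x\<close> inside, \<open>y\<close> outside), recorded for both coordinates. An element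
  is free for \<open>c\<close> if it is comparable to \<open>c\<close> and inserting or deleting it does not change \<open>I(c)\<close>.
  Toggling a free element does not change the set of free elements, so toggling a chosen one
  matches chains of different parity with the same \<open>I(c)\<close>; every chain that is not maximal has a
  free element, and the unmatched maximal chains are the pairs of permutations without common
  ascent, with \<open>|I(c)|\<close> their number of inversions.

  This matching is used twice. It is acyclic with respect to \<open>|I(c)|\<close>, hence the homology is
  concentrated in the top degree and the character is a signed count of fixed chains (Hopf trace).
  It is also sign-reversing, which turns \<open>W_n(q)\<close> into the signed sum of \<open>q^|I(c)|\<close> over all
  chains. Splitting off the last element of a chain, both signed sums satisfy the recursion of
  \<open>\<Sum> (-1)^(n - k) h_{a_1}^2 \<dots> h_{a_k}^2\<close> over compositions of \<open>n\<close>, with \<open>h_a = 1 / (q; q)_a\<close>.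
\<close>

section \<open>Simplices of the order complex\<close>

abbreviation is_chain :: "'a::order set \<Rightarrow> bool" where
  "is_chain \<equiv> Complete_Partial_Order.chain (\<le>)"

definition all_simplices :: "'a::order set \<Rightarrow> 'a list set" where
  "all_simplices P = {xs. sorted_wrt (<) xs \<and> set xs \<subseteq> P}"

definition simplices :: "'a::order set \<Rightarrow> nat \<Rightarrow> 'a list set" where
  "simplices P l = {xs \<in> all_simplices P. length xs = l}"

lemma order_simplices_eq_simplices: "order_simplices P (int l - 1) = simplices P l"
  by (auto simp: order_simplices_def simplices_def all_simplices_def)

lemma distinct_if_sorted_wrt_less: "sorted_wrt (<) (xs :: 'a::order list) \<Longrightarrow> distinct xs"
  by (induction xs) auto

lemma is_chain_set_if_sorted_wrt_less: "sorted_wrt (<) xs \<Longrightarrow> is_chain (set xs)"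
  by (induction xs) (auto simp: Complete_Partial_Order.chain_def less_imp_le)

lemma finite_all_simplices: "finite P \<Longrightarrow> finite (all_simplices P)"
  by (rule finite_subset[OF _ finite_subset_distinct])
    (auto simp: all_simplices_def distinct_if_sorted_wrt_less)

lemma finite_simplices: "finite P \<Longrightarrow> finite (simplices P l)"
  by (simp add: simplices_def finite_all_simplices)

lemma all_simplicesD:
  assumes "xs \<in> all_simplices P"
  shows "sorted_wrt (<) xs" "set xs \<subseteq> P" "is_chain (set xs)" "card (set xs) = length xs"
  using assms
  by (auto simp: all_simplices_def is_chain_set_if_sorted_wrt_less distinct_if_sorted_wrt_less
      distinct_card)

lemma simplicesD:
  assumes "xs \<in> simplices P l"
  shows "xs \<in> all_simplices P" "length xs = l"
  using assms by (auto simp: simplices_def)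

lemma sorted_wrt_less_set_inject:
  fixes xs ys :: "'a::order list"
  assumes "sorted_wrt (<) xs" "sorted_wrt (<) ys" "set xs = set ys"
  shows "xs = ys"
  using assms
proof (induction xs arbitrary: ys)
  case (Cons x xs)
  then obtain y ys' where ys: "ys = y # ys'" by (cases ys) auto
  have "x = y"
  proof (rule ccontr)
    assume "x \<noteq> y"
    then have "y < x" "x < y" using Cons.prems ys by auto
    then show False by auto
  qed
  moreover have "set xs = set ys'"
    using Cons.prems ys \<open>x = y\<close>
    by (metis insert_ident list.simps(15) sorted_wrt.simps(2) less_irrefl)
  ultimately show ?case using Cons ys by auto
qed simp

lemma ex_sorted_list_of_chain:
  assumes "finite c" "is_chain c"
  shows "\<exists>xs. sorted_wrt (<) xs \<and> set xs = c"
  using assms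
proof (induction rule: finite_remove_induct)
  case (remove c)
  then obtain m where m: "m \<in> c" "\<And>x. x \<in> c \<Longrightarrow> m \<le> x \<Longrightarrow> m = x"
    using finite_has_maximal[of c] by metis
  obtain xs where xs: "sorted_wrt (<) xs" "set xs = c - {m}"
    using remove.IH[OF m(1)] remove.prems by (meson chain_subset Diff_subset)
  have "x < m" if "x \<in> c - {m}" for x
    using m that chainD[OF remove.prems, of x m] by (auto simp: less_le)
  then have "sorted_wrt (<) (xs @ [m])" "set (xs @ [m]) = c"
    using xs m(1) by (auto simp: sorted_wrt_append)
  then show ?case by blast
qed (intro exI[of _ "[]"], simp)

definition list_of_chain :: "'a::order set \<Rightarrow> 'a list" where
  "list_of_chain c = (THE xs. sorted_wrt (<) xs \<and> set xs = c)"

lemma list_of_chain_set: "sorted_wrt (<) xs \<Longrightarrow> list_of_chain (set xs) = xs"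
  unfolding list_of_chain_def by (rule the_equality) (auto intro: sorted_wrt_less_set_inject)

lemma list_of_chain:
  assumes "finite c" "is_chain c"
  shows "sorted_wrt (<) (list_of_chain c)" "set (list_of_chain c) = c"
proof -
  obtain xs where "sorted_wrt (<) xs" "set xs = c" using ex_sorted_list_of_chain[OF assms] by blast
  then show "sorted_wrt (<) (list_of_chain c)" "set (list_of_chain c) = c"
    using list_of_chain_set[of xs] by auto
qed

lemma bij_betw_set_all_simplices:
  assumes "finite P"
  shows "bij_betw set (all_simplices P) {c. c \<subseteq> P \<and> is_chain c}"
proof (rule bij_betw_byWitness[where f' = list_of_chain])
  have "finite c" if "c \<subseteq> P" for c using assms that finite_subset by blast
  then show "list_of_chain ` {c. c \<subseteq> P \<and> is_chain c} \<subseteq> all_simplices P"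
    and "\<forall>c\<in>{c. c \<subseteq> P \<and> is_chain c}. set (list_of_chain c) = c"
    by (auto simp: all_simplices_def list_of_chain)
qed (use all_simplicesD list_of_chain_set in blast)+

section \<open>The boundary operator\<close>

definition delete_nth :: "nat \<Rightarrow> 'a list \<Rightarrow> 'a list" where
  "delete_nth i xs = take i xs @ drop (Suc i) xs"

lemma length_delete_nth: "i < length xs \<Longrightarrow> length (delete_nth i xs) = length xs - 1"
  by (auto simp: delete_nth_def)

lemma delete_nth_map: "delete_nth i (map f xs) = map f (delete_nth i xs)"
  by (simp add: delete_nth_def take_map drop_map)

lemma delete_nth_delete_nth:
  assumes "i \<le> j" "Suc j < length xs"
  shows "delete_nth j (delete_nth i xs) = delete_nth i (delete_nth (Suc j) xs)"
  using assms by (intro nth_equalityI) (auto simp: delete_nth_def nth_append min_def)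

lemma set_delete_nth:
  assumes "distinct xs" "i < length xs"
  shows "set (delete_nth i xs) = set xs - {xs ! i}"
proof -
  have "xs = take i xs @ xs ! i # drop (Suc i) xs" using assms by (simp add: id_take_nth_drop)
  then have "distinct (take i xs @ xs ! i # drop (Suc i) xs)"
    "set xs = set (take i xs @ xs ! i # drop (Suc i) xs)" using assms by metis+
  then show ?thesis by (auto simp: delete_nth_def)
qed

lemma sorted_wrt_delete_nth:
  assumes "sorted_wrt R xs"
  shows "sorted_wrt R (delete_nth i xs)"
proof -
  have "sorted_wrt R (take i xs @ drop i xs)" using assms by simp
  moreover have "set (drop (Suc i) xs) \<subseteq> set (drop i xs)" by (simp add: set_drop_subset_set_drop)
  ultimately show ?thesis
    using sorted_wrt_drop[OF assms, of "Suc i"] unfolding delete_nth_def sorted_wrt_append by blast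
qed

lemma delete_nth_simplices:
  assumes "xs \<in> simplices P (Suc l)" "i < length xs"
  shows "delete_nth i xs \<in> simplices P l"
  using assms sorted_wrt_delete_nth[of "(<)" xs i] set_delete_nth[of xs i]
    length_delete_nth[of i xs]
  by (auto simp: simplices_def all_simplices_def distinct_if_sorted_wrt_less)

lemma delete_nth_eq_iff:
  fixes xs ys :: "'a::order list"
  assumes "sorted_wrt (<) xs" "i < length xs"
  shows "delete_nth i xs = ys \<longleftrightarrow> sorted_wrt (<) ys \<and> set ys = set xs - {xs ! i}"
  using sorted_wrt_delete_nth[OF assms(1)]
    set_delete_nth[OF distinct_if_sorted_wrt_less[OF assms(1)] assms(2)]
    sorted_wrt_less_set_inject by metis

definition incidence :: "'a list \<Rightarrow> 'a list \<Rightarrow> complex" where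
  "incidence xs ys = (\<Sum>i<length xs. if delete_nth i xs = ys then (-1) ^ i else 0)"

lemma boundary_eq_sum_incidence:
  assumes "finite X" "\<And>x. x \<notin> X \<Longrightarrow> c x = 0"
  shows "boundary c w = (\<Sum>x\<in>X. c x * incidence x w)"
proof -
  have "boundary c w = (\<Sum>x | c x \<noteq> 0. c x * incidence x w)"
    unfolding boundary_def incidence_def delete_nth_def
    by (intro sum.cong refl) (auto simp: sum_distrib_left intro!: sum.cong)
  also have "\<dots> = (\<Sum>x\<in>X. c x * incidence x w)"
    using assms by (intro sum.mono_neutral_left) auto
  finally show ?thesis .
qed

lemma incidence_nonzero_iff:
  fixes xs ys :: "'a::order list"
  assumes xs: "sorted_wrt (<) xs"
  shows "incidence xs ys \<noteq> 0 \<longleftrightarrow> (\<exists>e\<in>set xs. sorted_wrt (<) ys \<and> set ys = set xs - {e})"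
proof
  assume "incidence xs ys \<noteq> 0"
  then obtain i where "i < length xs" "delete_nth i xs = ys"
    unfolding incidence_def
    by (auto elim!: sum.not_neutral_contains_not_neutral split: if_splits)
  then show "\<exists>e\<in>set xs. sorted_wrt (<) ys \<and> set ys = set xs - {e}"
    using delete_nth_eq_iff[OF xs] nth_mem by blast
next
  assume "\<exists>e\<in>set xs. sorted_wrt (<) ys \<and> set ys = set xs - {e}"
  then obtain i where i: "i < length xs" and ys: "sorted_wrt (<) ys" "set ys = set xs - {xs ! i}"
    by (metis in_set_conv_nth)
  have "delete_nth j xs = ys \<longleftrightarrow> j = i" if "j < length xs" for j
  proof -
    have "delete_nth j xs = ys \<longleftrightarrow> set xs - {xs ! i} = set xs - {xs ! j}"
      using delete_nth_eq_iff[OF xs that] ys by simp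
    also have "\<dots> \<longleftrightarrow> xs ! j = xs ! i"
      using nth_mem[OF i] nth_mem[OF that] by (metis Diff_iff insertCI singletonD)
    also have "\<dots> \<longleftrightarrow> j = i" using nth_eq_iff_index_eq[OF distinct_if_sorted_wrt_less[OF xs]] i that
      by blast
    finally show ?thesis .
  qed
  then have "incidence xs ys = (\<Sum>j<length xs. if j = i then (-1) ^ j else 0)"
    unfolding incidence_def by (intro sum.cong) auto
  then show "incidence xs ys \<noteq> 0" using i by simp
qed

lemma incidence_simplices_eq_0:
  assumes "x \<in> simplices P (Suc l)" "w \<notin> simplices P l"
  shows "incidence x w = 0"
  unfolding incidence_def using delete_nth_simplices[OF assms(1)] assms(2)
  by (intro sum.neutral) auto

lemma incidence_map:
  assumes "inj_on f (set xs \<union> set ys)"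
  shows "incidence (map f xs) (map f ys) = incidence xs ys"
proof -
  have "delete_nth i (map f xs) = map f ys \<longleftrightarrow> delete_nth i xs = ys" for i
  proof -
    have "set (delete_nth i xs) \<subseteq> set xs"
      by (auto simp: delete_nth_def dest: in_set_takeD in_set_dropD)
    then show ?thesis
      unfolding delete_nth_map using inj_on_subset[OF assms] by (intro inj_on_map_eq_map) blast
  qed
  then show ?thesis by (simp add: incidence_def)
qed

lemma sum_incidence_delete_nth_eq_0:
  "(\<Sum>i<length xs. (-1) ^ i * incidence (delete_nth i xs) ys) = 0"
proof (cases "length xs")
  case (Suc m)
  define t :: "nat \<Rightarrow> nat \<Rightarrow> complex"
    where "t i j = (if delete_nth j (delete_nth i xs) = ys then (-1) ^ (i + j) else 0)" for i j
  define U where "U = {(i, j). i \<le> j \<and> j < m}"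
  define V where "V = {(i, j). j < i \<and> i \<le> m}"
  have UV: "{..<Suc m} \<times> {..<m} = U \<union> V" by (auto simp: U_def V_def)
  then have fin: "finite U" "finite V"
    by (metis finite_Un finite_cartesian_product finite_lessThan)+
  have "(\<Sum>i<length xs. (-1) ^ i * incidence (delete_nth i xs) ys) = (\<Sum>i<Suc m. \<Sum>j<m. t i j)"
    unfolding Suc incidence_def
    by (rule sum.cong)
      (auto simp: t_def length_delete_nth Suc sum_distrib_left power_add intro!: sum.cong)
  also have "\<dots> = (\<Sum>(i, j)\<in>U. t i j) + (\<Sum>(i, j)\<in>V. t i j)"
    unfolding sum.cartesian_product UV
    by (rule sum.union_disjoint) (auto simp: fin, auto simp: U_def V_def)
  also have "(\<Sum>(i, j)\<in>V. t i j) = (\<Sum>(i, j)\<in>U. - t i j)"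
    by (rule sum.reindex_bij_witness[of _ "\<lambda>(i, j). (Suc j, i)" "\<lambda>(i, j). (j, i - 1)"])
      (auto simp: t_def U_def V_def Suc delete_nth_delete_nth gr0_conv_Suc add.commute
        elim!: less_natE)
  also have "(\<Sum>(i, j)\<in>U. - t i j) = - (\<Sum>(i, j)\<in>U. t i j)"
    by (simp add: sum_negf split_def)
  finally show ?thesis by simp
qed simp

lemma sum_incidence_mult_incidence_eq_0:
  assumes "finite P" and y: "y \<in> simplices P (Suc l)"
  shows "(\<Sum>x\<in>simplices P l. incidence y x * incidence x w) = 0"
proof -
  let ?X = "simplices P l"
  have "(\<Sum>x\<in>?X. incidence y x * incidence x w)
    = (\<Sum>i<length y. \<Sum>x\<in>?X. if delete_nth i y = x then (-1) ^ i * incidence x w else 0)"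
    unfolding incidence_def[of y]
    by (subst sum.swap) (auto simp: sum_distrib_right intro!: sum.cong)
  also have "\<dots> = (\<Sum>i<length y. (-1) ^ i * incidence (delete_nth i y) w)"
    using delete_nth_simplices[OF y] finite_simplices[OF assms(1)] by (intro sum.cong) auto
  finally show ?thesis by (simp add: sum_incidence_delete_nth_eq_0)
qed

definition cycles :: "'a::order set \<Rightarrow> nat \<Rightarrow> ('a list \<Rightarrow> complex) set" where
  "cycles P l = {z. (\<forall>x. x \<notin> simplices P l \<longrightarrow> z x = 0) \<and>
     (\<forall>w. (\<Sum>x\<in>simplices P l. z x * incidence x w) = 0)}"

lemma cyclesD:
  assumes "z \<in> cycles P l"
  shows "x \<notin> simplices P l \<Longrightarrow> z x = 0" "(\<Sum>x\<in>simplices P l. z x * incidence x w) = 0"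
  using assms by (auto simp: cycles_def)

definition exact_at :: "'a::order set \<Rightarrow> nat \<Rightarrow> bool" where
  "exact_at P l \<longleftrightarrow> (\<forall>z\<in>cycles P l. \<exists>y. \<forall>x\<in>simplices P l.
     z x = (\<Sum>y'\<in>simplices P (Suc l). y y' * incidence y' x))"

section \<open>Exactness from an acyclic matching\<close>

lemma triangular_system_solvable:
  fixes t :: "'i \<Rightarrow> 'i \<Rightarrow> 'k::field" and rk :: "'i \<Rightarrow> 'r::linorder"
  assumes "finite I" and "\<And>i. i \<in> I \<Longrightarrow> t i i \<noteq> 0"
    and "\<And>i j. i \<in> I \<Longrightarrow> j \<in> I \<Longrightarrow> i \<noteq> j \<Longrightarrow> t i j \<noteq> 0 \<Longrightarrow> rk j < rk i"
  shows "\<exists>a. \<forall>j\<in>I. z j = (\<Sum>i\<in>I. a i * t i j)"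
  using assms
proof (induction arbitrary: z rule: finite_ranking_induct[where f = rk])
  case (insert m S)
  show ?case
  proof (cases "m \<in> S")
    case True
    then show ?thesis using insert by (simp add: insert_absorb)
  next
    case False
    let ?b = "z m / t m m"
    have column_m: "t i m = 0" if "i \<in> S" for i
      using insert.prems(2)[of i m] insert.hyps(2)[OF that] that False by force
    obtain a where a: "\<And>j. j \<in> S \<Longrightarrow> z j - ?b * t m j = (\<Sum>i\<in>S. a i * t i j)"
      using insert.IH[of "\<lambda>j. z j - ?b * t m j"] insert.prems by blast
    have "z j = (\<Sum>i\<in>insert m S. (a(m := ?b)) i * t i j)" if "j \<in> insert m S" for j
    proof -
      have "(\<Sum>i\<in>S. (a(m := ?b)) i * t i j) = (\<Sum>i\<in>S. a i * t i j)"
        using False by (intro sum.cong) auto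
      moreover have "(\<Sum>i\<in>S. a i * t i m) = 0" by (simp add: column_m)
      ultimately show ?thesis
        using that a[of j] insert.prems(1)[of m] insert.hyps(1) False
        by (cases "j = m") (auto simp: field_simps)
    qed
    then show ?thesis by blast
  qed
qed simp

lemma triangular_system_unique:
  fixes t :: "'i \<Rightarrow> 'i \<Rightarrow> 'k::field" and rk :: "'i \<Rightarrow> 'r::linorder"
  assumes "finite I" and "\<And>i. i \<in> I \<Longrightarrow> t i i \<noteq> 0"
    and "\<And>i j. i \<in> I \<Longrightarrow> j \<in> I \<Longrightarrow> i \<noteq> j \<Longrightarrow> t i j \<noteq> 0 \<Longrightarrow> rk j < rk i"
    and "\<And>j. j \<in> I \<Longrightarrow> (\<Sum>i\<in>I. a i * t i j) = 0"
  shows "\<forall>i\<in>I. a i = 0"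
  using assms
proof (induction rule: finite_ranking_induct[where f = rk])
  case (insert m S)
  show ?case
  proof (cases "m \<in> S")
    case True
    then show ?thesis using insert by (simp add: insert_absorb)
  next
    case False
    have "t i m = 0" if "i \<in> S" for i
      using insert.prems(2)[of i m] insert.hyps(2)[OF that] that False by force
    then have "a m * t m m = 0"
      using insert.prems(3)[of m] insert.hyps(1) False by simp
    then have "a m = 0" using insert.prems(1)[of m] by simp
    moreover from this have "\<forall>i\<in>S. a i = 0"
      using insert.IH insert.prems insert.hyps(1) False by simp
    ultimately show ?thesis by simp
  qed
qed simp

lemma exact_if_acyclic_matching:
  fixes d :: "'x \<Rightarrow> 'x \<Rightarrow> 'k::field" and rk :: "'x \<Rightarrow> 'r::linorder"
  assumes fin: "finite X" "finite Y" and up_subset: "Up \<subseteq> X"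
    and dd: "\<And>y w. y \<in> Y \<Longrightarrow> (\<Sum>x\<in>X. d y x * d x w) = 0"
    and up: "\<And>c. c \<in> Up \<Longrightarrow> up c \<in> Y" "\<And>c. c \<in> Up \<Longrightarrow> d (up c) c \<noteq> 0"
    and up_acyclic:
      "\<And>c c'. c \<in> Up \<Longrightarrow> c' \<in> Up \<Longrightarrow> c \<noteq> c' \<Longrightarrow> d (up c) c' \<noteq> 0 \<Longrightarrow> rk c' < rk c"
    and down: "\<And>x. x \<in> X - Up \<Longrightarrow> d x (down x) \<noteq> 0"
    and down_acyclic:
      "\<And>x x'. x \<in> X - Up \<Longrightarrow> x' \<in> X - Up \<Longrightarrow> x \<noteq> x' \<Longrightarrow> d x (down x') \<noteq> 0 \<Longrightarrow> rk x' < rk x"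
    and cycle: "\<And>w. (\<Sum>x\<in>X. z x * d x w) = 0"
  shows "\<exists>y. \<forall>x\<in>X. z x = (\<Sum>y'\<in>Y. y y' * d y' x)"
proof -
  have fin_up: "finite Up" using finite_subset[OF up_subset fin(1)] .
  obtain a where a: "\<forall>c\<in>Up. z c = (\<Sum>c'\<in>Up. a c' * d (up c') c)"
    using triangular_system_solvable[of Up "\<lambda>c c'. d (up c) c'" rk z] fin_up up(2) up_acyclic
    by blast
  define y where "y y' = (\<Sum>c\<in>Up. if up c = y' then a c else 0)" for y'
  define bd where "bd x = (\<Sum>y'\<in>Y. y y' * d y' x)" for x
  have "bd x = (\<Sum>c\<in>Up. \<Sum>y'\<in>Y. if up c = y' then a c * d y' x else 0)" for x
    unfolding bd_def y_def by (subst sum.swap) (auto simp: sum_distrib_right intro!: sum.cong)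
  then have "bd x = (\<Sum>c\<in>Up. a c * d (up c) x)" for x
    using up(1) fin(2) by simp
  then have agree_on_up: "z c - bd c = 0" if "c \<in> Up" for c using a that by simp
  have difference_cycle: "(\<Sum>x\<in>X - Up. (z x - bd x) * d x w) = 0" for w
  proof -
    have "(\<Sum>x\<in>X - Up. (z x - bd x) * d x w) = (\<Sum>x\<in>X. (z x - bd x) * d x w)"
      using fin agree_on_up by (intro sum.mono_neutral_left) auto
    also have "\<dots> = (\<Sum>x\<in>X. z x * d x w) - (\<Sum>y'\<in>Y. y y' * (\<Sum>x\<in>X. d y' x * d x w))"
      unfolding bd_def
      by (simp add: left_diff_distrib sum_subtractf sum_distrib_left sum_distrib_right mult.assoc
          sum.swap[of _ X Y])
    finally show ?thesis by (simp add: cycle dd)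
  qed
  have "\<forall>x\<in>X - Up. z x - bd x = 0"
    using fin(1) difference_cycle down down_acyclic
    by (intro triangular_system_unique[where t = "\<lambda>x x'. d x (down x')" and rk = rk]) auto
  then have "\<forall>x\<in>X. z x = bd x" using agree_on_up by (metis DiffI eq_iff_diff_eq_0)
  then show ?thesis unfolding bd_def by blast
qed

section \<open>Traces on spaces of functions\<close>

definition fun_scale :: "complex \<Rightarrow> ('x \<Rightarrow> complex) \<Rightarrow> 'x \<Rightarrow> complex" where
  "fun_scale a v = (\<lambda>x. a * v x)"

interpretation fun_space: vector_space fun_scale
  by standard (auto simp: fun_scale_def fun_eq_iff algebra_simps)

definition fun_module :: "('x \<Rightarrow> complex) set \<Rightarrow> (complex, 'x \<Rightarrow> complex) module" where
  "fun_module Z = \<lparr>carrier = Z, monoid.mult = undefined, one = undefined,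
     zero = (\<lambda>_. 0), add = (\<lambda>c d x. c x + d x), smult = (\<lambda>a c x. a * c x)\<rparr>"

abbreviation zero_quotient :: "('x \<Rightarrow> complex) set \<Rightarrow> (complex, ('x \<Rightarrow> complex) set) module" where
  "zero_quotient Z \<equiv> quotient_module (fun_module Z) {\<lambda>_. 0}"

definition singletons :: "'b set \<Rightarrow> 'b set set" where
  "singletons B = (\<lambda>b. {b}) ` B"

lemma sum_fun_apply: "(\<Sum>i\<in>I. f i) x = (\<Sum>i\<in>I. f i x)"
  by (induction I rule: infinite_finite_induct) auto

lemma sum_singletons: "sum h (singletons B) = (\<Sum>b\<in>B. h {b})"
  by (simp add: singletons_def sum.reindex)

lemma singleton_in_singletons_iff [simp]: "{b} \<in> singletons B \<longleftrightarrow> b \<in> B"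
  by (auto simp: singletons_def)

lemma finite_singletons_iff: "finite (singletons B) \<longleftrightarrow> finite B"
  by (simp add: singletons_def finite_image_iff)

lemma carrier_zero_quotient: "carrier (zero_quotient Z) = singletons Z"
  by (auto simp: singletons_def quotient_module_def fun_module_def A_RCOSETS_def' a_r_coset_def')

lemma add_zero_quotient: "{u} \<oplus>\<^bsub>zero_quotient Z\<^esub> {v} = {u + v}"
  by (auto simp: quotient_module_def fun_module_def set_add_def' plus_fun_def)

lemma zero_zero_quotient: "\<zero>\<^bsub>zero_quotient Z\<^esub> = {0}"
  by (simp add: quotient_module_def zero_fun_def)

lemma smult_zero_quotient: "a \<odot>\<^bsub>zero_quotient Z\<^esub> {v} = {fun_scale a v}"
  by (auto simp: quotient_module_def fun_module_def a_r_coset_def' fun_scale_def)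

context
  fixes Z :: "('x \<Rightarrow> complex) set"
  assumes subspace_Z: "fun_space.subspace Z"
begin

lemma abelian_monoid_zero_quotient: "abelian_monoid (zero_quotient Z)"
  using subspace_Z
  by (intro abelian_monoidI)
    (auto simp: carrier_zero_quotient singletons_def add_zero_quotient zero_zero_quotient
      fun_space.subspace_0 fun_space.subspace_add add_ac)

lemma finsum_zero_quotient:
  assumes "finite I" "f \<in> I \<rightarrow> Z"
  shows "finsum (zero_quotient Z) (\<lambda>i. {f i}) I = {\<Sum>i\<in>I. f i}"
  using assms
proof (induction I rule: finite_induct)
  case empty
  then show ?case
    by (simp add: abelian_monoid.finsum_empty[OF abelian_monoid_zero_quotient] zero_zero_quotient
        zero_fun_def)
next
  case (insert i I)
  then show ?case
    by (subst abelian_monoid.finsum_insert[OF abelian_monoid_zero_quotient])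
      (auto simp: carrier_zero_quotient singletons_def add_zero_quotient)
qed

lemma is_coords_singletons_iff:
  assumes "finite B" "B \<subseteq> Z"
  shows "is_coords (zero_quotient Z) (singletons B) {z} a \<longleftrightarrow>
    a \<in> extensional (singletons B) \<and> z = (\<Sum>b\<in>B. fun_scale (a {b}) b)"
proof -
  let ?f = "\<lambda>e. fun_scale (a e) (the_elem e)"
  have f: "?f e \<in> Z" "a e \<odot>\<^bsub>zero_quotient Z\<^esub> e = {?f e}" if "e \<in> singletons B" for e
    using that assms(2) fun_space.subspace_scale[OF subspace_Z]
    by (auto simp: singletons_def smult_zero_quotient)
  have "finsum (zero_quotient Z) (\<lambda>e. a e \<odot>\<^bsub>zero_quotient Z\<^esub> e) (singletons B)
    = finsum (zero_quotient Z) (\<lambda>e. {?f e}) (singletons B)"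
    by (rule abelian_monoid.finsum_cong'[OF abelian_monoid_zero_quotient refl])
      (auto simp: carrier_zero_quotient f)
  also have "\<dots> = {\<Sum>e\<in>singletons B. ?f e}"
    using assms(1) f(1) by (intro finsum_zero_quotient) (auto simp: finite_singletons_iff)
  finally show ?thesis by (auto simp: is_coords_def sum_singletons)
qed

lemma is_coords_independent_iff:
  assumes B: "finite B" "B \<subseteq> Z" and indep: "fun_space.independent B" "Z \<subseteq> fun_space.span B"
    and z: "z \<in> Z"
  shows "is_coords (zero_quotient Z) (singletons B) {z} a \<longleftrightarrow>
    a = (\<lambda>e\<in>singletons B. fun_space.representation B z (the_elem e))"
proof
  have rep: "z = (\<Sum>b\<in>B. fun_scale (fun_space.representation B z b) b)"
    using fun_space.sum_representation_eq[of B z B] indep z B by auto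
  show "is_coords (zero_quotient Z) (singletons B) {z} a"
    if "a = (\<lambda>e\<in>singletons B. fun_space.representation B z (the_elem e))"
    using that rep by (simp add: is_coords_singletons_iff[OF B])
  assume "is_coords (zero_quotient Z) (singletons B) {z} a"
  then have a: "a \<in> extensional (singletons B)" "z = (\<Sum>b\<in>B. fun_scale (a {b}) b)"
    by (auto simp: is_coords_singletons_iff[OF B])
  have "(\<Sum>b\<in>B. fun_scale (a {b} - fun_space.representation B z b) b) = 0"
    using rep a(2) by (simp add: fun_space.scale_left_diff_distrib sum_subtractf)
  then have "a {b} = fun_space.representation B z b" if "b \<in> B" for b
    using fun_space.independentD[OF indep(1) B(1) order_refl] that by fastforce
  then show "a = (\<lambda>e\<in>singletons B. fun_space.representation B z (the_elem e))"
    using a(1) by (intro extensionalityI[of _ "singletons B"]) (auto simp: singletons_def)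
qed

lemma is_basis_singletons_iff:
  assumes B: "finite B" "B \<subseteq> Z"
  shows "is_basis (zero_quotient Z) (singletons B) \<longleftrightarrow>
    fun_space.independent B \<and> Z \<subseteq> fun_space.span B"
proof (intro iffI conjI)
  assume "is_basis (zero_quotient Z) (singletons B)"
  then have unique_coords: "\<exists>!a. is_coords (zero_quotient Z) (singletons B) {z} a" if "z \<in> Z" for z
    using that by (auto simp: is_basis_def carrier_zero_quotient singletons_def)
  show "Z \<subseteq> fun_space.span B"
  proof
    fix z assume "z \<in> Z"
    then obtain a where "z = (\<Sum>b\<in>B. fun_scale (a {b}) b)"
      using unique_coords is_coords_singletons_iff[OF B] by blast
    then show "z \<in> fun_space.span B"
      by (auto intro: fun_space.span_sum fun_space.span_scale fun_space.span_base)
  qed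
  show "fun_space.independent B"
  proof (rule fun_space.independent_if_scalars_zero[OF B(1)])
    fix u b assume zero: "(\<Sum>b\<in>B. fun_scale (u b) b) = 0" and b: "b \<in> B"
    define a where "a = (\<lambda>e\<in>singletons B. u (the_elem e))"
    have "is_coords (zero_quotient Z) (singletons B) {0} a"
      "is_coords (zero_quotient Z) (singletons B) {0} (\<lambda>e\<in>singletons B. 0)"
      using zero by (simp_all add: is_coords_singletons_iff[OF B] a_def)
    then have "a = (\<lambda>e\<in>singletons B. 0)"
      using unique_coords[OF fun_space.subspace_0[OF subspace_Z]] by blast
    then have "a {b} = (\<lambda>e\<in>singletons B. 0) {b}" by simp
    then show "u b = 0" using b by (simp add: a_def)
  qed
next
  assume "fun_space.independent B \<and> Z \<subseteq> fun_space.span B"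
  then have "\<exists>!a. is_coords (zero_quotient Z) (singletons B) {z} a" if "z \<in> Z" for z
    using is_coords_independent_iff[OF B _ _ that] by simp
  moreover have "singletons B \<subseteq> singletons Z" using B(2) by (auto simp: singletons_def)
  ultimately show "is_basis (zero_quotient Z) (singletons B)"
    using B(1) unfolding is_basis_def carrier_zero_quotient finite_singletons_iff
    by (auto simp: singletons_def)
qed

lemma ex_basis_zero_quotient:
  assumes "finite S" "Z \<subseteq> fun_space.span S"
  shows "\<exists>F. is_basis (zero_quotient Z) F"
proof -
  obtain B where B: "B \<subseteq> Z" "fun_space.independent B" "Z \<subseteq> fun_space.span B"
    using fun_space.maximal_independent_subset by blast
  then have "finite B" using fun_space.independent_span_bound[OF assms(1), of B] assms(2) by auto
  then show ?thesis using B is_basis_singletons_iff by blast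
qed

lemma linear_trace_eq_sum_representation:
  assumes "finite S" "Z \<subseteq> fun_space.span S" and G: "\<And>z. z \<in> Z \<Longrightarrow> G z \<in> Z"
  obtains B where "finite B" "B \<subseteq> Z" "fun_space.independent B" "Z \<subseteq> fun_space.span B"
    "linear_trace (zero_quotient Z) ((`) G) = (\<Sum>b\<in>B. fun_space.representation B (G b) b)"
proof -
  define F where "F = (SOME F. is_basis (zero_quotient Z) F)"
  have basis: "is_basis (zero_quotient Z) F"
    using ex_basis_zero_quotient[OF assms(1,2)] unfolding F_def by (rule someI_ex)
  then obtain B where B: "F = singletons B" "B \<subseteq> Z" "finite B"
    by (auto simp: is_basis_def carrier_zero_quotient singletons_def finite_image_iff
      subset_image_iff)
  then have indep: "fun_space.independent B" "Z \<subseteq> fun_space.span B"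
    using basis is_basis_singletons_iff by auto
  have "linear_trace (zero_quotient Z) ((`) G) = (\<Sum>b\<in>B. coords (zero_quotient Z) F {G b} {b})"
    by (simp add: linear_trace_def F_def[symmetric] Let_def sum_singletons B(1))
  also have "\<dots> = (\<Sum>b\<in>B. fun_space.representation B (G b) b)"
    using G B(2)
    by (intro sum.cong) (auto simp: coords_def B(1) is_coords_independent_iff[OF B(3,2) indep])
  finally show thesis using that B indep by blast
qed

theorem linear_trace_zero_quotient:
  assumes "finite X"
    and E: "\<And>x. x \<in> X \<Longrightarrow> E x \<in> Z" "\<And>z. z \<in> Z \<Longrightarrow> z = (\<Sum>x\<in>X. fun_scale (z x) (E x))"
    and G: "\<And>z. z \<in> Z \<Longrightarrow> G z \<in> Z" "\<And>z. z \<in> Z \<Longrightarrow> G z = (\<Sum>x\<in>X. fun_scale (z x) (G (E x)))"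
  shows "linear_trace (zero_quotient Z) ((`) G) = (\<Sum>x\<in>X. G (E x) x)"
proof -
  have "Z \<subseteq> fun_space.span (E ` X)"
  proof
    fix z assume "z \<in> Z"
    then have "z = (\<Sum>x\<in>X. fun_scale (z x) (E x))" by (rule E(2))
    also have "\<dots> \<in> fun_space.span (E ` X)"
      by (intro fun_space.span_sum fun_space.span_scale fun_space.span_base imageI)
    finally show "z \<in> fun_space.span (E ` X)" .
  qed
  then obtain B where B: "finite B" "B \<subseteq> Z"
    and indep: "fun_space.independent B" "Z \<subseteq> fun_space.span B"
    and trace: "linear_trace (zero_quotient Z) ((`) G) = (\<Sum>b\<in>B. fun_space.representation B (G b) b)"
    using linear_trace_eq_sum_representation[of "E ` X" G] assms(1) G(1) by blast
  let ?r = "fun_space.representation B"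
  have in_span: "G (E x) \<in> fun_space.span B" if "x \<in> X" for x
    using that G(1) E(1) indep(2) by blast
  have "?r (G b) b = (\<Sum>x\<in>X. b x * ?r (G (E x)) b)" if "b \<in> B" for b
  proof -
    have "?r (G b) b = ?r (\<Sum>x\<in>X. fun_scale (b x) (G (E x))) b"
      using G(2)[of b] that B(2) by auto
    also have "\<dots> = (\<Sum>x\<in>X. ?r (fun_scale (b x) (G (E x))) b)"
      using fun_space.representation_sum[OF indep(1), of X "\<lambda>x. fun_scale (b x) (G (E x))"] in_span
      by (simp add: fun_space.span_scale)
    finally show ?thesis using in_span by (simp add: fun_space.representation_scale[OF indep(1)])
  qed
  then have "linear_trace (zero_quotient Z) ((`) G) = (\<Sum>x\<in>X. \<Sum>b\<in>B. ?r (G (E x)) b * b x)"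
    by (simp add: trace sum.swap[of _ X B] mult.commute)
  also have "\<dots> = (\<Sum>x\<in>X. G (E x) x)"
  proof (rule sum.cong[OF refl])
    fix x assume "x \<in> X"
    then have "G (E x) = (\<Sum>b\<in>B. fun_scale (?r (G (E x)) b) b)"
      using fun_space.sum_representation_eq[OF indep(1) in_span B(1) order_refl] by simp
    from fun_cong[OF this, of x] show "(\<Sum>b\<in>B. ?r (G (E x)) b * b x) = G (E x) x"
      by (simp add: sum_fun_apply fun_scale_def)
  qed
  finally show ?thesis .
qed

end

section \<open>The Hopf trace formula\<close>

lemma length_all_simplices_le:
  assumes "simplices P (Suc r) = {}" "x \<in> all_simplices P"
  shows "length x \<le> r"
proof (rule ccontr)
  assume "\<not> length x \<le> r"
  then have "take (Suc r) x \<in> simplices P (Suc r)"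
    using assms(2) by (auto simp: simplices_def all_simplices_def sorted_wrt_take
      dest: in_set_takeD)
  then show False using assms(1) by blast
qed

lemma subspace_cycles: "fun_space.subspace (cycles P l)"
  by (rule fun_space.subspaceI)
    (auto simp: cycles_def fun_scale_def distrib_right sum.distrib mult.assoc
      sum_distrib_left[symmetric])

lemma cycle_module_eq:
  assumes "finite P"
  shows "cycle_module P (int l - 1) = fun_module (cycles P l)"
proof -
  have fin: "finite (simplices P l)" using assms by (rule finite_simplices)
  have "z \<in> poset_chains P (int l - 1) \<longleftrightarrow> (\<forall>x. x \<notin> simplices P l \<longrightarrow> z x = 0)" for z
    using finite_subset[OF _ fin, of "{xs. z xs \<noteq> 0}"]
    unfolding poset_chains_def order_simplices_eq_simplices by blast
  moreover have "boundary z = (\<lambda>_. 0) \<longleftrightarrow> (\<forall>w. (\<Sum>x\<in>simplices P l. z x * incidence x w) = 0)"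
    if "\<forall>x. x \<notin> simplices P l \<longrightarrow> z x = 0" for z
    using boundary_eq_sum_incidence[OF fin, of z] that by (auto simp: fun_eq_iff)
  ultimately have "{c \<in> poset_chains P (int l - 1). boundary c = (\<lambda>_. 0)} = cycles P l"
    unfolding cycles_def by blast
  then show ?thesis by (simp add: cycle_module_def fun_module_def)
qed

lemma reduced_homology_top:
  assumes "finite P" "simplices P (Suc l) = {}"
  shows "reduced_homology P (int l - 1) = zero_quotient (cycles P l)"
proof -
  have "order_simplices P (int l - 1 + 1) = {}"
    using assms(2) order_simplices_eq_simplices[of P "Suc l"] by simp
  then have "poset_chains P (int l - 1 + 1) = {\<lambda>_. 0}"
    by (auto simp: poset_chains_def fun_eq_iff)
  moreover have "boundary (\<lambda>_. 0) = (\<lambda>_ :: 'a list. 0)" by (simp add: boundary_def)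
  ultimately show ?thesis by (simp add: reduced_homology_def cycle_module_eq[OF assms(1)])
qed

definition is_cycle_projection ::
    "'a::order set \<Rightarrow> nat \<Rightarrow> ('a list \<Rightarrow> 'a list \<Rightarrow> complex) \<Rightarrow> bool" where
  "is_cycle_projection P l E \<longleftrightarrow> (\<forall>x\<in>simplices P l. E x \<in> cycles P l) \<and>
     (\<forall>z\<in>cycles P l. z = (\<Sum>x\<in>simplices P l. fun_scale (z x) (E x)))"

lemma is_cycle_projectionD:
  assumes "is_cycle_projection P l E"
  shows "x \<in> simplices P l \<Longrightarrow> E x \<in> cycles P l"
    and "z \<in> cycles P l \<Longrightarrow> z = (\<Sum>x\<in>simplices P l. fun_scale (z x) (E x))"
    and "z \<in> cycles P l \<Longrightarrow> z y = (\<Sum>x\<in>simplices P l. z x * E x y)"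
proof -
  show "x \<in> simplices P l \<Longrightarrow> E x \<in> cycles P l"
    and rep: "z \<in> cycles P l \<Longrightarrow> z = (\<Sum>x\<in>simplices P l. fun_scale (z x) (E x))"
    using assms by (auto simp: is_cycle_projection_def)
  show "z y = (\<Sum>x\<in>simplices P l. z x * E x y)" if "z \<in> cycles P l"
    using fun_cong[OF rep[OF that], of y] by (simp add: sum_fun_apply fun_scale_def)
qed

text \<open>If the boundary of \<open>H w\<close> is \<open>E w\<close>, then the boundary of \<open>x - H (boundary x)\<close> is
  \<open>boundary x - E (boundary x) = 0\<close>.\<close>

definition complement_projection ::
    "'a::order set \<Rightarrow> nat \<Rightarrow> ('a list \<Rightarrow> 'a list \<Rightarrow> complex) \<Rightarrow> 'a list \<Rightarrow> 'a list \<Rightarrow> complex" where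
  "complement_projection P l H x y =
     (if y \<in> simplices P (Suc l)
      then of_bool (x = y) - (\<Sum>w\<in>simplices P l. incidence x w * H w y) else 0)"

lemma incidence_cycles:
  assumes "finite P" "x \<in> simplices P (Suc l)"
  shows "incidence x \<in> cycles P l"
  using incidence_simplices_eq_0[OF assms(2)] sum_incidence_mult_incidence_eq_0[OF assms]
  by (auto simp: cycles_def)

lemma is_cycle_projection_complement:
  assumes P: "finite P" and E: "is_cycle_projection P l E"
    and H: "\<And>x x'. x \<in> simplices P l \<Longrightarrow> x' \<in> simplices P l \<Longrightarrow>
      E x x' = (\<Sum>y\<in>simplices P (Suc l). H x y * incidence y x')"
  shows "is_cycle_projection P (Suc l) (complement_projection P l H)"
proof -
  let ?X = "simplices P l" and ?Y = "simplices P (Suc l)" and ?E = "complement_projection P l H"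
  have fin: "finite ?Y" using finite_simplices[OF P] .
  have sum_diagonal: "(\<Sum>y\<in>?Y. of_bool (x = y) * h y) = h x" "(\<Sum>y\<in>?Y. h y * of_bool (y = x)) = h x"
    if "x \<in> ?Y" for x and h :: "'a list \<Rightarrow> complex"
    using fin that by (simp_all add: of_bool_def if_distrib if_distribR cong: if_cong)
  have "(\<Sum>y\<in>?Y. ?E x y * incidence y w) = 0" if x: "x \<in> ?Y" for x w
  proof (cases "w \<in> ?X")
    case True
    have "(\<Sum>y\<in>?Y. ?E x y * incidence y w)
      = incidence x w - (\<Sum>v\<in>?X. incidence x v * (\<Sum>y\<in>?Y. H v y * incidence y w))"
      using x
      by (simp add: complement_projection_def left_diff_distrib sum_subtractf sum_distrib_right
          sum_distrib_left mult.assoc sum_diagonal sum.swap[of _ ?Y ?X])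
    also have "(\<Sum>v\<in>?X. incidence x v * (\<Sum>y\<in>?Y. H v y * incidence y w))
      = (\<Sum>v\<in>?X. incidence x v * E v w)"
      using H True by (intro sum.cong) auto
    also have "\<dots> = incidence x w"
      using is_cycle_projectionD(3)[OF E incidence_cycles[OF P x], of w] by simp
    finally show ?thesis by simp
  qed (simp add: incidence_simplices_eq_0)
  then have "?E x \<in> cycles P (Suc l)" if "x \<in> ?Y" for x
    using that by (simp add: cycles_def complement_projection_def)
  moreover have "z = (\<Sum>x\<in>?Y. fun_scale (z x) (?E x))" if z: "z \<in> cycles P (Suc l)" for z
  proof
    fix y
    show "z y = (\<Sum>x\<in>?Y. fun_scale (z x) (?E x)) y"
    proof (cases "y \<in> ?Y")
      case True
      have "(\<Sum>x\<in>?Y. z x * ?E x y) = z y - (\<Sum>w\<in>?X. (\<Sum>x\<in>?Y. z x * incidence x w) * H w y)"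
        using True
        by (simp add: complement_projection_def right_diff_distrib sum_subtractf sum_distrib_right
            sum_distrib_left mult.assoc sum_diagonal sum.swap[of _ ?Y ?X])
      then show ?thesis by (simp add: cyclesD(2)[OF z] sum_fun_apply fun_scale_def)
    qed (simp add: cyclesD(1)[OF z] complement_projection_def sum_fun_apply fun_scale_def)
  qed
  ultimately show ?thesis by (simp add: is_cycle_projection_def)
qed

locale finite_poset_automorphism =
  fixes P :: "'a::order set" and f :: "'a \<Rightarrow> 'a"
  assumes finite_P: "finite P" and bij: "bij_betw f P P" and strict_mono: "strict_mono_on P f"
begin

definition fixed_simplices :: "nat \<Rightarrow> 'a list set" where
  "fixed_simplices l = {x \<in> simplices P l. map f x = x}"

lemma inj_on_map_simplices:
  assumes "x \<in> all_simplices P" "y \<in> all_simplices P"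
  shows "inj_on f (set x \<union> set y)"
  using all_simplicesD(2)[OF assms(1)] all_simplicesD(2)[OF assms(2)] bij
  by (auto simp: bij_betw_def intro: inj_on_subset)

lemma bij_betw_map_simplices: "bij_betw (map f) (simplices P l) (simplices P l)"
proof -
  have inj: "inj_on (map f) (simplices P l)"
    using inj_on_map_simplices inj_on_map_eq_map by (blast intro: inj_onI dest: simplicesD)
  have "map f x \<in> simplices P l" if "x \<in> simplices P l" for x
  proof -
    have x: "sorted_wrt (<) x" "set x \<subseteq> P" "length x = l"
      using that by (auto simp: simplices_def all_simplices_def)
    have "sorted_wrt (<) (map f x)"
      unfolding sorted_wrt_map
      by (rule sorted_wrt_mono_rel[OF _ x(1)]) (use x(2) strict_mono in \<open>blast dest: monotone_onD\<close>)
    then show ?thesis using x bij_betwE[OF bij] by (auto simp: simplices_def all_simplices_def)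
  qed
  then show ?thesis
    using inj endo_inj_surj[OF finite_simplices[OF finite_P] image_subsetI]
    by (auto simp: bij_betw_def)
qed

lemma map_simplices: "x \<in> simplices P l \<Longrightarrow> map f x \<in> simplices P l"
  using bij_betwE[OF bij_betw_map_simplices] by blast

lemma incidence_map_simplices:
  "x \<in> simplices P k \<Longrightarrow> y \<in> simplices P l \<Longrightarrow> incidence (map f x) (map f y) = incidence x y"
  by (intro incidence_map inj_on_map_simplices) (auto dest: simplicesD)

lemma sum_complement_projection_map:
  assumes H: "\<And>x x'. x \<in> simplices P l \<Longrightarrow> x' \<in> simplices P l \<Longrightarrow>
      E x x' = (\<Sum>y\<in>simplices P (Suc l). H x y * incidence y x')"
  shows "(\<Sum>x\<in>simplices P (Suc l). complement_projection P l H (map f x) x)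
    = of_nat (card (fixed_simplices (Suc l))) - (\<Sum>w\<in>simplices P l. E (map f w) w)"
proof -
  let ?X = "simplices P l" and ?Y = "simplices P (Suc l)"
  have fin: "finite ?Y" using finite_simplices[OF finite_P] .
  have "(\<Sum>x\<in>?Y. complement_projection P l H (map f x) x)
    = (\<Sum>x\<in>?Y. of_bool (map f x = x)) - (\<Sum>x\<in>?Y. \<Sum>w\<in>?X. incidence (map f x) w * H w x)"
    by (simp add: complement_projection_def sum_subtractf)
  also have "(\<Sum>x\<in>?Y. of_bool (map f x = x)) = (of_nat (card (fixed_simplices (Suc l))) :: complex)"
    using fin by (simp add: fixed_simplices_def of_bool_def sum.If_cases Int_def)
  also have "(\<Sum>x\<in>?Y. \<Sum>w\<in>?X. incidence (map f x) w * H w x)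
    = (\<Sum>x\<in>?Y. \<Sum>w\<in>?X. H (map f w) x * incidence x w)"
  proof (rule sum.cong[OF refl])
    fix x assume x: "x \<in> ?Y"
    have "(\<Sum>w\<in>?X. incidence (map f x) w * H w x)
      = (\<Sum>w\<in>?X. incidence (map f x) (map f w) * H (map f w) x)"
      using sum.reindex_bij_betw[OF bij_betw_map_simplices,
          of "\<lambda>w. incidence (map f x) w * H w x"] by simp
    also have "\<dots> = (\<Sum>w\<in>?X. H (map f w) x * incidence x w)"
      using x by (intro sum.cong refl) (simp add: incidence_map_simplices)
    finally show "(\<Sum>w\<in>?X. incidence (map f x) w * H w x) = (\<Sum>w\<in>?X. H (map f w) x * incidence x w)" .
  qed
  also have "\<dots> = (\<Sum>w\<in>?X. \<Sum>x\<in>?Y. H (map f w) x * incidence x w)" by (rule sum.swap)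
  also have "\<dots> = (\<Sum>w\<in>?X. E (map f w) w)"
    by (intro sum.cong refl) (simp add: H map_simplices)
  finally show ?thesis .
qed

lemma ex_cycle_projection_trace:
  assumes "\<And>k. k < l \<Longrightarrow> exact_at P k"
  shows "\<exists>E. is_cycle_projection P l E \<and> (\<Sum>x\<in>simplices P l. E (map f x) x)
    = (\<Sum>j\<le>l. (-1) ^ (l + j) * of_nat (card (fixed_simplices j)))"
  using assms
proof (induction l)
  case 0
  have empty: "simplices P 0 = {[]}" by (auto simp: simplices_def all_simplices_def)
  define E where "E x y = (of_bool (y = []) :: complex)" for x y :: "'a list"
  have "is_cycle_projection P 0 E"
    by (auto simp: is_cycle_projection_def cycles_def empty E_def incidence_def fun_scale_def
      fun_eq_iff)
  moreover have "fixed_simplices 0 = {[]}" by (auto simp: fixed_simplices_def empty)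
  moreover have "(\<Sum>x\<in>simplices P 0. E (map f x) x) = 1" by (simp add: empty E_def)
  ultimately show ?case by (intro exI[of _ E]) simp
next
  case (Suc l)
  obtain E where E: "is_cycle_projection P l E"
    and trace: "(\<Sum>x\<in>simplices P l. E (map f x) x)
      = (\<Sum>j\<le>l. (-1) ^ (l + j) * of_nat (card (fixed_simplices j)))"
    using Suc by auto
  have "\<exists>y. \<forall>x'\<in>simplices P l. E x x' = (\<Sum>y'\<in>simplices P (Suc l). y y' * incidence y' x')"
    if "x \<in> simplices P l" for x
    using Suc.prems[of l] is_cycle_projectionD(1)[OF E that] by (simp add: exact_at_def)
  then obtain H where H: "\<And>x x'. x \<in> simplices P l \<Longrightarrow> x' \<in> simplices P l \<Longrightarrow>
      E x x' = (\<Sum>y\<in>simplices P (Suc l). H x y * incidence y x')" by metis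
  show ?case
    using is_cycle_projection_complement[OF finite_P E H]
      sum_complement_projection_map[of l E H, OF H] trace
    by (intro exI[of _ "complement_projection P l H"]) (simp add: sum_negf)
qed

lemma chain_map_apply:
  assumes "z \<in> cycles P l" "x \<in> simplices P l"
  shows "chain_map f z (map f x) = z x"
proof -
  have "{y. z y \<noteq> 0 \<and> map f y = map f x} = (if z x = 0 then {} else {x})"
    using assms(2) cyclesD(1)[OF assms(1)] bij_betw_imp_inj_on[OF bij_betw_map_simplices]
    by (auto dest: inj_onD)
  then show ?thesis by (simp add: chain_map_def)
qed

lemma chain_map_eq_0:
  assumes "z \<in> cycles P l" "w \<notin> simplices P l"
  shows "chain_map f z w = 0"
proof -
  have "{y. z y \<noteq> 0 \<and> map f y = w} = {}"
    using assms(2) cyclesD(1)[OF assms(1)] map_simplices by blast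
  then show ?thesis by (simp only: chain_map_def sum.empty)
qed

lemma chain_map_cycles:
  assumes z: "z \<in> cycles P l"
  shows "chain_map f z \<in> cycles P l"
proof -
  have "(\<Sum>x\<in>simplices P l. chain_map f z x * incidence x w) = 0" for w
  proof (cases "\<exists>k. l = Suc k \<and> w \<in> simplices P k")
    case True
    then obtain k v where v: "w = map f v" "v \<in> simplices P k"
      using bij_betw_imp_surj_on[OF bij_betw_map_simplices] by blast
    have "(\<Sum>x\<in>simplices P l. chain_map f z x * incidence x w)
      = (\<Sum>x\<in>simplices P l. chain_map f z (map f x) * incidence (map f x) w)"
      by (rule sum.reindex_bij_betw[OF bij_betw_map_simplices, symmetric])
    also have "\<dots> = (\<Sum>x\<in>simplices P l. z x * incidence x v)"
      using v by (intro sum.cong refl) (simp add: chain_map_apply[OF z] incidence_map_simplices)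
    finally show ?thesis using cyclesD(2)[OF z] by simp
  next
    case False
    have "incidence x w = 0" if "x \<in> simplices P l" for x
      using that False incidence_simplices_eq_0[of x P _ w]
      by (cases l) (auto simp: simplices_def incidence_def)
    then show ?thesis by simp
  qed
  then show ?thesis using chain_map_eq_0[OF z] by (simp add: cycles_def)
qed

lemma chain_map_cycle_expansion:
  assumes E: "is_cycle_projection P l E" and z: "z \<in> cycles P l"
  shows "chain_map f z = (\<Sum>x\<in>simplices P l. fun_scale (z x) (chain_map f (E x)))"
proof
  fix w
  note EX = is_cycle_projectionD[OF E]
  show "chain_map f z w = (\<Sum>x\<in>simplices P l. fun_scale (z x) (chain_map f (E x))) w"
  proof (cases "w \<in> simplices P l")
    case True
    then obtain v where v: "w = map f v" "v \<in> simplices P l"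
      using bij_betw_imp_surj_on[OF bij_betw_map_simplices] by blast
    have "chain_map f z w = (\<Sum>x\<in>simplices P l. z x * E x v)"
      using chain_map_apply[OF z v(2)] v(1) EX(3)[OF z, of v] by simp
    also have "\<dots> = (\<Sum>x\<in>simplices P l. z x * chain_map f (E x) w)"
      using v by (intro sum.cong refl) (simp add: chain_map_apply[OF EX(1)])
    finally show ?thesis by (simp add: sum_fun_apply fun_scale_def)
  next
    case False
    then show ?thesis
      by (simp add: chain_map_eq_0[OF z] chain_map_eq_0[OF EX(1)] sum_fun_apply fun_scale_def)
  qed
qed

theorem hopf_trace:
  assumes top: "simplices P (Suc r) = {}" and exact: "\<And>l. l < r \<Longrightarrow> exact_at P l"
  shows "linear_trace (reduced_homology P (int r - 1)) (homology_map f)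
    = (\<Sum>c | c \<in> all_simplices P \<and> map f c = c. (-1) ^ (r + length c))"
proof -
  let ?X = "simplices P r"
  obtain E where E: "is_cycle_projection P r E" and trace: "(\<Sum>x\<in>?X. E (map f x) x)
      = (\<Sum>j\<le>r. (-1) ^ (r + j) * of_nat (card (fixed_simplices j)))"
    using ex_cycle_projection_trace exact by blast
  note EX = is_cycle_projectionD[OF E]
  have "linear_trace (reduced_homology P (int r - 1)) (homology_map f)
    = (\<Sum>x\<in>?X. chain_map f (E x) x)"
    using linear_trace_zero_quotient[OF subspace_cycles finite_simplices[OF finite_P] EX(1,2)
        chain_map_cycles chain_map_cycle_expansion[OF E]]
    by (simp add: reduced_homology_top[OF finite_P top] homology_map_def[abs_def])
  also have "\<dots> = (\<Sum>x\<in>?X. chain_map f (E (map f x)) (map f x))"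
    by (rule sum.reindex_bij_betw[OF bij_betw_map_simplices, symmetric])
  also have "\<dots> = (\<Sum>x\<in>?X. E (map f x) x)"
    by (intro sum.cong refl) (simp add: chain_map_apply[OF EX(1)] map_simplices)
  also note trace
  also have "(\<Sum>j\<le>r. (-1) ^ (r + j) * of_nat (card (fixed_simplices j)))
    = (\<Sum>j\<le>r. \<Sum>c\<in>fixed_simplices j. (-1) ^ (r + length c) :: complex)"
    by (intro sum.cong refl) (auto simp: fixed_simplices_def simplices_def)
  also have "\<dots> = (\<Sum>c\<in>(\<Union>j\<le>r. fixed_simplices j). (-1) ^ (r + length c))"
    using finite_all_simplices[OF finite_P]
    by (intro sum.UNION_disjoint[symmetric]) (auto simp: fixed_simplices_def simplices_def)
  also have "(\<Union>j\<le>r. fixed_simplices j) = {c. c \<in> all_simplices P \<and> map f c = c}"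
    using length_all_simplices_le[OF top] by (auto simp: fixed_simplices_def simplices_def)
  finally show ?thesis .
qed

end

section \<open>Chains separated by a family of sets\<close>

definition toggle :: "'a \<Rightarrow> 'a set \<Rightarrow> 'a set" where
  "toggle x c = (if x \<in> c then c - {x} else insert x c)"

lemma toggle_toggle [simp]: "toggle x (toggle x c) = c"
  by (auto simp: toggle_def)

lemma self_mem_toggle_iff [simp]: "x \<in> toggle x c \<longleftrightarrow> x \<notin> c"
  by (simp add: toggle_def)

lemma toggle_subset: "toggle x c \<subseteq> insert x c"
  by (auto simp: toggle_def)

lemma minus_one_power_card_toggle:
  assumes "finite c"
  shows "(-1) ^ card (toggle x c) = - ((-1) ^ card c :: 'r::ring_1)"
proof (cases "x \<in> c")
  case True
  then have "card c = Suc (card (toggle x c))"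
    using assms by (metis toggle_def card_Suc_Diff1)
  then show ?thesis by simp
qed (use assms in \<open>simp add: toggle_def\<close>)

locale separating_family =
  fixes P :: "'a::order set" and sep :: "'a \<Rightarrow> 'i set"
  assumes finite_P: "finite P" and finite_sep: "x \<in> P \<Longrightarrow> finite (sep x)"
    and redundant_pair: "\<lbrakk>c \<subseteq> P; is_chain c; a \<in> c; b \<in> c; a \<noteq> b;
        sep a \<subseteq> \<Union> (sep ` (c - {a})); sep b \<subseteq> \<Union> (sep ` (c - {b}))\<rbrakk>
      \<Longrightarrow> sep a \<subseteq> \<Union> (sep ` (c - {a, b}))"
    and redundant_comparable: "\<lbrakk>c \<subseteq> P; a \<in> P; b \<in> P; is_chain (insert a c); is_chain (insert b c);
        sep a \<subseteq> \<Union> (sep ` c); sep b \<subseteq> \<Union> (sep ` c)\<rbrakk> \<Longrightarrow> a \<le> b \<or> b \<le> a"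
begin

definition separated :: "'a set \<Rightarrow> 'i set" where
  "separated c = \<Union> (sep ` c)"

definition free :: "'a set \<Rightarrow> 'a set" where
  "free c = {x \<in> P. is_chain (insert x c) \<and> sep x \<subseteq> separated (c - {x})}"

lemma freeD:
  assumes "x \<in> free c"
  shows "x \<in> P" "is_chain (insert x c)" "sep x \<subseteq> separated (c - {x})" "sep x \<subseteq> separated c"
  using assms by (auto simp: free_def separated_def)

lemma separated_toggle:
  assumes "a \<in> free c"
  shows "separated (toggle a c) = separated c"
proof -
  have "separated c \<subseteq> sep a \<union> separated (c - {a})" by (auto simp: separated_def)
  then show ?thesis using freeD(3,4)[OF assms] by (auto simp: toggle_def separated_def)
qed

lemma toggle_free_chain:
  assumes "c \<subseteq> P" "a \<in> free c"
  shows "toggle a c \<subseteq> P" "is_chain (toggle a c)"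
  using assms toggle_subset[of a c] freeD(1,2)[OF assms(2)] chain_subset by blast+

lemma free_insert_subset:
  assumes subset: "c \<subseteq> P" and a: "a \<in> free c" "a \<notin> c"
  shows "free (insert a c) \<subseteq> free c"
proof
  fix b assume b: "b \<in> free (insert a c)"
  show "b \<in> free c"
  proof (cases "b = a")
    case False
    let ?d = "insert b (insert a c)"
    have d: "is_chain ?d" "sep b \<subseteq> separated (insert a c - {b})" "b \<in> P"
      using freeD[OF b] by auto
    have "sep b \<subseteq> \<Union> (sep ` (?d - {b, a}))"
    proof (rule redundant_pair[OF _ d(1)])
      show "?d \<subseteq> P" using subset d(3) freeD(1)[OF a(1)] by simp
      show "sep b \<subseteq> \<Union> (sep ` (?d - {b}))" using d(2) by (simp add: separated_def)
      show "sep a \<subseteq> \<Union> (sep ` (?d - {a}))"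
        using freeD(4)[OF a(1)] a(2) by (auto simp: separated_def)
    qed (use False in auto)
    moreover have "?d - {b, a} = c - {b}" using a(2) by auto
    moreover have "is_chain (insert b c)" using chain_subset[OF d(1)] by auto
    ultimately show ?thesis using d(3) by (simp add: free_def separated_def)
  qed (simp add: a)
qed

lemma free_subset_free_insert:
  assumes subset: "c \<subseteq> P" and a: "a \<in> free c" "a \<notin> c"
  shows "free c \<subseteq> free (insert a c)"
proof
  fix b assume b: "b \<in> free c"
  have "a \<le> b \<or> b \<le> a"
    using redundant_comparable[OF subset] freeD[OF a(1)] freeD[OF b] by (simp add: separated_def)
  then have "is_chain (insert b (insert a c))"
    using freeD(2)[OF a(1)] freeD(2)[OF b] by (auto simp: Complete_Partial_Order.chain_def)
  moreover have "separated (c - {b}) \<subseteq> separated (insert a c - {b})" by (auto simp: separated_def)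
  ultimately show "b \<in> free (insert a c)" using freeD[OF b] by (auto simp: free_def)
qed

lemma free_toggle:
  assumes "c \<subseteq> P" "a \<in> free c"
  shows "free (toggle a c) = free c"
proof -
  have free_insert: "free (insert a d) = free d" if "d \<subseteq> P" "a \<in> free d" "a \<notin> d" for d
    using free_insert_subset[OF that] free_subset_free_insert[OF that] by (rule subset_antisym)
  show ?thesis
  proof (cases "a \<in> c")
    case True
    then have "a \<in> free (c - {a})" using assms(2) by (simp add: free_def insert_absorb)
    then have "free (insert a (c - {a})) = free (c - {a})"
      using assms(1) by (intro free_insert) auto
    then show ?thesis using True by (simp add: toggle_def insert_absorb)
  qed (use free_insert assms in \<open>simp add: toggle_def\<close>)
qed

definition pivot :: "'a set \<Rightarrow> 'a" where
  "pivot c = (SOME x. x \<in> free c)"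

definition partner :: "'a set \<Rightarrow> 'a set" where
  "partner c = toggle (pivot c) c"

definition matched_chains :: "'a set set" where
  "matched_chains = {c. c \<subseteq> P \<and> is_chain c \<and> free c \<noteq> {}}"

definition critical_chains :: "'a set set" where
  "critical_chains = {c. c \<subseteq> P \<and> is_chain c \<and> free c = {}}"

lemma matched_chainsD:
  assumes "c \<in> matched_chains"
  shows "c \<subseteq> P" "is_chain c" "free c \<noteq> {}" "pivot c \<in> free c" "finite c"
  using assms finite_subset[OF _ finite_P] by (auto simp: matched_chains_def pivot_def some_in_eq)

lemma partner_properties:
  assumes "c \<in> matched_chains"
  shows "partner c \<in> matched_chains" "pivot (partner c) = pivot c" "partner (partner c) = c"
    "separated (partner c) = separated c" "pivot c \<in> partner c \<longleftrightarrow> pivot c \<notin> c"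
proof -
  note c = matched_chainsD[OF assms]
  have free: "free (partner c) = free c" using free_toggle c by (simp add: partner_def)
  then show "partner c \<in> matched_chains"
    using toggle_free_chain[OF c(1,4)] c(3) by (simp add: matched_chains_def partner_def)
  show pivot: "pivot (partner c) = pivot c" using free by (simp add: pivot_def)
  show "partner (partner c) = c" using pivot by (simp add: partner_def)
  show "separated (partner c) = separated c" "pivot c \<in> partner c \<longleftrightarrow> pivot c \<notin> c"
    using separated_toggle[OF c(4)] by (simp_all add: partner_def)
qed

lemma sum_matched_chains_eq_0:
  fixes g :: "'i set \<Rightarrow> 'r::comm_ring_1"
  shows "(\<Sum>c\<in>matched_chains. (-1) ^ card c * g (separated c)) = 0"
proof -
  let ?f = "\<lambda>c. (-1) ^ card c * g (separated c)"
  let ?lower = "{c \<in> matched_chains. pivot c \<notin> c}" and ?upper = "{c \<in> matched_chains. pivot c \<in> c}"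
  have "finite matched_chains"
    by (rule finite_subset[of _ "Pow P"]) (use finite_P in \<open>auto simp: matched_chains_def\<close>)
  then have "(\<Sum>c\<in>matched_chains. ?f c) = (\<Sum>c\<in>?lower. ?f c) + (\<Sum>c\<in>?upper. ?f c)"
    by (subst sum.union_disjoint[symmetric]) (auto intro: sum.cong)
  also have "(\<Sum>c\<in>?upper. ?f c) = (\<Sum>c\<in>?lower. ?f (partner c))"
    by (rule sum.reindex_bij_witness[of _ partner partner]) (auto simp: partner_properties)
  also have "\<dots> = - (\<Sum>c\<in>?lower. ?f c)"
    unfolding sum_negf[symmetric]
  proof (rule sum.cong[OF refl])
    fix c assume "c \<in> ?lower"
    then have matched: "c \<in> matched_chains" by simp
    show "?f (partner c) = - ?f c"
      using matched_chainsD(5)[OF matched] partner_properties(4)[OF matched]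
      by (simp add: partner_def minus_one_power_card_toggle)
  qed
  finally show ?thesis by simp
qed

theorem sum_chains_eq_sum_critical_chains:
  fixes g :: "'i set \<Rightarrow> 'r::comm_ring_1"
  shows "(\<Sum>c | c \<subseteq> P \<and> is_chain c. (-1) ^ card c * g (separated c))
    = (\<Sum>c\<in>critical_chains. (-1) ^ card c * g (separated c))"
proof -
  have "finite {c. c \<subseteq> P \<and> is_chain c}" using finite_P by simp
  moreover have split: "{c. c \<subseteq> P \<and> is_chain c} = critical_chains \<union> matched_chains"
    by (auto simp: critical_chains_def matched_chains_def)
  ultimately show ?thesis
    unfolding split
    by (subst sum.union_disjoint)
      (auto simp: sum_matched_chains_eq_0, auto simp: critical_chains_def matched_chains_def)
qed

text \<open>Since \<open>card (separated c)\<close> is constant on matched pairs, its strict decrease along the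
  other descents makes the matching acyclic.\<close>

lemma card_separated_remove_less:
  assumes matched: "c \<in> matched_chains" "pivot c \<in> c" and e: "e \<in> c"
    and lower: "pivot (c - {e}) \<notin> c - {e}" and ne: "c - {e} \<noteq> partner c"
  shows "card (separated (c - {e})) < card (separated c)"
proof (rule ccontr)
  note chain = matched_chainsD[OF matched(1)]
  assume "\<not> ?thesis"
  moreover have "separated (c - {e}) \<subseteq> separated c" by (auto simp: separated_def)
  moreover have "finite (separated c)"
    using chain(1,5) finite_sep by (auto simp: separated_def)
  ultimately have "separated (c - {e}) = separated c" by (meson card_seteq not_le)
  then have "sep e \<subseteq> separated (c - {e})" using e by (auto simp: separated_def)
  then have "e \<in> free c" using chain(1,2) e by (auto simp: free_def insert_absorb)
  then have "free (c - {e}) = free c"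
    using free_toggle[OF chain(1), of e] e by (simp add: toggle_def)
  then have "pivot (c - {e}) = pivot c" by (simp add: pivot_def)
  then have "e = pivot c" using lower matched(2) by auto
  then show False using ne matched(2) by (simp add: partner_def toggle_def)
qed

lemma card_separated_less_partner:
  assumes matched: "c \<in> matched_chains" "pivot c \<notin> c" and d: "pivot d \<notin> d" "d \<noteq> c"
    and e: "e \<in> partner c" "d = partner c - {e}"
  shows "card (separated d) < card (separated c)"
  using card_separated_remove_less[of "partner c" e] partner_properties[OF matched(1)] matched(2)
    d e by simp

lemma card_separated_partner_less:
  assumes matched: "c \<in> matched_chains" "pivot c \<in> c"
    and d: "d \<in> matched_chains" "pivot d \<in> d" "d \<noteq> c"
    and e: "e \<in> c" "partner d = c - {e}"
  shows "card (separated d) < card (separated c)"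
proof -
  have "partner d \<noteq> partner c"
    using partner_properties(3)[OF matched(1)] partner_properties(3)[OF d(1)] d(3) by metis
  moreover have "pivot (partner d) \<notin> partner d" using partner_properties[OF d(1)] d(2) by simp
  ultimately show ?thesis
    using card_separated_remove_less[OF matched e(1)] partner_properties(4)[OF d(1)] e(2) by simp
qed

definition partner_list :: "'a list \<Rightarrow> 'a list" where
  "partner_list xs = list_of_chain (partner (set xs))"

lemma incidence_iff_remove:
  assumes "xs \<in> all_simplices P" "ys \<in> all_simplices P"
  shows "incidence xs ys \<noteq> 0 \<longleftrightarrow> (\<exists>e\<in>set xs. set ys = set xs - {e})"
  using incidence_nonzero_iff[OF all_simplicesD(1)[OF assms(1)], of ys]
    all_simplicesD(1)[OF assms(2)]
  by blast

lemma partner_list: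
  assumes xs: "xs \<in> all_simplices P" and matched: "set xs \<in> matched_chains"
  shows partner_list_all_simplices: "partner_list xs \<in> all_simplices P"
    and set_partner_list: "set (partner_list xs) = partner (set xs)"
    and length_partner_list: "pivot (set xs) \<notin> set xs \<Longrightarrow> length (partner_list xs) = Suc (length xs)"
    and incidence_partner_list:
      "pivot (set xs) \<notin> set xs \<Longrightarrow> incidence (partner_list xs) xs \<noteq> 0"
      "pivot (set xs) \<in> set xs \<Longrightarrow> incidence xs (partner_list xs) \<noteq> 0"
proof -
  note partner = matched_chainsD[OF partner_properties(1)[OF matched]]
  show all: "partner_list xs \<in> all_simplices P" and set: "set (partner_list xs) = partner (set xs)"
    using list_of_chain[OF partner(5,2)] partner(1)
    by (auto simp: partner_list_def all_simplices_def)
  show "length (partner_list xs) = Suc (length xs)" if "pivot (set xs) \<notin> set xs"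
    using that all_simplicesD(4)[OF all] all_simplicesD(4)[OF xs] set
    by (simp add: partner_def toggle_def)
  show "incidence (partner_list xs) xs \<noteq> 0" if "pivot (set xs) \<notin> set xs"
    using that set by (auto simp: incidence_iff_remove[OF all xs] partner_def toggle_def)
  show "incidence xs (partner_list xs) \<noteq> 0" if "pivot (set xs) \<in> set xs"
    using that set by (auto simp: incidence_iff_remove[OF xs all] partner_def toggle_def)
qed

theorem exact_at_if_free:
  assumes "\<And>c. c \<subseteq> P \<Longrightarrow> is_chain c \<Longrightarrow> card c = l \<Longrightarrow> free c \<noteq> {}"
  shows "exact_at P l"
  unfolding exact_at_def
proof
  fix z assume z: "z \<in> cycles P l"
  let ?X = "simplices P l" and ?Y = "simplices P (Suc l)"
  define Up where "Up = {xs \<in> ?X. pivot (set xs) \<notin> set xs}"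
  have all: "xs \<in> all_simplices P" if "xs \<in> ?X" for xs using that by (rule simplicesD)
  have matched: "set xs \<in> matched_chains" if "xs \<in> ?X" for xs
    using assms[of "set xs"] all_simplicesD[OF all[OF that]] simplicesD(2)[OF that]
    by (simp add: matched_chains_def)
  have inject: "set xs \<noteq> set ys" if "xs \<in> ?X" "ys \<in> ?X" "xs \<noteq> ys" for xs ys
    using that sorted_wrt_less_set_inject all_simplicesD(1)[OF all] by blast
  show "\<exists>y. \<forall>x\<in>?X. z x = (\<Sum>y'\<in>?Y. y y' * incidence y' x)"
  proof (rule exact_if_acyclic_matching[where Up = Up and up = partner_list and down = partner_list
        and rk = "\<lambda>xs. card (separated (set xs))", OF finite_simplices finite_simplices])
    fix xs assume "xs \<in> Up"
    then have xs: "xs \<in> ?X" "pivot (set xs) \<notin> set xs" by (auto simp: Up_def)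
    note partner = partner_list[OF all[OF xs(1)] matched[OF xs(1)]]
    show "partner_list xs \<in> ?Y" "incidence (partner_list xs) xs \<noteq> 0"
      using partner(1,3,4) xs(2) simplicesD(2)[OF xs(1)] by (simp_all add: simplices_def)
    fix ys assume ys: "ys \<in> Up" "xs \<noteq> ys" and inc: "incidence (partner_list xs) ys \<noteq> 0"
    then have ysX: "ys \<in> ?X" "pivot (set ys) \<notin> set ys" by (auto simp: Up_def)
    obtain e where "e \<in> partner (set xs)" "set ys = partner (set xs) - {e}"
      using inc incidence_iff_remove[OF partner(1) all[OF ysX(1)]] partner(2) by auto
    then show "card (separated (set ys)) < card (separated (set xs))"
      using inject[OF xs(1) ysX(1) ys(2)]
      by (intro card_separated_less_partner[OF matched[OF xs(1)] xs(2) ysX(2)]) auto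
  next
    fix xs assume "xs \<in> ?X - Up"
    then have xs: "xs \<in> ?X" "pivot (set xs) \<in> set xs" by (auto simp: Up_def)
    show "incidence xs (partner_list xs) \<noteq> 0"
      using incidence_partner_list(2)[OF all[OF xs(1)] matched[OF xs(1)]] xs(2) .
    fix ys assume ys: "ys \<in> ?X - Up" "xs \<noteq> ys" and inc: "incidence xs (partner_list ys) \<noteq> 0"
    then have ysX: "ys \<in> ?X" "pivot (set ys) \<in> set ys" by (auto simp: Up_def)
    note partner = partner_list[OF all[OF ysX(1)] matched[OF ysX(1)]]
    obtain e where "e \<in> set xs" "partner (set ys) = set xs - {e}"
      using inc incidence_iff_remove[OF all[OF xs(1)] partner(1)] partner(2) by auto
    then show "card (separated (set ys)) < card (separated (set xs))"
      using inject[OF xs(1) ysX(1) ys(2)]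
      by (intro card_separated_partner_less[OF matched[OF xs(1)] xs(2) matched[OF ysX(1)] ysX(2)])
         auto
  qed (use sum_incidence_mult_incidence_eq_0[OF finite_P] cyclesD(2)[OF z] finite_P in
      \<open>auto simp: Up_def\<close>)
qed

end

section \<open>Inversions across a cut\<close>

definition cut_inversions :: "'a::linorder set \<Rightarrow> 'a set \<Rightarrow> ('a \<times> 'a) set" where
  "cut_inversions A S = {(x, y). x \<in> S \<and> y \<in> A - S \<and> y < x}"

lemma cut_inversions_iff: "(x, y) \<in> cut_inversions A S \<longleftrightarrow> x \<in> S \<and> y \<in> A - S \<and> y < x"
  by (simp add: cut_inversions_def)

lemma cut_inversions_empty [simp]: "cut_inversions A {} = {}"
  and cut_inversions_full [simp]: "cut_inversions A A = {}"
  by (auto simp: cut_inversions_def)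

lemma finite_cut_inversions: "finite A \<Longrightarrow> S \<subseteq> A \<Longrightarrow> finite (cut_inversions A S)"
  by (rule finite_subset[of _ "A \<times> A"]) (auto simp: cut_inversions_def)

lemma cut_inversions_insert_Min:
  assumes "finite U" "L \<subset> U"
  shows "cut_inversions A (insert (Min (U - L)) L) \<subseteq> cut_inversions A L \<union> cut_inversions A U"
proof -
  have "Min (U - L) \<in> U" "\<And>y. y \<in> U \<Longrightarrow> y \<notin> L \<Longrightarrow> Min (U - L) \<le> y"
    using assms Min_in[of "U - L"] by auto
  then show ?thesis by (fastforce simp: cut_inversions_def)
qed

lemma cut_inversions_common:
  assumes C: "is_chain C" "C \<subseteq> Pow A" and S: "S \<in> C" and T: "T \<in> C" and less: "T \<subset> S"
    and redundant: "cut_inversions A S \<subseteq> \<Union> (cut_inversions A ` (C - {S}))"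
      "cut_inversions A T \<subseteq> \<Union> (cut_inversions A ` (C - {T}))"
  shows "cut_inversions A S \<inter> cut_inversions A T \<subseteq> \<Union> (cut_inversions A ` (C - {S, T}))"
proof (intro subsetI, elim IntE)
  fix p assume p: "p \<in> cut_inversions A S" "p \<in> cut_inversions A T"
  then obtain x y where xy: "p = (x, y)" "x \<in> T" "y \<in> A - S" "y < x"
    by (auto simp: cut_inversions_def)
  obtain z where z: "z \<in> S" "z \<notin> T" "z \<in> A" using less S C(2) by blast
  consider (below) "z < x" | (above) "y < z" using xy(4) by force
  then show "p \<in> \<Union> (cut_inversions A ` (C - {S, T}))"
  proof cases
    case below
    then have "(x, z) \<in> cut_inversions A T" using xy z by (simp add: cut_inversions_iff)
    then obtain U where U: "U \<in> C" "U \<noteq> T" "x \<in> U" "z \<notin> U"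
      using redundant(2) by (auto simp: cut_inversions_def)
    then have "U \<subseteq> S" "U \<noteq> S" using chainD[OF C(1) U(1) S] z by auto
    then have "p \<in> cut_inversions A U" using xy U by (auto simp: cut_inversions_def)
    then show ?thesis using U \<open>U \<noteq> S\<close> by blast
  next
    case above
    then have "(z, y) \<in> cut_inversions A S" using xy z by (simp add: cut_inversions_iff)
    then obtain U where U: "U \<in> C" "U \<noteq> S" "z \<in> U" "y \<notin> U"
      using redundant(1) by (auto simp: cut_inversions_def)
    then have "T \<subseteq> U" "U \<noteq> T" using chainD[OF C(1) U(1) T] z by auto
    then have "p \<in> cut_inversions A U" using xy U by (auto simp: cut_inversions_def)
    then show ?thesis using U \<open>U \<noteq> T\<close> by blast
  qed
qed

lemma cut_inversions_redundant_pair: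
  assumes C: "is_chain C" "C \<subseteq> Pow A" and S: "S \<in> C" and T: "T \<in> C" and "S \<noteq> T"
    and redundant: "cut_inversions A S \<subseteq> \<Union> (cut_inversions A ` (C - {S}))"
      "cut_inversions A T \<subseteq> \<Union> (cut_inversions A ` (C - {T}))"
  shows "cut_inversions A S \<subseteq> \<Union> (cut_inversions A ` (C - {S, T}))"
proof -
  have "T \<subset> S \<or> S \<subset> T" using chainD[OF C(1) S T] \<open>S \<noteq> T\<close> by auto
  then have common: "cut_inversions A S \<inter> cut_inversions A T \<subseteq> \<Union> (cut_inversions A ` (C - {S, T}))"
    using cut_inversions_common[OF C S T _ redundant]
      cut_inversions_common[OF C T S _ redundant(2,1)]
    by (auto simp: insert_commute Int_commute)
  show ?thesis
  proof
    fix p assume p: "p \<in> cut_inversions A S"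
    then obtain U where "U \<in> C - {S}" "p \<in> cut_inversions A U" using redundant(1) by blast
    then have "p \<in> cut_inversions A T \<or> p \<in> \<Union> (cut_inversions A ` (C - {S, T}))"
      by (cases "U = T") auto
    then show "p \<in> \<Union> (cut_inversions A ` (C - {S, T}))" using subsetD[OF common IntI[OF p]] by blast
  qed
qed

lemma cut_inversions_redundant_comparable:
  assumes "S \<subseteq> A" "T \<subseteq> A" and chain: "is_chain (insert S C)" "is_chain (insert T C)"
    and redundant: "cut_inversions A S \<subseteq> \<Union> (cut_inversions A ` C)"
      "cut_inversions A T \<subseteq> \<Union> (cut_inversions A ` C)"
  shows "S \<subseteq> T \<or> T \<subseteq> S"
proof (rule ccontr)
  assume "\<not> ?thesis"
  then obtain x y where xy: "x \<in> S" "x \<notin> T" "y \<in> T" "y \<notin> S" by blast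
  have comparable: "U \<subseteq> S \<or> S \<subseteq> U" "U \<subseteq> T \<or> T \<subseteq> U" if "U \<in> C" for U
    using that chainD[OF chain(1), of U S] chainD[OF chain(2), of U T] by auto
  consider (S_inversion) "y < x" | (T_inversion) "x < y" using xy by fastforce
  then show False
  proof cases
    case S_inversion
    then have "(x, y) \<in> cut_inversions A S" using xy assms(2) by (auto simp: cut_inversions_def)
    then obtain U where "U \<in> C" "x \<in> U" "y \<notin> U"
      using redundant(1) by (auto simp: cut_inversions_def)
    then show False using comparable(2) xy by blast
  next
    case T_inversion
    then have "(y, x) \<in> cut_inversions A T" using xy assms(1) by (auto simp: cut_inversions_def)
    then obtain U where "U \<in> C" "y \<in> U" "x \<notin> U"
      using redundant(2) by (auto simp: cut_inversions_def)
    then show False using comparable(1) xy by blast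
  qed
qed

section \<open>The Segre product of two Boolean lattices\<close>

definition segre_lattice :: "'a set \<Rightarrow> 'b set \<Rightarrow> ('a set \<times> 'b set) set" where
  "segre_lattice A B = {(S, T). S \<subseteq> A \<and> T \<subseteq> B \<and> card S = card T}"

definition segre_interior :: "'a set \<Rightarrow> 'b set \<Rightarrow> ('a set \<times> 'b set) set" where
  "segre_interior A B = {x \<in> segre_lattice A B. 0 < card (fst x) \<and> card (fst x) < card A}"

lemma segre_lattice_iff:
  "x \<in> segre_lattice A B \<longleftrightarrow> fst x \<subseteq> A \<and> snd x \<subseteq> B \<and> card (fst x) = card (snd x)"
  by (cases x) (simp add: segre_lattice_def)

lemma segre_interior_iff:
  "x \<in> segre_interior A B \<longleftrightarrow> fst x \<subseteq> A \<and> snd x \<subseteq> B \<and> card (fst x) = card (snd x) \<and>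
     0 < card (fst x) \<and> card (fst x) < card A"
  by (simp add: segre_interior_def segre_lattice_iff)

lemma segre_interior_subset: "segre_interior A B \<subseteq> segre_lattice A B"
  by (auto simp: segre_interior_def)

lemma finite_segre_interior: "finite A \<Longrightarrow> finite B \<Longrightarrow> finite (segre_interior A B)"
  by (rule finite_subset[of _ "Pow A \<times> Pow B"]) (auto simp: segre_interior_iff)

lemma segre_lattice_finite:
  assumes "finite A" "finite B" "x \<in> segre_lattice A B"
  shows "finite (fst x)" "finite (snd x)"
  using assms finite_subset by (auto simp: segre_lattice_iff)

lemma segre_lattice_less:
  assumes fin: "finite A" "finite B" and x: "x \<in> segre_lattice A B" and y: "y \<in> segre_lattice A B"
    and "x < y"
  shows "fst x \<subset> fst y" "snd x \<subset> snd y" "card (fst x) < card (fst y)"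
proof -
  have subsets: "fst x \<subseteq> fst y" "snd x \<subseteq> snd y" and neq: "x \<noteq> y"
    using \<open>x < y\<close> by (auto simp: less_le less_eq_prod_def)
  have "card (fst x) = card (snd x)" "card (fst y) = card (snd y)"
    using x y by (auto simp: segre_lattice_iff)
  then show "fst x \<subset> fst y" "snd x \<subset> snd y"
    using subsets neq segre_lattice_finite[OF fin y] by (metis card_subset_eq prod_eqI psubsetI)+
  then show "card (fst x) < card (fst y)"
    using segre_lattice_finite(1)[OF fin y] psubset_card_mono by blast
qed

lemma segre_lattice_comparable:
  assumes fin: "finite A" "finite B" and x: "x \<in> segre_lattice A B" and y: "y \<in> segre_lattice A B"
    and comparable: "fst x \<subseteq> fst y \<or> fst y \<subseteq> fst x" "snd x \<subseteq> snd y \<or> snd y \<subseteq> snd x"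
  shows "x \<le> y \<or> y \<le> x"
proof -
  have cards: "card (fst x) = card (snd x)" "card (fst y) = card (snd y)"
    using x y by (auto simp: segre_lattice_iff)
  have "snd x = snd y" if "fst x \<subseteq> fst y" "snd y \<subseteq> snd x"
    using that cards segre_lattice_finite[OF fin x] segre_lattice_finite[OF fin y]
      card_mono[of "fst y" "fst x"] by (metis card_seteq)
  moreover have "snd x = snd y" if "fst y \<subseteq> fst x" "snd x \<subseteq> snd y"
    using that cards segre_lattice_finite[OF fin x] segre_lattice_finite[OF fin y]
      card_mono[of "fst x" "fst y"] by (metis card_seteq)
  ultimately show ?thesis using comparable unfolding less_eq_prod_def by blast
qed

lemma segre_chain_projections:
  assumes fin: "finite A" "finite B" and chain: "c \<subseteq> segre_lattice A B" "is_chain c"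
  shows "inj_on fst c" "inj_on snd c" "inj_on (\<lambda>x. card (fst x)) c"
    "is_chain (fst ` c)" "is_chain (snd ` c)"
proof -
  have "fst x \<noteq> fst y \<and> snd x \<noteq> snd y \<and> card (fst x) \<noteq> card (fst y)"
    if xy: "x \<in> c" "y \<in> c" "x \<noteq> y" for x y
  proof -
    have lattice: "x \<in> segre_lattice A B" "y \<in> segre_lattice A B" using xy(1,2) chain(1) by auto
    consider (less) "x < y" | (greater) "y < x" using chainD[OF chain(2) xy(1,2)] xy(3) by auto
    then show ?thesis
    proof cases
      case less
      then show ?thesis using segre_lattice_less[OF fin lattice] by auto
    next
      case greater
      then show ?thesis using segre_lattice_less[OF fin lattice(2,1)] by auto
    qed
  qed
  then show "inj_on fst c" "inj_on snd c" "inj_on (\<lambda>x. card (fst x)) c"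
    unfolding inj_on_def by blast+
  show "is_chain (fst ` c)" "is_chain (snd ` c)"
    using chain_imageI[OF chain(2), of "(\<le>)" fst] chain_imageI[OF chain(2), of "(\<le>)" snd]
    by (auto simp: less_eq_prod_def)
qed

definition pair_inversions ::
    "'a::linorder set \<Rightarrow> 'b::linorder set \<Rightarrow> 'a set \<times> 'b set \<Rightarrow> ('a \<times> 'a + 'b \<times> 'b) set" where
  "pair_inversions A B x = cut_inversions A (fst x) <+> cut_inversions B (snd x)"

lemma UN_pair_inversions:
  "\<Union> (pair_inversions A B ` c)
    = \<Union> (cut_inversions A ` fst ` c) <+> \<Union> (cut_inversions B ` snd ` c)"
  by (auto simp: pair_inversions_def)

lemma pair_inversions_subset_UN_iff:
  "pair_inversions A B x \<subseteq> \<Union> (pair_inversions A B ` c) \<longleftrightarrow>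
    cut_inversions A (fst x) \<subseteq> \<Union> (cut_inversions A ` fst ` c) \<and>
    cut_inversions B (snd x) \<subseteq> \<Union> (cut_inversions B ` snd ` c)"
  unfolding UN_pair_inversions by (auto simp: pair_inversions_def)

lemma pair_inversions_redundant_pair:
  assumes fin: "finite A" "finite B" and chain: "c \<subseteq> segre_lattice A B" "is_chain c"
    and ab: "a \<in> c" "b \<in> c" "a \<noteq> b"
    and redundant: "pair_inversions A B a \<subseteq> \<Union> (pair_inversions A B ` (c - {a}))"
      "pair_inversions A B b \<subseteq> \<Union> (pair_inversions A B ` (c - {b}))"
  shows "pair_inversions A B a \<subseteq> \<Union> (pair_inversions A B ` (c - {a, b}))"
proof -
  note proj = segre_chain_projections[OF fin chain]
  have minus: "fst ` (c - d) = fst ` c - fst ` d" "snd ` (c - d) = snd ` c - snd ` d"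
    if "d \<subseteq> c" for d
    using inj_on_image_set_diff[OF proj(1) _ that] inj_on_image_set_diff[OF proj(2) _ that] by auto
  have "fst x \<subseteq> A" "snd x \<subseteq> B" if "x \<in> c" for x
    using subsetD[OF chain(1) that] by (auto simp: segre_lattice_iff)
  then have subsets: "fst ` c \<subseteq> Pow A" "snd ` c \<subseteq> Pow B" by (simp_all add: image_subset_iff)
  have "fst a \<noteq> fst b" "snd a \<noteq> snd b"
    using inj_onD[OF proj(1) _ ab(1,2)] inj_onD[OF proj(2) _ ab(1,2)] ab(3) by auto
  then show ?thesis
    using redundant ab
      cut_inversions_redundant_pair[OF proj(4) subsets(1) imageI[OF ab(1)] imageI[OF ab(2)]]
      cut_inversions_redundant_pair[OF proj(5) subsets(2) imageI[OF ab(1)] imageI[OF ab(2)]]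
    by (simp add: pair_inversions_subset_UN_iff minus)
qed

lemma pair_inversions_redundant_comparable:
  assumes fin: "finite A" "finite B"
    and lattice: "insert a c \<subseteq> segre_lattice A B" "insert b c \<subseteq> segre_lattice A B"
    and chain: "is_chain (insert a c)" "is_chain (insert b c)"
    and redundant: "pair_inversions A B a \<subseteq> \<Union> (pair_inversions A B ` c)"
      "pair_inversions A B b \<subseteq> \<Union> (pair_inversions A B ` c)"
  shows "a \<le> b \<or> b \<le> a"
proof -
  note proj_a = segre_chain_projections(4,5)[OF fin lattice(1) chain(1)]
    and proj_b = segre_chain_projections(4,5)[OF fin lattice(2) chain(2)]
  have ab: "a \<in> segre_lattice A B" "b \<in> segre_lattice A B" using lattice by simp_all
  have "fst a \<subseteq> fst b \<or> fst b \<subseteq> fst a"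
    using proj_a(1) proj_b(1) redundant ab
    by (intro cut_inversions_redundant_comparable[where A = A and C = "fst ` c"])
      (auto simp: pair_inversions_subset_UN_iff segre_lattice_iff)
  moreover have "snd a \<subseteq> snd b \<or> snd b \<subseteq> snd a"
    using proj_a(2) proj_b(2) redundant ab
    by (intro cut_inversions_redundant_comparable[where A = B and C = "snd ` c"])
      (auto simp: pair_inversions_subset_UN_iff segre_lattice_iff)
  ultimately show ?thesis by (rule segre_lattice_comparable[OF fin ab])
qed

lemma separating_family_segre:
  assumes fin: "finite A" "finite B"
  shows "separating_family (segre_interior A B) (pair_inversions A B)"
proof
  show "finite (segre_interior A B)" using fin by (rule finite_segre_interior)
  show "finite (pair_inversions A B x)" if "x \<in> segre_interior A B" for x
    using that fin finite_cut_inversions[of A "fst x"] finite_cut_inversions[of B "snd x"]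
    by (auto simp: pair_inversions_def segre_interior_iff)
next
  fix c a b
  assume "c \<subseteq> segre_interior A B"
  then have "c \<subseteq> segre_lattice A B" using segre_interior_subset by blast
  then show "pair_inversions A B a \<subseteq> \<Union> (pair_inversions A B ` (c - {a, b}))"
    if "is_chain c" "a \<in> c" "b \<in> c" "a \<noteq> b"
      "pair_inversions A B a \<subseteq> \<Union> (pair_inversions A B ` (c - {a}))"
      "pair_inversions A B b \<subseteq> \<Union> (pair_inversions A B ` (c - {b}))"
    using pair_inversions_redundant_pair[OF fin] that by blast
next
  fix c a b
  assume "c \<subseteq> segre_interior A B" "a \<in> segre_interior A B" "b \<in> segre_interior A B"
  then have "insert a c \<subseteq> segre_lattice A B" "insert b c \<subseteq> segre_lattice A B"
    using segre_interior_subset by blast+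
  then show "a \<le> b \<or> b \<le> a"
    if "is_chain (insert a c)" "is_chain (insert b c)"
      "pair_inversions A B a \<subseteq> \<Union> (pair_inversions A B ` c)"
      "pair_inversions A B b \<subseteq> \<Union> (pair_inversions A B ` c)"
    using pair_inversions_redundant_comparable[OF fin] that by blast
qed

section \<open>Every non-maximal chain has a free element\<close>

lemma chain_gap:
  fixes rk :: "'a::order \<Rightarrow> nat"
  assumes D: "is_chain D" and rk: "strict_mono_on D rk"
    and ends: "lo \<in> D" "rk lo < r" "hi \<in> D" "r < rk hi" and gap: "r \<notin> rk ` D"
  obtains l u where "l \<in> D" "u \<in> D" "rk l < r" "r < rk u" "\<And>e. e \<in> D \<Longrightarrow> e \<le> l \<or> u \<le> e"
proof -
  have le_if_rank_le: "x \<le> y" if "x \<in> D" "y \<in> D" "rk x \<le> rk y" for x y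
    using chainD[OF D that(1,2)] strict_mono_onD[OF rk that(2,1)] that(3) by force
  obtain l where l: "l \<in> D" "rk l < r" "\<And>e. e \<in> D \<Longrightarrow> rk e < r \<Longrightarrow> rk e \<le> rk l"
    using ex_has_greatest_nat[of "\<lambda>e. e \<in> D \<and> rk e < r" lo rk r] ends(1,2) by auto
  obtain u where u: "u \<in> D" "r < rk u" "\<And>e. e \<in> D \<Longrightarrow> r < rk e \<Longrightarrow> rk u \<le> rk e"
    using ex_has_least_nat[of "\<lambda>e. e \<in> D \<and> r < rk e" hi rk] ends(3,4) by auto
  have "e \<le> l \<or> u \<le> e" if e: "e \<in> D" for e
  proof (cases "rk e < r")
    case True
    then show ?thesis using le_if_rank_le[OF e l(1)] l(3)[OF e] by simp
  next
    case False
    then have "r < rk e" using gap e by (metis imageI linorder_neqE_nat)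
    then show ?thesis using le_if_rank_le[OF u(1) e] u(3)[OF e] by simp
  qed
  then show thesis using that l(1,2) u(1,2) by blast
qed

lemma (in separating_family) free_nonemptyI:
  assumes "x \<in> P" "is_chain (insert x c)" "sep x \<subseteq> \<Union> (sep ` (c - {x}))"
  shows "free c \<noteq> {}"
  using assms by (auto simp: free_def separated_def)

lemma insert_Min_between:
  fixes l u :: "'a::linorder set \<times> 'b::linorder set"
  defines "x \<equiv> (insert (Min (fst u - fst l)) (fst l), insert (Min (snd u - snd l)) (snd l))"
  assumes fin: "finite A" "finite B" and lu: "l \<in> segre_lattice A B" "u \<in> segre_lattice A B" "l < u"
  shows "x \<in> segre_lattice A B" "card (fst x) = Suc (card (fst l))" "l \<le> x" "x \<le> u"
    "pair_inversions A B x \<subseteq> pair_inversions A B l \<union> pair_inversions A B u"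
proof -
  have fin_l: "finite (fst l)" "finite (snd l)" and fin_u: "finite (fst u)" "finite (snd u)"
    using segre_lattice_finite[OF fin] lu by auto
  note less = segre_lattice_less(1,2)[OF fin lu]
  have "Min (fst u - fst l) \<in> fst u - fst l" "Min (snd u - snd l) \<in> snd u - snd l"
    using less fin_u by (intro Min_in; auto)+
  then show "x \<in> segre_lattice A B" "card (fst x) = Suc (card (fst l))" "l \<le> x" "x \<le> u"
    using lu(1,2) less fin_l by (auto simp: x_def segre_lattice_iff less_eq_prod_def)
  show "pair_inversions A B x \<subseteq> pair_inversions A B l \<union> pair_inversions A B u"
    using cut_inversions_insert_Min[OF fin_u(1) less(1), of A]
      cut_inversions_insert_Min[OF fin_u(2) less(2), of B]
    by (auto simp: x_def pair_inversions_def)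
qed

locale segre_product =
  fixes A :: "'a::linorder set" and B :: "'b::linorder set"
  assumes finite_A: "finite A" and finite_B: "finite B" and card_eq: "card A = card B"
begin

sublocale separating_family "segre_interior A B" "pair_inversions A B"
  by (rule separating_family_segre[OF finite_A finite_B])

lemma free_nonempty_if_rank_missing:
  assumes chain: "c \<subseteq> segre_interior A B" "is_chain c"
    and r: "0 < r" "r < card A" "r \<notin> (\<lambda>x. card (fst x)) ` c"
  shows "free c \<noteq> {}"
proof -
  note fin = finite_A finite_B
  define D where "D = insert ({}, {}) (insert (A, B) c)"
  have D: "D \<subseteq> segre_lattice A B"
    using chain(1) card_eq segre_interior_subset by (auto simp: D_def segre_lattice_iff)
  have "({}, {}) \<le> x" "x \<le> (A, B)" if "x \<in> D" for x
    using subsetD[OF D that] by (auto simp: segre_lattice_iff less_eq_prod_def)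
  then have chain_D: "is_chain D"
    using chain(2) unfolding D_def Complete_Partial_Order.chain_def by blast
  have rank_mono: "strict_mono_on D (\<lambda>x. card (fst x))"
    using segre_lattice_less(3)[OF fin] D by (intro strict_mono_onI) blast
  have ends: "({}, {}) \<in> D" "(A, B) \<in> D" "r \<notin> (\<lambda>x. card (fst x)) ` D"
    using r by (auto simp: D_def)
  obtain l u where lu: "l \<in> D" "u \<in> D" "card (fst l) < r" "r < card (fst u)"
    and gap: "\<And>e. e \<in> D \<Longrightarrow> e \<le> l \<or> u \<le> e"
    by (rule chain_gap[OF chain_D rank_mono ends(1) _ ends(2) _ ends(3)]) (use r in auto)
  have "l < u"
  proof -
    have "l \<noteq> u" using lu(3,4) by auto
    moreover have "\<not> u < l" using strict_mono_onD[OF rank_mono lu(2,1)] lu(3,4) by force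
    ultimately show ?thesis using chainD[OF chain_D lu(1,2)] by auto
  qed
  define x where "x = (insert (Min (fst u - fst l)) (fst l), insert (Min (snd u - snd l)) (snd l))"
  have x: "x \<in> segre_lattice A B" "card (fst x) = Suc (card (fst l))" "l \<le> x" "x \<le> u"
    "pair_inversions A B x \<subseteq> pair_inversions A B l \<union> pair_inversions A B u"
    using insert_Min_between[OF fin _ _ \<open>l < u\<close>] subsetD[OF D lu(1)] subsetD[OF D lu(2)]
    unfolding x_def by blast+
  have covered: "pair_inversions A B e \<subseteq> \<Union> (pair_inversions A B ` (c - {x}))"
    if "e \<in> D" "e \<noteq> x" for e
    using that by (auto simp: D_def pair_inversions_def)
  show ?thesis
  proof (rule free_nonemptyI)
    show "x \<in> segre_interior A B" using x(1,2) lu(3) r(2) by (simp add: segre_interior_def)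
    have "e \<le> x \<or> x \<le> e" if "e \<in> c" for e using gap[of e] that x(3,4) by (auto simp: D_def)
    then show "is_chain (insert x c)"
      using chain(2) by (auto simp: Complete_Partial_Order.chain_def)
    have "l \<noteq> x" "u \<noteq> x" using x(2) lu(3,4) by auto
    then show "pair_inversions A B x \<subseteq> \<Union> (pair_inversions A B ` (c - {x}))"
      using x(5) covered lu(1,2) by blast
  qed
qed

lemma segre_chain_ranks:
  assumes chain: "c \<subseteq> segre_interior A B" "is_chain c"
  shows "inj_on (\<lambda>x. card (fst x)) c" "(\<lambda>x. card (fst x)) ` c \<subseteq> {1..<card A}"
proof -
  show "inj_on (\<lambda>x. card (fst x)) c"
    using segre_chain_projections(3)[OF finite_A finite_B _ chain(2)] chain(1) segre_interior_subset
    by blast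
  have "card (fst x) \<in> {1..<card A}" if "x \<in> c" for x
    using subsetD[OF chain(1) that] by (simp add: segre_interior_iff Suc_le_eq)
  then show "(\<lambda>x. card (fst x)) ` c \<subseteq> {1..<card A}" by (rule image_subsetI)
qed

lemma card_segre_chain_le:
  assumes "c \<subseteq> segre_interior A B" "is_chain c"
  shows "card c \<le> card A - 1"
  using card_inj_on_le[OF segre_chain_ranks[OF assms]] by simp

lemma free_nonempty_if_not_maximal:
  assumes chain: "c \<subseteq> segre_interior A B" "is_chain c" and "Suc (card c) < card A"
  shows "free c \<noteq> {}"
proof -
  have "card ((\<lambda>x. card (fst x)) ` c) < card {1..<card A}"
    using card_image[OF segre_chain_ranks(1)[OF chain]] assms(3) by simp
  then have "(\<lambda>x. card (fst x)) ` c \<subset> {1..<card A}" using segre_chain_ranks(2)[OF chain] by auto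
  then obtain r where "r \<in> {1..<card A}" "r \<notin> (\<lambda>x. card (fst x)) ` c"
    using psubset_imp_ex_mem by blast
  then show ?thesis using free_nonempty_if_rank_missing[OF chain, of r] by simp
qed

theorem exact_at_segre_interior:
  assumes "Suc l < card A"
  shows "exact_at (segre_interior A B) l"
  using assms free_nonempty_if_not_maximal by (intro exact_at_if_free) auto

lemma simplices_segre_interior_eq_empty:
  assumes "0 < card A"
  shows "simplices (segre_interior A B) (card A) = {}"
proof -
  have "length xs \<le> card A - 1" if "xs \<in> all_simplices (segre_interior A B)" for xs
    using card_segre_chain_le all_simplicesD[OF that] by metis
  then show ?thesis using assms by (fastforce simp: simplices_def)
qed

lemma card_critical_chain:
  assumes "c \<in> critical_chains"
  shows "card c = card A - 1"
proof -
  have chain: "c \<subseteq> segre_interior A B" "is_chain c" "free c = {}"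
    using assms by (auto simp: critical_chains_def)
  then show ?thesis
    using card_segre_chain_le[OF chain(1,2)] free_nonempty_if_not_maximal[OF chain(1,2)] by linarith
qed

theorem sum_all_simplices_eq_sum_critical_chains:
  fixes g :: "('a \<times> 'a + 'b \<times> 'b) set \<Rightarrow> 'r::comm_ring_1"
  assumes "0 < card A"
  shows "(\<Sum>xs\<in>all_simplices (segre_interior A B).
      (-1) ^ (card A + 1 + length xs) * g (separated (set xs)))
    = (\<Sum>c\<in>critical_chains. g (separated c))"
proof -
  let ?P = "segre_interior A B"
  have "(\<Sum>xs\<in>all_simplices ?P. (-1) ^ (card A + 1 + length xs) * g (separated (set xs)))
    = (\<Sum>xs\<in>all_simplices ?P. (-1) ^ (card A + 1 + card (set xs)) * g (separated (set xs)))"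
    by (intro sum.cong refl) (simp add: all_simplicesD(4))
  also have "\<dots> = (\<Sum>c | c \<subseteq> ?P \<and> is_chain c. (-1) ^ (card A + 1 + card c) * g (separated c))"
    by (rule sum.reindex_bij_betw[OF bij_betw_set_all_simplices[OF finite_P]])
  also have "\<dots> = (-1) ^ (card A + 1) * (\<Sum>c\<in>critical_chains. (-1) ^ card c * g (separated c))"
    by (simp add: power_add sum_distrib_left mult.assoc flip: sum_chains_eq_sum_critical_chains)
  also have "\<dots> = (\<Sum>c\<in>critical_chains. (-1) ^ (card A + 1 + (card A - 1)) * g (separated c))"
    unfolding sum_distrib_left
    by (intro sum.cong refl) (simp add: card_critical_chain power_add mult.assoc)
  also have "card A + 1 + (card A - 1) = 2 * card A" using assms by simp
  finally show ?thesis by simp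
qed

end

section \<open>Maximal chains and pairs of permutations\<close>

definition prefix_image :: "(nat \<Rightarrow> nat) \<Rightarrow> nat \<Rightarrow> nat set" where
  "prefix_image \<sigma> i = \<sigma> ` {1..i}"

lemma prefix_image_0 [simp]: "prefix_image \<sigma> 0 = {}"
  by (simp add: prefix_image_def)

lemma prefix_image_Suc: "prefix_image \<sigma> (Suc i) = insert (\<sigma> (Suc i)) (prefix_image \<sigma> i)"
  by (simp add: prefix_image_def atLeastAtMostSuc_conv)

lemma prefix_image_mono: "i \<le> j \<Longrightarrow> prefix_image \<sigma> i \<subseteq> prefix_image \<sigma> j"
  by (auto simp: prefix_image_def)

context
  fixes n :: nat and \<sigma> :: "nat \<Rightarrow> nat"
  assumes \<sigma>: "\<sigma> permutes {1..n}"
begin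

lemma prefix_image_full: "prefix_image \<sigma> n = {1..n}"
  using permutes_image[OF \<sigma>] by (simp add: prefix_image_def)

lemma prefix_image_subset: "i \<le> n \<Longrightarrow> prefix_image \<sigma> i \<subseteq> {1..n}"
  using prefix_image_mono[of i n \<sigma>] prefix_image_full by simp

lemma card_prefix_image: "card (prefix_image \<sigma> i) = i"
  unfolding prefix_image_def using permutes_inj[OF \<sigma>] by (simp add: card_image inj_on_subset)

lemma mem_prefix_image_iff: "\<sigma> a \<in> prefix_image \<sigma> i \<longleftrightarrow> a \<in> {1..i}"
  using permutes_inj[OF \<sigma>] by (auto simp: prefix_image_def inj_image_mem_iff)

lemma prefix_image_Diff: "1 \<le> k \<Longrightarrow> prefix_image \<sigma> k - prefix_image \<sigma> (k - 1) = {\<sigma> k}"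
  using prefix_image_Suc[of \<sigma> "k - 1"] mem_prefix_image_iff[of k "k - 1"] by auto

lemma cut_inversions_prefix_image:
  "cut_inversions {1..n} (prefix_image \<sigma> i)
    = map_prod \<sigma> \<sigma> ` {(a, b). 1 \<le> a \<and> a \<le> i \<and> i < b \<and> b \<le> n \<and> \<sigma> b < \<sigma> a}"
proof (intro equalityI subsetI)
  fix q assume "q \<in> cut_inversions {1..n} (prefix_image \<sigma> i)"
  then obtain x y where q: "q = (x, y)" "x \<in> prefix_image \<sigma> i" "y \<in> {1..n}" "y \<notin> prefix_image \<sigma> i"
    "y < x"
    by (auto simp: cut_inversions_def)
  obtain a where a: "x = \<sigma> a" "a \<in> {1..i}" using q(2) by (auto simp: prefix_image_def)
  obtain b where b: "y = \<sigma> b" "b \<in> {1..n}" using q(3) permutes_image[OF \<sigma>] by blast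
  have "b \<notin> {1..i}" using q(4) b(1) mem_prefix_image_iff by simp
  then show "q \<in> map_prod \<sigma> \<sigma> ` {(a, b). 1 \<le> a \<and> a \<le> i \<and> i < b \<and> b \<le> n \<and> \<sigma> b < \<sigma> a}"
    using q(1,5) a b by (intro image_eqI[of _ _ "(a, b)"]) auto
next
  fix q assume "q \<in> map_prod \<sigma> \<sigma> ` {(a, b). 1 \<le> a \<and> a \<le> i \<and> i < b \<and> b \<le> n \<and> \<sigma> b < \<sigma> a}"
  then obtain a b where q: "q = (\<sigma> a, \<sigma> b)" "1 \<le> a" "a \<le> i" "i < b" "b \<le> n" "\<sigma> b < \<sigma> a" by auto
  have "\<sigma> b \<in> {1..n}" using q permutes_in_image[OF \<sigma>, of b] by simp
  then show "q \<in> cut_inversions {1..n} (prefix_image \<sigma> i)"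
    using q mem_prefix_image_iff by (simp add: cut_inversions_iff)
qed

lemma card_UN_cut_inversions_prefix_image:
  "card (\<Union>i\<in>{1..<n}. cut_inversions {1..n} (prefix_image \<sigma> i)) = inversions n \<sigma>"
proof -
  let ?I = "{(i, j). 1 \<le> i \<and> i < j \<and> j \<le> n \<and> \<sigma> i > \<sigma> j}"
  have "(\<Union>i\<in>{1..<n}. {(a, b). 1 \<le> a \<and> a \<le> i \<and> i < b \<and> b \<le> n \<and> \<sigma> b < \<sigma> a}) = ?I"
  proof (intro equalityI subsetI)
    fix q assume "q \<in> ?I"
    then show "q \<in> (\<Union>i\<in>{1..<n}. {(a, b). 1 \<le> a \<and> a \<le> i \<and> i < b \<and> b \<le> n \<and> \<sigma> b < \<sigma> a})"
      by (intro UN_I[of "fst q"]) auto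
  qed auto
  then have "(\<Union>i\<in>{1..<n}. cut_inversions {1..n} (prefix_image \<sigma> i)) = map_prod \<sigma> \<sigma> ` ?I"
    unfolding cut_inversions_prefix_image image_UN[symmetric] by simp
  moreover have "inj_on (map_prod \<sigma> \<sigma>) ?I"
    using prod.inj_map[OF permutes_inj permutes_inj, OF \<sigma> \<sigma>] by (rule inj_on_subset) simp
  ultimately show ?thesis by (simp add: inversions_def card_image)
qed

lemma cut_inversions_prefix_image_redundant_iff:
  assumes i: "i \<in> {1..<n}"
  shows "cut_inversions {1..n} (prefix_image \<sigma> i)
      \<subseteq> (\<Union>j\<in>{1..<n} - {i}. cut_inversions {1..n} (prefix_image \<sigma> j)) \<longleftrightarrow> i \<in> ascents n \<sigma>"
    (is "?cut i \<subseteq> ?others \<longleftrightarrow> _")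
proof
  assume redundant: "?cut i \<subseteq> ?others"
  show "i \<in> ascents n \<sigma>"
  proof (rule ccontr)
    assume "i \<notin> ascents n \<sigma>"
    moreover have "\<sigma> i \<noteq> \<sigma> (i + 1)" by (simp add: inj_eq[OF permutes_inj[OF \<sigma>]])
    ultimately have "\<sigma> (i + 1) < \<sigma> i" using i by (auto simp: ascents_def)
    then have "(\<sigma> i, \<sigma> (i + 1)) \<in> ?cut i"
      unfolding cut_inversions_prefix_image using i by (intro image_eqI[of _ _ "(i, i + 1)"]) auto
    then obtain j where "j \<noteq> i" "\<sigma> i \<in> prefix_image \<sigma> j" "\<sigma> (i + 1) \<notin> prefix_image \<sigma> j"
      using redundant by (auto simp: cut_inversions_def)
    then show False unfolding mem_prefix_image_iff by auto
  qed
next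
  assume ascent: "i \<in> ascents n \<sigma>"
  show "?cut i \<subseteq> ?others"
  proof
    fix q assume "q \<in> ?cut i"
    then obtain a b where q: "q = (\<sigma> a, \<sigma> b)" "1 \<le> a" "a \<le> i" "i < b" "b \<le> n" "\<sigma> b < \<sigma> a"
      unfolding cut_inversions_prefix_image by auto
    define j where "j = (if a < i then i - 1 else i + 1)"
    have "a < i \<or> i + 1 < b" using ascent q by (cases "a = i \<and> b = i + 1") (auto simp: ascents_def)
    then have j: "j \<in> {1..<n} - {i}" "a \<le> j" "j < b" using q i by (auto simp: j_def)
    have "q \<in> ?cut j"
      unfolding cut_inversions_prefix_image using q j by (intro image_eqI[of _ _ "(a, b)"]) auto
    then show "q \<in> ?others" using j(1) by blast
  qed
qed

end

lemma permutes_eq_if_prefix_image_eq: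
  assumes \<sigma>: "\<sigma> permutes {1..n}" and \<rho>: "\<rho> permutes {1..n}"
    and eq: "\<And>i. i \<in> {1..<n} \<Longrightarrow> prefix_image \<sigma> i = prefix_image \<rho> i"
  shows "\<sigma> = \<rho>"
proof
  fix k
  have all_eq: "prefix_image \<sigma> i = prefix_image \<rho> i" if "i \<le> n" for i
    using that eq[of i] prefix_image_full[OF \<sigma>] prefix_image_full[OF \<rho>]
    by (cases "i = 0 \<or> i = n") auto
  show "\<sigma> k = \<rho> k"
  proof (cases "k \<in> {1..n}")
    case True
    then have "1 \<le> k" "k \<le> n" "k - 1 \<le> n" by auto
    then have "{\<sigma> k} = {\<rho> k}"
      using prefix_image_Diff[OF \<sigma>] prefix_image_Diff[OF \<rho>] all_eq by metis
    then show ?thesis by simp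
  qed (use permutes_not_in[OF \<sigma>] permutes_not_in[OF \<rho>] in simp)
qed

lemma ex_permutes_prefix_image:
  assumes subset: "\<And>i. i \<le> n \<Longrightarrow> S i \<subseteq> {1..n}" and card: "\<And>i. i \<le> n \<Longrightarrow> card (S i) = i"
    and mono: "\<And>i. i < n \<Longrightarrow> S i \<subseteq> S (Suc i)"
  shows "\<exists>\<sigma>. \<sigma> permutes {1..n} \<and> (\<forall>i\<le>n. prefix_image \<sigma> i = S i)"
proof -
  have finite: "finite (S i)" if "i \<le> n" for i using subset[OF that] finite_subset by blast
  have "\<exists>x. S (Suc i) = insert x (S i)" if "i < n" for i
  proof -
    have "card (S (Suc i) - S i) = 1"
      using card[of i] card[of "Suc i"] mono[OF that] finite[of i] that
      by (simp add: card_Diff_subset)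
    then obtain x where "S (Suc i) - S i = {x}" by (auto simp: card_1_singleton_iff)
    then show ?thesis using mono[OF that] by blast
  qed
  then obtain x where x: "\<And>i. i < n \<Longrightarrow> S (Suc i) = insert (x i) (S i)" by metis
  define \<sigma> where "\<sigma> k = (if k \<in> {1..n} then x (k - 1) else k)" for k
  have prefix: "prefix_image \<sigma> i = S i" if "i \<le> n" for i
    using that
  proof (induction i)
    case 0
    then show ?case using card[of 0] finite[of 0] by simp
  next
    case (Suc i)
    then show ?case using x[of i] by (simp add: prefix_image_Suc \<sigma>_def)
  qed
  moreover have "S n = {1..n}" using subset[of n] card[of n] by (intro card_subset_eq) auto
  ultimately have image: "\<sigma> ` {1..n} = {1..n}" by (simp add: prefix_image_def)
  then have "bij_betw \<sigma> {1..n} {1..n}" by (simp add: bij_betw_def eq_card_imp_inj_on)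
  then have "\<sigma> permutes {1..n}" by (rule bij_imp_permutes) (auto simp: \<sigma>_def)
  then show ?thesis using prefix by blast
qed

definition prefix_pair :: "(nat \<Rightarrow> nat) \<Rightarrow> (nat \<Rightarrow> nat) \<Rightarrow> nat \<Rightarrow> nat set \<times> nat set" where
  "prefix_pair \<sigma> \<omega> i = (prefix_image \<sigma> i, prefix_image \<omega> i)"

definition perm_chain :: "nat \<Rightarrow> (nat \<Rightarrow> nat) \<times> (nat \<Rightarrow> nat) \<Rightarrow> (nat set \<times> nat set) set" where
  "perm_chain n = (\<lambda>(\<sigma>, \<omega>). prefix_pair \<sigma> \<omega> ` {1..<n})"

lemma fst_prefix_pair [simp]: "fst (prefix_pair \<sigma> \<omega> i) = prefix_image \<sigma> i"
  and snd_prefix_pair [simp]: "snd (prefix_pair \<sigma> \<omega> i) = prefix_image \<omega> i"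
  by (simp_all add: prefix_pair_def)

interpretation boolean: segre_product "{1..n}" "{1..n}" for n :: nat
  by standard simp_all

context
  fixes n :: nat and \<sigma> \<omega> :: "nat \<Rightarrow> nat"
  assumes \<sigma>: "\<sigma> permutes {1..n}" and \<omega>: "\<omega> permutes {1..n}"
begin

lemma inj_prefix_pair: "inj (prefix_pair \<sigma> \<omega>)"
  by (rule inj_on_imageI2[of "\<lambda>x. card (fst x)"]) (simp add: inj_on_def card_prefix_image[OF \<sigma>])

lemma perm_chain_subset_segre_interior: "perm_chain n (\<sigma>, \<omega>) \<subseteq> segre_interior {1..n} {1..n}"
  using prefix_image_subset[OF \<sigma>] prefix_image_subset[OF \<omega>]
  by (auto simp: perm_chain_def segre_interior_iff card_prefix_image[OF \<sigma>] card_prefix_image[OF \<omega>])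

lemma is_chain_perm_chain: "is_chain (perm_chain n (\<sigma>, \<omega>))"
proof -
  have "prefix_pair \<sigma> \<omega> i \<le> prefix_pair \<sigma> \<omega> j" if "i \<le> j" for i j
    using prefix_image_mono[OF that] by (simp add: less_eq_prod_def)
  then show ?thesis
    unfolding perm_chain_def split_conv
    by (intro chain_imageI[of "(\<le>)"]) (auto simp: Complete_Partial_Order.chain_def)
qed

lemma free_perm_chain_subset:
  "boolean.free n (perm_chain n (\<sigma>, \<omega>)) \<subseteq> perm_chain n (\<sigma>, \<omega>)"
proof
  fix y assume "y \<in> boolean.free n (perm_chain n (\<sigma>, \<omega>))"
  note y = boolean.freeD[OF this]
  let ?c = "perm_chain n (\<sigma>, \<omega>)" and ?i = "card (fst y)"
  have subset: "insert y ?c \<subseteq> segre_interior {1..n} {1..n}"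
    using y(1) perm_chain_subset_segre_interior by simp
  have "?i \<in> {1..<n}" using y(1) by (simp add: segre_interior_iff)
  then have mem: "prefix_pair \<sigma> \<omega> ?i \<in> ?c" by (auto simp: perm_chain_def)
  then have "y = prefix_pair \<sigma> \<omega> ?i"
    using inj_onD[OF boolean.segre_chain_ranks(1)[OF subset y(2)], of y "prefix_pair \<sigma> \<omega> ?i"]
    by (simp add: card_prefix_image[OF \<sigma>])
  then show "y \<in> ?c" using mem by simp
qed

lemma prefix_pair_free_iff:
  assumes i: "i \<in> {1..<n}"
  shows "prefix_pair \<sigma> \<omega> i \<in> boolean.free n (perm_chain n (\<sigma>, \<omega>)) \<longleftrightarrow> i \<in> ascents n \<sigma> \<inter> ascents n \<omega>"
proof -
  let ?c = "perm_chain n (\<sigma>, \<omega>)" and ?x = "prefix_pair \<sigma> \<omega>"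
  have mem: "?x i \<in> ?c" using i by (auto simp: perm_chain_def)
  have others: "?c - {?x i} = ?x ` ({1..<n} - {i})"
    using inj_on_image_set_diff[OF inj_prefix_pair, of "{1..<n}" "{i}"]
    by (simp add: perm_chain_def)
  have "?x i \<in> boolean.free n ?c \<longleftrightarrow>
      pair_inversions {1..n} {1..n} (?x i) \<subseteq> \<Union> (pair_inversions {1..n} {1..n} ` (?c - {?x i}))"
    using subsetD[OF perm_chain_subset_segre_interior mem] is_chain_perm_chain mem
    by (simp add: boolean.free_def boolean.separated_def insert_absorb del: One_nat_def)
  then show ?thesis
    unfolding others pair_inversions_subset_UN_iff
    using cut_inversions_prefix_image_redundant_iff[OF \<sigma> i]
      cut_inversions_prefix_image_redundant_iff[OF \<omega> i]
    by (simp add: image_image)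
qed

lemma perm_chain_critical_iff:
  "perm_chain n (\<sigma>, \<omega>) \<in> boolean.critical_chains n \<longleftrightarrow> (\<sigma>, \<omega>) \<in> no_common_ascent n"
proof -
  have "boolean.free n (perm_chain n (\<sigma>, \<omega>)) = {} \<longleftrightarrow>
      (\<forall>i\<in>{1..<n}. prefix_pair \<sigma> \<omega> i \<notin> boolean.free n (perm_chain n (\<sigma>, \<omega>)))"
    using free_perm_chain_subset by (auto simp: perm_chain_def)
  also have "\<dots> \<longleftrightarrow> (\<forall>i\<in>{1..<n}. i \<notin> ascents n \<sigma> \<inter> ascents n \<omega>)"
    by (intro ball_cong refl) (simp only: prefix_pair_free_iff)
  also have "\<dots> \<longleftrightarrow> ascents n \<sigma> \<inter> ascents n \<omega> = {}"
    by (auto simp: ascents_def)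
  finally show ?thesis
    using perm_chain_subset_segre_interior is_chain_perm_chain \<sigma> \<omega>
    by (simp add: boolean.critical_chains_def no_common_ascent_def del: One_nat_def)
qed

lemma card_separated_perm_chain:
  "card (boolean.separated n (perm_chain n (\<sigma>, \<omega>))) = inversions n \<sigma> + inversions n \<omega>"
proof -
  have fin: "finite (\<Union>i\<in>{1..<n}. cut_inversions {1..n} (prefix_image \<rho> i))"
    if "\<rho> permutes {1..n}" for \<rho>
    by (rule finite_UN_I) (simp_all add: finite_cut_inversions prefix_image_subset[OF that]
      del: One_nat_def)
  then show ?thesis
    unfolding boolean.separated_def UN_pair_inversions
    by (simp add: perm_chain_def image_image card_Plus[OF fin[OF \<sigma>] fin[OF \<omega>]]
        card_UN_cut_inversions_prefix_image[OF \<sigma>] card_UN_cut_inversions_prefix_image[OF \<omega>]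
        del: One_nat_def)
qed

end

lemma ex_rank_enumeration:
  assumes chain: "c \<subseteq> segre_interior {1..n} {1..n}" "is_chain c" "card c = n - 1"
  shows "\<exists>x. (\<forall>i\<le>n. x i \<in> segre_lattice {1..n} {1..n} \<and> card (fst (x i)) = i) \<and>
    (\<forall>i<n. x i \<le> x (Suc i)) \<and> x ` {1..<n} = c"
proof -
  let ?A = "{1..n}" and ?rk = "\<lambda>x :: nat set \<times> nat set. card (fst x)"
  have "?rk ` c = {1..<n}"
    using boolean.segre_chain_ranks[OF chain(1,2)] chain(3)
    by (intro card_subset_eq) (simp_all add: card_image)
  then have "\<exists>x\<in>c. ?rk x = i" if "i \<in> {1..<n}" for i using that by (metis imageE)
  then obtain e where e: "\<And>i. i \<in> {1..<n} \<Longrightarrow> e i \<in> c \<and> ?rk (e i) = i" by metis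
  define x where "x i = (if i = 0 then ({}, {}) else if i = n then (?A, ?A) else e i)" for i
  have e_lattice: "e i \<in> segre_lattice ?A ?A" if "i \<in> {1..<n}" for i
    using e[OF that] chain(1) segre_interior_subset by blast
  have x: "x i \<in> segre_lattice ?A ?A" "?rk (x i) = i" if "i \<le> n" for i
    using that e[of i] e_lattice[of i]
    by (cases "i = 0 \<or> i = n"; auto simp: x_def segre_lattice_iff)+
  have "x i \<le> x (Suc i)" if "i < n" for i
  proof -
    have "({}, {}) \<le> x (Suc i)" "x i \<le> (?A, ?A)"
      using x(1)[of i] x(1)[of "Suc i"] that by (auto simp: segre_lattice_iff less_eq_prod_def)
    moreover have "e i \<le> e (Suc i)" if i: "i \<in> {1..<n}" "Suc i \<in> {1..<n}"
    proof -
      have "\<not> e (Suc i) < e i" "e i \<noteq> e (Suc i)"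
        using segre_lattice_less(3)[OF _ _ e_lattice[OF i(2)] e_lattice[OF i(1)]] e[OF i(1)]
          e[OF i(2)]
        by auto
      then show ?thesis using chainD[OF chain(2), of "e i" "e (Suc i)"] e[OF i(1)] e[OF i(2)]
        by auto
    qed
    ultimately show ?thesis using that by (auto simp: x_def)
  qed
  moreover have "x ` {1..<n} = c"
  proof (rule card_subset_eq)
    show "finite c" using finite_subset[OF chain(1) boolean.finite_P] .
    show "x ` {1..<n} \<subseteq> c" using e by (auto simp: x_def)
    have "inj_on x {1..<n}" using x(2) by (intro inj_onI) (metis atLeastLessThan_iff less_imp_le)
    then show "card (x ` {1..<n}) = card c" using chain(3) by (simp add: card_image)
  qed
  ultimately show ?thesis using x by blast
qed

lemma ex_perm_chain:
  assumes chain: "c \<subseteq> segre_interior {1..n} {1..n}" "is_chain c" "card c = n - 1"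
  shows "\<exists>\<sigma> \<omega>. \<sigma> permutes {1..n} \<and> \<omega> permutes {1..n} \<and> c = perm_chain n (\<sigma>, \<omega>)"
proof -
  obtain x where x: "\<And>i. i \<le> n \<Longrightarrow> x i \<in> segre_lattice {1..n} {1..n}"
      "\<And>i. i \<le> n \<Longrightarrow> card (fst (x i)) = i"
    and mono: "\<And>i. i < n \<Longrightarrow> x i \<le> x (Suc i)" and image: "x ` {1..<n} = c"
    using ex_rank_enumeration[OF chain] by blast
  have ex: "\<exists>\<sigma>. \<sigma> permutes {1..n} \<and> (\<forall>i\<le>n. prefix_image \<sigma> i = fst (x i))"
    "\<exists>\<omega>. \<omega> permutes {1..n} \<and> (\<forall>i\<le>n. prefix_image \<omega> i = snd (x i))"
    using x mono
    by (intro ex_permutes_prefix_image; simp add: segre_lattice_iff less_eq_prod_def)+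
  then obtain \<sigma> \<omega> where perms: "\<sigma> permutes {1..n}" "\<omega> permutes {1..n}"
    and "\<And>i. i \<le> n \<Longrightarrow> prefix_image \<sigma> i = fst (x i)"
      "\<And>i. i \<le> n \<Longrightarrow> prefix_image \<omega> i = snd (x i)" by blast
  then have "perm_chain n (\<sigma>, \<omega>) = x ` {1..<n}"
    unfolding perm_chain_def split_conv by (intro image_cong refl) (simp add: prefix_pair_def)
  then show ?thesis using perms image by blast
qed

lemma bij_betw_perm_chain:
  "bij_betw (perm_chain n) (no_common_ascent n) (boolean.critical_chains n)"
  unfolding bij_betw_def
proof
  show "inj_on (perm_chain n) (no_common_ascent n)"
  proof (rule inj_onI, clarify)
    fix \<sigma> \<omega> \<sigma>' \<omega>' assume "(\<sigma>, \<omega>) \<in> no_common_ascent n" "(\<sigma>', \<omega>') \<in> no_common_ascent n"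
      and eq: "perm_chain n (\<sigma>, \<omega>) = perm_chain n (\<sigma>', \<omega>')"
    then have perms: "\<sigma> permutes {1..n}" "\<omega> permutes {1..n}" "\<sigma>' permutes {1..n}"
      "\<omega>' permutes {1..n}"
      by (auto simp: no_common_ascent_def)
    have "prefix_pair \<sigma> \<omega> i = prefix_pair \<sigma>' \<omega>' i" if "i \<in> {1..<n}" for i
    proof -
      have "prefix_pair \<sigma> \<omega> i \<in> perm_chain n (\<sigma>', \<omega>')" using eq that by (auto simp: perm_chain_def)
      then obtain j where j: "prefix_pair \<sigma> \<omega> i = prefix_pair \<sigma>' \<omega>' j"
        by (auto simp: perm_chain_def)
      then have "i = j"
        using card_prefix_image[OF perms(1), of i] card_prefix_image[OF perms(3), of j]
        by (simp add: prefix_pair_def)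
      then show ?thesis using j by simp
    qed
    then show "\<sigma> = \<sigma>' \<and> \<omega> = \<omega>'"
      using permutes_eq_if_prefix_image_eq perms by (simp add: prefix_pair_def)
  qed
  show "perm_chain n ` no_common_ascent n = boolean.critical_chains n"
  proof (intro equalityI subsetI)
    fix c assume "c \<in> perm_chain n ` no_common_ascent n"
    then show "c \<in> boolean.critical_chains n"
      using perm_chain_critical_iff by (auto simp: no_common_ascent_def)
  next
    fix c assume critical: "c \<in> boolean.critical_chains n"
    then obtain \<sigma> \<omega> where "\<sigma> permutes {1..n}" "\<omega> permutes {1..n}" "c = perm_chain n (\<sigma>, \<omega>)"
      using ex_perm_chain[of c n] boolean.card_critical_chain[OF critical]
      by (auto simp: boolean.critical_chains_def simp del: One_nat_def)
    then show "c \<in> perm_chain n ` no_common_ascent n"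
      using critical perm_chain_critical_iff by blast
  qed
qed

theorem W_poly_eq_sum_critical_chains:
  "W_poly n = (\<Sum>c\<in>boolean.critical_chains n. fps_X ^ card (boolean.separated n c))"
proof -
  have "W_poly n = (\<Sum>p\<in>no_common_ascent n. fps_X ^ card (boolean.separated n (perm_chain n p)))"
    unfolding W_poly_def
    by (intro sum.cong refl) (auto simp: no_common_ascent_def card_separated_perm_chain
      simp del: One_nat_def)
  also have "\<dots> = (\<Sum>c\<in>boolean.critical_chains n. fps_X ^ card (boolean.separated n c))"
    by (rule sum.reindex_bij_betw[OF bij_betw_perm_chain])
  finally show ?thesis .
qed

section \<open>The $q$-series\<close>

definition qpoch :: "nat \<Rightarrow> 'a::field fps" where
  "qpoch m = (\<Prod>i=1..m. 1 - fps_X ^ i)"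

lemma qpoch_0 [simp]: "qpoch 0 = 1"
  by (simp add: qpoch_def)

lemma qpoch_Suc: "qpoch (Suc m) = qpoch m * (1 - fps_X ^ Suc m)"
  by (simp add: qpoch_def)

lemma one_minus_fps_X_power_nth_0: "0 < k \<Longrightarrow> fps_nth (1 - fps_X ^ k :: 'a::field fps) 0 = 1"
  by (simp add: fps_X_power_nth)

lemma qpoch_nth_0: "fps_nth (qpoch m) 0 = 1"
  by (induction m) (simp_all add: qpoch_Suc one_minus_fps_X_power_nth_0 del: power_Suc)

lemma qpoch_nonzero [simp]: "qpoch m \<noteq> 0"
  using qpoch_nth_0[of m] by (metis fps_zero_nth zero_neq_one)

definition inverse_qpoch :: "nat \<Rightarrow> 'a::field fps" where
  "inverse_qpoch m = inverse (qpoch m)"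

lemma qpoch_inverse_qpoch [simp]: "qpoch m * inverse_qpoch m = 1"
  unfolding inverse_qpoch_def by (rule inverse_mult_eq_1') (simp add: qpoch_nth_0)

lemma inverse_qpoch_0 [simp]: "inverse_qpoch 0 = 1"
  by (simp add: inverse_qpoch_def)

lemma inverse_qpoch_Suc:
  "(1 - fps_X ^ Suc m) * inverse_qpoch (Suc m) = (inverse_qpoch m :: 'a::field fps)"
proof -
  have "qpoch m * ((1 - fps_X ^ Suc m) * inverse_qpoch (Suc m))
    = qpoch m * (inverse_qpoch m :: 'a fps)"
    using qpoch_inverse_qpoch[of "Suc m"] unfolding qpoch_Suc mult.assoc by simp
  then show ?thesis by (simp only: mult_left_cancel[OF qpoch_nonzero])
qed

lemma one_minus_fps_X_power_inverse:
  "0 < k \<Longrightarrow> (1 - fps_X ^ k) * inverse (1 - fps_X ^ k) = (1 :: 'a::field fps)"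
  by (rule inverse_mult_eq_1') (simp add: one_minus_fps_X_power_nth_0)

lemma newton_identity_summand:
  fixes p :: "nat \<Rightarrow> 'a::field fps"
  defines "p k \<equiv> inverse (1 - fps_X ^ k)"
  assumes "0 < k"
  shows "(1 - fps_X ^ (k + Suc j)) * (p k * inverse_qpoch (Suc j))
    = inverse_qpoch (Suc j) + (p k - 1) * inverse_qpoch j"
proof -
  have p: "(1 - fps_X ^ k) * p k = 1"
    unfolding p_def by (rule one_minus_fps_X_power_inverse[OF assms(2)])
  have "(1 - fps_X ^ (k + Suc j)) * (p k * inverse_qpoch (Suc j))
    = (1 - fps_X ^ k) * p k * inverse_qpoch (Suc j)
      + (p k - (1 - fps_X ^ k) * p k) * ((1 - fps_X ^ Suc j) * inverse_qpoch (Suc j))"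
    unfolding power_add by (simp add: algebra_simps del: power_Suc)
  then show ?thesis unfolding p inverse_qpoch_Suc by simp
qed

lemma newton_identity:
  "(\<Sum>k=1..n. inverse (1 - fps_X ^ k) * inverse_qpoch (n - k))
    = of_nat n * (inverse_qpoch n :: 'a::field fps)"
proof (induction n)
  case (Suc n)
  let ?h = "inverse_qpoch :: nat \<Rightarrow> 'a fps" and ?p = "\<lambda>k. inverse (1 - fps_X ^ k :: 'a fps)"
  let ?S = "\<Sum>k=1..Suc n. ?p k * ?h (Suc n - k)"
  have nonzero: "1 - fps_X ^ Suc n \<noteq> (0 :: 'a fps)"
    using one_minus_fps_X_power_nth_0[of "Suc n"] by (metis fps_zero_nth zero_less_Suc zero_neq_one)
  have "(1 - fps_X ^ Suc n) * ?S = (\<Sum>k=1..n. (1 - fps_X ^ Suc n) * (?p k * ?h (Suc n - k))) + 1"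
    using one_minus_fps_X_power_inverse[of "Suc n"]
    by (simp add: sum_distrib_left distrib_left del: power_Suc)
  also have "(\<Sum>k=1..n. (1 - fps_X ^ Suc n) * (?p k * ?h (Suc n - k)))
    = (\<Sum>k=1..n. ?h (Suc n - k) + (?p k - 1) * ?h (n - k))"
  proof (rule sum.cong[OF refl])
    fix k assume k: "k \<in> {1..n}"
    then have "Suc n = k + Suc (n - k)" "Suc n - k = Suc (n - k)" "0 < k" by auto
    then show "(1 - fps_X ^ Suc n) * (?p k * ?h (Suc n - k))
      = ?h (Suc n - k) + (?p k - 1) * ?h (n - k)"
      using newton_identity_summand[of k "n - k"] by metis
  qed
  also have "\<dots> = (\<Sum>k=1..n. ?h (Suc n - k)) - (\<Sum>k=1..n. ?h (n - k)) + of_nat n * ?h n"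
    using Suc by (simp add: sum.distrib sum_subtractf left_diff_distrib)
  also have "(\<Sum>k=1..n. ?h (Suc n - k)) - (\<Sum>k=1..n. ?h (n - k)) = ?h n - 1"
  proof -
    have "(\<Sum>k=1..n. ?h (Suc n - k)) = (\<Sum>k<n. ?h (n - k))"
      by (rule sum.reindex_bij_witness[of _ Suc "\<lambda>k. k - 1"]) auto
    moreover have "(\<Sum>k\<le>n. ?h (n - k)) = ?h n + (\<Sum>k=1..n. ?h (n - k))"
      by (simp add: sum.atLeast_Suc_atMost atMost_atLeast0)
    moreover have "(\<Sum>k\<le>n. ?h (n - k)) = (\<Sum>k<n. ?h (n - k)) + 1"
      by (simp add: lessThan_Suc_atMost[symmetric])
    ultimately show ?thesis by (simp add: algebra_simps)
  qed
  also have "?h n - 1 + of_nat n * ?h n + 1 = of_nat (Suc n) * ?h n" by (simp add: distrib_right)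
  also have "\<dots> = (1 - fps_X ^ Suc n) * (of_nat (Suc n) * ?h (Suc n))"
    unfolding inverse_qpoch_Suc[of n, symmetric] by (rule mult.left_commute)
  finally show ?case by (rule mult_left_cancel[OF nonzero, THEN iffD1])
qed simp

definition qbinomial :: "nat \<Rightarrow> nat \<Rightarrow> 'a::field fps" where
  "qbinomial m a = (if a \<le> m then qpoch m * (inverse_qpoch a * inverse_qpoch (m - a)) else 0)"

lemma qbinomial_0 [simp]: "qbinomial m 0 = 1"
  by (simp add: qbinomial_def)

lemma qbinomial_Suc_Suc:
  assumes "a \<le> m"
  shows "qbinomial (Suc m) (Suc a)
    = qbinomial m (Suc a) + fps_X ^ (m - a) * (qbinomial m a :: 'a::field fps)"
proof (cases "a = m")
  case True
  have "qpoch (Suc m) * inverse_qpoch (Suc m) = qpoch m * (inverse_qpoch m :: 'a fps)" by simp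
  then show ?thesis using True by (simp add: qbinomial_def)
next
  case False
  define r where "r = m - Suc a"
  have m: "m = Suc a + r" "m - a = Suc r" using False assms by (auto simp: r_def)
  let ?h = "inverse_qpoch :: nat \<Rightarrow> 'a fps"
  have "1 - fps_X ^ Suc m = (1 - fps_X ^ Suc r) + fps_X ^ Suc r * (1 - fps_X ^ Suc a :: 'a fps)"
    unfolding m by (simp add: algebra_simps power_add)
  then have "qbinomial (Suc m) (Suc a)
    = qpoch m * ((1 - fps_X ^ Suc r) * ?h (Suc r) * ?h (Suc a)
        + fps_X ^ Suc r * ((1 - fps_X ^ Suc a) * ?h (Suc a)) * ?h (Suc r))"
    using m by (simp add: qbinomial_def qpoch_Suc algebra_simps del: power_Suc)
  also have "\<dots> = qbinomial m (Suc a) + fps_X ^ (m - a) * qbinomial m a"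
    unfolding inverse_qpoch_Suc using m by (simp add: qbinomial_def algebra_simps del: power_Suc)
  finally show ?thesis .
qed

lemma subsets_insert_card_Suc:
  assumes "finite A" "t \<notin> A"
  shows "{S. S \<subseteq> insert t A \<and> card S = Suc a}
    = {S. S \<subseteq> A \<and> card S = Suc a} \<union> insert t ` {S. S \<subseteq> A \<and> card S = a}"
proof (intro equalityI subsetI)
  fix S assume S: "S \<in> {S. S \<subseteq> insert t A \<and> card S = Suc a}"
  show "S \<in> {S. S \<subseteq> A \<and> card S = Suc a} \<union> insert t ` {S. S \<subseteq> A \<and> card S = a}"
  proof (cases "t \<in> S")
    case True
    then have "S = insert t (S - {t})" "S - {t} \<in> {S. S \<subseteq> A \<and> card S = a}" using S by auto
    then show ?thesis by blast
  qed (use S in auto)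
next
  fix S assume "S \<in> {S. S \<subseteq> A \<and> card S = Suc a} \<union> insert t ` {S. S \<subseteq> A \<and> card S = a}"
  then show "S \<in> {S. S \<subseteq> insert t A \<and> card S = Suc a}"
    using assms by (auto simp: card_insert_if finite_subset)
qed

lemma card_cut_inversions_insert_max:
  assumes A: "finite A" "\<forall>x\<in>A. x < t" and S: "S \<subseteq> A"
  shows "card (cut_inversions (insert t A) S) = card (cut_inversions A S)"
    and "card (cut_inversions (insert t A) (insert t S))
      = card (cut_inversions A S) + (card A - card S)"
proof -
  have t: "t \<notin> A" using A(2) by auto
  have "cut_inversions (insert t A) S = cut_inversions A S"
    using A(2) S by (fastforce simp: cut_inversions_def)
  then show "card (cut_inversions (insert t A) S) = card (cut_inversions A S)" by simp
  have "cut_inversions (insert t A) (insert t S) = cut_inversions A S \<union> {t} \<times> (A - S)"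
    using A(2) S t by (auto simp: cut_inversions_def)
  moreover have "cut_inversions A S \<inter> {t} \<times> (A - S) = {}"
    using S t by (auto simp: cut_inversions_def)
  ultimately have "card (cut_inversions (insert t A) (insert t S))
    = card (cut_inversions A S) + card ({t} \<times> (A - S))"
    using finite_cut_inversions[OF A(1) S] A(1) by (simp add: card_Un_disjoint)
  then show "card (cut_inversions (insert t A) (insert t S))
    = card (cut_inversions A S) + (card A - card S)"
    using S finite_subset[OF S A(1)] by (simp add: card_cartesian_product card_Diff_subset)
qed

theorem sum_subsets_cut_inversions:
  fixes A :: "'b::linorder set"
  assumes "finite A"
  shows "(\<Sum>S | S \<subseteq> A \<and> card S = a. fps_X ^ card (cut_inversions A S))
    = (qbinomial (card A) a :: 'a::field fps)"
  using assms
proof (induction A arbitrary: a rule: finite_linorder_max_induct)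
  case empty
  have "{S. S \<subseteq> {} \<and> card S = a} = (if a = 0 then {{} :: 'b set} else {})" by auto
  then show ?case by (simp add: qbinomial_def)
next
  case (insert t A)
  let ?b = "\<lambda>A a. \<Sum>S | S \<subseteq> A \<and> card S = a. fps_X ^ card (cut_inversions A S) :: 'a fps"
  have t: "t \<notin> A" using insert.hyps(2) by auto
  have fin: "finite {S. S \<subseteq> A \<and> card S = b}" for b using insert.hyps(1) by simp
  show ?case
  proof (cases a)
    case 0
    have "{S. S \<subseteq> insert t A \<and> card S = 0} = {{}}"
      using insert.hyps(1) finite_subset by (fastforce simp: card_eq_0_iff)
    then show ?thesis using 0 by simp
  next
    case (Suc a')
    have inj: "inj_on (insert t) {S. S \<subseteq> A \<and> card S = a'}"
      using t by (auto intro!: inj_onI dest: insert_ident[THEN iffD1, rotated 2])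
    have "?b (insert t A) (Suc a')
      = (\<Sum>S | S \<subseteq> A \<and> card S = Suc a'. fps_X ^ card (cut_inversions (insert t A) S))
      + (\<Sum>S\<in>insert t ` {S. S \<subseteq> A \<and> card S = a'}. fps_X ^ card (cut_inversions (insert t A) S))"
      unfolding subsets_insert_card_Suc[OF insert.hyps(1) t] using fin t
      by (intro sum.union_disjoint) auto
    also have "(\<Sum>S | S \<subseteq> A \<and> card S = Suc a'. fps_X ^ card (cut_inversions (insert t A) S))
      = ?b A (Suc a')"
      using card_cut_inversions_insert_max(1)[OF insert.hyps(1,2)] by (intro sum.cong refl) auto
    also have "(\<Sum>S\<in>insert t ` {S. S \<subseteq> A \<and> card S = a'}.
        fps_X ^ card (cut_inversions (insert t A) S))
      = (\<Sum>S | S \<subseteq> A \<and> card S = a'. fps_X ^ card (cut_inversions A S) * fps_X ^ (card A - a'))"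
      unfolding sum.reindex[OF inj] using card_cut_inversions_insert_max(2)[OF insert.hyps(1,2)]
      by (intro sum.cong refl) (auto simp: power_add)
    also have "\<dots> = fps_X ^ (card A - a') * ?b A a'"
      by (simp add: mult.commute flip: sum_distrib_right)
    also have "?b A (Suc a') + \<dots> = qbinomial (Suc (card A)) (Suc a')"
      unfolding insert.IH
      by (cases "a' \<le> card A") (simp_all add: qbinomial_Suc_Suc, simp add: qbinomial_def)
    finally show ?thesis using Suc insert.hyps(1) t by simp
  qed
qed

section \<open>Principal specialization of series of bounded degree\<close>

fun var_weight :: "var \<Rightarrow> nat" where
  "var_weight (XVar i) = i - 1"
| "var_weight (YVar i) = i - 1"

definition mon_weight :: "var multiset \<Rightarrow> nat" where
  "mon_weight M = (\<Sum>v\<in>#M. var_weight v)"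

definition monomials :: "nat \<Rightarrow> nat \<Rightarrow> var multiset set" where
  "monomials D d = {M. size M \<le> D \<and> mon_weight M = d}"

definition degree_le :: "nat \<Rightarrow> series \<Rightarrow> bool" where
  "degree_le D f \<longleftrightarrow> (\<forall>M. f M \<noteq> 0 \<longrightarrow> size M \<le> D)"

lemma principal_value_eq: "principal_value v = fps_X ^ var_weight v"
  by (cases v) auto

lemma mon_weight_add: "mon_weight (M + N) = mon_weight M + mon_weight N"
  by (simp add: mon_weight_def)

lemma specialize_monomial_nth:
  "fps_nth (specialize_monomial f M) d = (if mon_weight M = d then f M else 0)"
proof -
  have "(\<Prod>v\<in>#M. principal_value v) = fps_X ^ mon_weight M"
    by (induction M) (auto simp: mon_weight_def principal_value_eq power_add)
  then show ?thesis by (simp add: specialize_monomial_def fps_X_power_nth)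
qed

lemma finite_bounded_multisets:
  assumes "finite A"
  shows "finite {M. set_mset M \<subseteq> A \<and> size M \<le> k}"
proof (rule finite_surj)
  show "finite {xs. set xs \<subseteq> A \<and> length xs \<le> k}" by (rule finite_lists_length_le[OF assms])
  show "{M. set_mset M \<subseteq> A \<and> size M \<le> k} \<subseteq> mset ` {xs. set xs \<subseteq> A \<and> length xs \<le> k}"
  proof
    fix M assume "M \<in> {M. set_mset M \<subseteq> A \<and> size M \<le> k}"
    moreover obtain xs where "M = mset xs" using ex_mset[of M] by blast
    ultimately show "M \<in> mset ` {xs. set xs \<subseteq> A \<and> length xs \<le> k}" by auto
  qed
qed

lemma finite_submsets: "finite {A. A \<subseteq># M}"
  by (rule finite_subset[OF _ finite_bounded_multisets[of "set_mset M" "size M"]])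
    (auto dest: mset_subset_eqD size_mset_mono)

lemma finite_monomials: "finite (monomials D d)"
proof (rule finite_subset)
  let ?A = "XVar ` {..Suc d} \<union> YVar ` {..Suc d}"
  have "v \<in> ?A" if "v \<in># M" "mon_weight M = d" for v M
  proof -
    have "var_weight v \<le> d"
      using multi_member_split[OF that(1)] that(2) by (auto simp: mon_weight_def)
    then show ?thesis by (cases v) auto
  qed
  then show "monomials D d \<subseteq> {M. set_mset M \<subseteq> ?A \<and> size M \<le> D}"
    by (auto simp: monomials_def)
  show "finite {M. set_mset M \<subseteq> ?A \<and> size M \<le> D}" by (rule finite_bounded_multisets) auto
qed

lemma principal_specialization_nth:
  assumes "degree_le D f"
  shows "fps_nth (principal_specialization f) d = (\<Sum>M\<in>monomials D d. f M)"
proof -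
  have "fps_nth (principal_specialization f) d = (\<Sum>M | mon_weight M = d \<and> f M \<noteq> 0. f M)"
    unfolding principal_specialization_def fps_nth_Abs_fps specialize_monomial_nth
    by (rule sum.cong) auto
  also have "\<dots> = (\<Sum>M\<in>monomials D d. f M)"
    using assms finite_monomials[of D d]
    by (intro sum.mono_neutral_left) (auto simp: monomials_def degree_le_def)
  finally show ?thesis .
qed

lemma degree_le_mult:
  assumes "degree_le D f" "degree_le D' g"
  shows "degree_le (D + D') (series_mult f g)"
  unfolding degree_le_def
proof (intro allI impI)
  fix M assume "series_mult f g M \<noteq> 0"
  then obtain A where A: "A \<subseteq># M" "f A * g (M - A) \<noteq> 0"
    unfolding series_mult_def using sum.not_neutral_contains_not_neutral by force
  then have "size A \<le> D" "size (M - A) \<le> D'" using assms by (auto simp: degree_le_def)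
  then show "size M \<le> D + D'" using A by (simp add: size_Diff_submset)
qed

lemma sum_series_mult:
  assumes f: "degree_le D f" and g: "degree_le D' g"
  shows "(\<Sum>M\<in>monomials (D + D') d. series_mult f g M)
    = (\<Sum>(A, B)\<in>(\<Union>i\<le>d. monomials D i \<times> monomials D' (d - i)). f A * g B)"
proof -
  let ?pairs = "{(A, B). A + B \<in> monomials (D + D') d}"
  let ?L = "SIGMA M:monomials (D + D') d. {A. A \<subseteq># M}"
  have fin: "finite ?L" by (simp add: finite_monomials finite_submsets)
  have "?pairs = (\<lambda>(M, A). (A, M - A)) ` ?L" by (force simp: image_iff)
  then have fin_pairs: "finite ?pairs" using fin by simp
  have "(\<Sum>M\<in>monomials (D + D') d. series_mult f g M) = (\<Sum>(M, A)\<in>?L. f A * g (M - A))"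
    unfolding series_mult_def by (rule sum.Sigma) (auto simp: finite_monomials finite_submsets)
  also have "\<dots> = (\<Sum>(A, B)\<in>?pairs. f A * g B)"
    by (rule sum.reindex_bij_witness[of _ "\<lambda>(A, B). (A + B, A)" "\<lambda>(M, A). (A, M - A)"]) auto
  also have "\<dots> = (\<Sum>(A, B)\<in>(\<Union>i\<le>d. monomials D i \<times> monomials D' (d - i)). f A * g B)"
  proof (rule sum.mono_neutral_right[OF fin_pairs])
    show "(\<Union>i\<le>d. monomials D i \<times> monomials D' (d - i)) \<subseteq> ?pairs"
      by (auto simp: monomials_def mon_weight_add)
    show "\<forall>p\<in>?pairs - (\<Union>i\<le>d. monomials D i \<times> monomials D' (d - i)).
        (case p of (A, B) \<Rightarrow> f A * g B) = 0"
      using f g by (force simp: monomials_def mon_weight_add degree_le_def)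
  qed
  finally show ?thesis .
qed

lemma principal_specialization_mult:
  assumes f: "degree_le D f" and g: "degree_le D' g"
  shows "principal_specialization (series_mult f g)
    = principal_specialization f * principal_specialization g"
proof (rule fps_ext)
  fix d
  have "fps_nth (principal_specialization (series_mult f g)) d
    = (\<Sum>(A, B)\<in>(\<Union>i\<le>d. monomials D i \<times> monomials D' (d - i)). f A * g B)"
    using principal_specialization_nth[OF degree_le_mult[OF f g]] sum_series_mult[OF f g] by simp
  also have "\<dots> = (\<Sum>i\<le>d. \<Sum>(A, B)\<in>monomials D i \<times> monomials D' (d - i). f A * g B)"
    using finite_monomials by (intro sum.UNION_disjoint) (auto simp: monomials_def)
  also have "\<dots> = fps_nth (principal_specialization f * principal_specialization g) d"
    by (simp add: fps_mult_nth atLeast0AtMost principal_specialization_nth[OF f]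
        principal_specialization_nth[OF g] sum_product sum.cartesian_product)
  finally show "fps_nth (principal_specialization (series_mult f g)) d
    = fps_nth (principal_specialization f * principal_specialization g) d" .
qed

lemma principal_specialization_sum:
  assumes "finite I" and f: "\<And>i. i \<in> I \<Longrightarrow> degree_le D (f i)"
  shows "principal_specialization (\<lambda>M. \<Sum>i\<in>I. c i * f i M)
    = (\<Sum>i\<in>I. fps_const (c i) * principal_specialization (f i))"
proof (rule fps_ext)
  fix d
  have "degree_le D (\<lambda>M. \<Sum>i\<in>I. c i * f i M)"
    unfolding degree_le_def
  proof (intro allI impI)
    fix M assume "(\<Sum>i\<in>I. c i * f i M) \<noteq> 0"
    then obtain i where "i \<in> I" "c i * f i M \<noteq> 0"
      using sum.not_neutral_contains_not_neutral by force
    then show "size M \<le> D" using f by (auto simp: degree_le_def)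
  qed
  then have "fps_nth (principal_specialization (\<lambda>M. \<Sum>i\<in>I. c i * f i M)) d
    = (\<Sum>i\<in>I. c i * (\<Sum>M\<in>monomials D d. f i M))"
    by (simp add: principal_specialization_nth sum.swap[of _ I] sum_distrib_left)
  also have "\<dots> = fps_nth (\<Sum>i\<in>I. fps_const (c i) * principal_specialization (f i)) d"
    by (simp add: fps_sum_nth principal_specialization_nth[OF f])
  finally show "fps_nth (principal_specialization (\<lambda>M. \<Sum>i\<in>I. c i * f i M)) d
    = fps_nth (\<Sum>i\<in>I. fps_const (c i) * principal_specialization (f i)) d" .
qed

lemma degree_le_power_sum: "degree_le k (power_sum v k)"
  by (auto simp: degree_le_def power_sum_def)

lemma degree_le_power_sum_partition: "degree_le (sum_list \<mu>) (power_sum_partition v \<mu>)"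
proof (induction \<mu>)
  case Nil
  then show ?case by (auto simp: power_sum_partition_def series_one_def degree_le_def)
next
  case (Cons k \<mu>)
  then show ?case
    using degree_le_mult[OF degree_le_power_sum] by (simp add: power_sum_partition_def)
qed

lemma principal_specialization_one: "principal_specialization series_one = 1"
proof (rule fps_ext)
  fix d
  have "degree_le 0 series_one" by (auto simp: degree_le_def series_one_def)
  moreover have "monomials 0 d = (if d = 0 then {{#}} else {})"
    by (auto simp: monomials_def mon_weight_def)
  ultimately show "fps_nth (principal_specialization series_one) d = fps_nth 1 d"
    by (simp add: principal_specialization_nth series_one_def)
qed

context
  fixes v :: "nat \<Rightarrow> var"
  assumes v: "v \<in> {XVar, YVar}"
begin

lemma mon_weight_replicate_mset: "mon_weight (replicate_mset k (v i)) = k * (i - 1)"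
  using v by (auto simp: mon_weight_def image_replicate_mset)

lemma principal_specialization_power_sum_nth:
  assumes "0 < k"
  shows "fps_nth (principal_specialization (power_sum v k)) d = (if k dvd d then 1 else 0)"
proof -
  have "M \<in> monomials k d \<and> (\<exists>i\<ge>1. M = replicate_mset k (v i))
    \<longleftrightarrow> k dvd d \<and> M = replicate_mset k (v (Suc (d div k)))" for M
    using assms mon_weight_replicate_mset
    by (auto simp: monomials_def intro!: exI[of _ "Suc (d div k)"])
  then have "{M \<in> monomials k d. \<exists>i\<ge>1. M = replicate_mset k (v i)}
    = (if k dvd d then {replicate_mset k (v (Suc (d div k)))} else {})" by auto
  moreover have "fps_nth (principal_specialization (power_sum v k)) d
    = (\<Sum>M \<in> {M \<in> monomials k d. \<exists>i\<ge>1. M = replicate_mset k (v i)}. 1)"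
    unfolding principal_specialization_nth[OF degree_le_power_sum] power_sum_def
    by (rule sum.inter_filter[OF finite_monomials, symmetric])
  ultimately show ?thesis by simp
qed

lemma principal_specialization_power_sum:
  assumes "0 < k"
  shows "principal_specialization (power_sum v k) = inverse (1 - fps_X ^ k)"
proof -
  have "principal_specialization (power_sum v k) * (1 - fps_X ^ k) = 1"
  proof (rule fps_ext)
    fix d
    show "fps_nth (principal_specialization (power_sum v k) * (1 - fps_X ^ k)) d = fps_nth 1 d"
      using assms
      by (auto simp: right_diff_distrib principal_specialization_power_sum_nth
          fps_X_power_mult_right_nth dvd_minus_self dest: dvd_imp_le)
  qed
  then show ?thesis using assms by (metis fps_inverse_unique mult.commute)
qed

lemma principal_specialization_power_sum_partition:
  assumes "0 \<notin> set \<mu>"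
  shows "principal_specialization (power_sum_partition v \<mu>) = (\<Prod>k\<in>#mset \<mu>. inverse (1 - fps_X ^ k))"
  using assms
proof (induction \<mu>)
  case Nil
  then show ?case by (simp add: power_sum_partition_def principal_specialization_one)
next
  case (Cons k \<mu>)
  have "principal_specialization (power_sum_partition v (k # \<mu>))
    = principal_specialization (power_sum v k) * principal_specialization (power_sum_partition v \<mu>)"
    using principal_specialization_mult[OF degree_le_power_sum degree_le_power_sum_partition]
    by (simp add: power_sum_partition_def)
  then show ?case using Cons principal_specialization_power_sum[of k] by simp
qed

end

section \<open>Cycle types as multisets\<close>

definition mset_partitions :: "nat \<Rightarrow> nat multiset set" where
  "mset_partitions m = {M. 0 \<notin># M \<and> sum_mset M = m}"

definition z_mset :: "nat multiset \<Rightarrow> nat" where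
  "z_mset M = (\<Prod>i\<in>set_mset M. i ^ count M i * fact (count M i))"

definition mset_choose :: "'a multiset \<Rightarrow> 'a multiset \<Rightarrow> nat" where
  "mset_choose M N = (\<Prod>i\<in>set_mset N. count M i choose count N i)"

lemma member_le_sum_mset: "x \<in># M \<Longrightarrow> x \<le> sum_mset (M :: nat multiset)"
  by (auto dest!: multi_member_split)

lemma size_le_sum_mset: "0 \<notin># M \<Longrightarrow> size M \<le> sum_mset (M :: nat multiset)"
proof (induction M)
  case (add x M)
  then show ?case by (cases x) auto
qed simp

lemma finite_mset_partitions: "finite (mset_partitions m)"
  by (rule finite_subset[OF _ finite_bounded_multisets[of "{..m}" m]])
    (use size_le_sum_mset member_le_sum_mset in \<open>auto simp: mset_partitions_def\<close>)

lemma mset_partitions_0: "mset_partitions 0 = {{#}}"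
proof -
  have "M = {#}" if "0 \<notin># M" "sum_mset M = 0" for M :: "nat multiset"
    using size_le_sum_mset[OF that(1)] that(2) by simp
  then show ?thesis by (auto simp: mset_partitions_def)
qed

lemma mset_partitions_submset:
  assumes "M \<in> mset_partitions m" "N \<subseteq># M" "sum_mset N = k"
  shows "N \<in> mset_partitions k" "M - N \<in> mset_partitions (m - k)"
  using assms by (auto simp: mset_partitions_def sum_mset_diff dest: mset_subset_eqD in_diffD)

lemma mset_choose_eq_prod:
  assumes "finite K" "set_mset N \<subseteq> K"
  shows "mset_choose M N = (\<Prod>i\<in>K. count M i choose count N i)"
  unfolding mset_choose_def using assms by (intro prod.mono_neutral_left) (auto simp: not_in_iff)

lemma z_mset_eq_prod:
  assumes "finite K" "set_mset M \<subseteq> K"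
  shows "z_mset M = (\<Prod>i\<in>K. i ^ count M i * fact (count M i))"
  unfolding z_mset_def using assms by (intro prod.mono_neutral_left) (auto simp: not_in_iff)

lemma z_mset_pos: "0 \<notin># M \<Longrightarrow> 0 < z_mset M"
  unfolding z_mset_def
  by (rule prod_pos) (metis fact_gt_zero mult_pos_pos neq0_conv zero_less_power)

lemma z_mset_eq_mset_choose:
  assumes "N \<subseteq># M"
  shows "z_mset M = mset_choose M N * (z_mset N * z_mset (M - N))"
proof -
  let ?K = "set_mset M"
  have K: "set_mset N \<subseteq> ?K" "set_mset (M - N) \<subseteq> ?K"
    using assms by (auto dest: mset_subset_eqD in_diffD)
  have "i ^ count M i * fact (count M i) = (count M i choose count N i) *
    ((i ^ count N i * fact (count N i)) * (i ^ count (M - N) i * fact (count (M - N) i)))" for i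
  proof -
    have count_le: "count N i \<le> count M i" using assms by (simp add: mset_subset_eq_count)
    have "i ^ count M i = i ^ count N i * i ^ (count M i - count N i)"
      using count_le by (simp flip: power_add)
    moreover have "fact (count M i)
      = fact (count N i) * fact (count M i - count N i) * (count M i choose count N i)"
      using binomial_fact_lemma[OF count_le] by simp
    ultimately show ?thesis by (simp add: mult_ac)
  qed
  then show ?thesis
    using K by (simp add: z_mset_eq_prod[of ?K] mset_choose_eq_prod[of ?K] flip: prod.distrib)
qed

lemma mset_choose_eq_0:
  assumes "\<not> N \<subseteq># M"
  shows "mset_choose M N = 0"
proof -
  obtain i where "count M i < count N i" using assms by (auto simp: subseteq_mset_def not_le)
  moreover from this have "i \<in># N" by (simp flip: count_greater_zero_iff)
  ultimately show ?thesis by (auto simp: mset_choose_def intro!: bexI[of _ i])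
qed

lemma mset_choose_singleton: "mset_choose M {#k#} = count M k"
  by (simp add: mset_choose_def)

lemma mset_choose_add_mset:
  "mset_choose (add_mset k M) N
    = mset_choose M N + (if k \<in># N then mset_choose M (N - {#k#}) else 0)"
proof (cases "k \<in># N")
  case True
  then obtain c where c: "count N k = Suc c" by (metis count_greater_zero_iff gr0_implies_Suc)
  let ?P = "\<Prod>i\<in>set_mset N - {k}. count M i choose count N i"
  have split: "mset_choose M' N'
    = (count M' k choose count N' k) * (\<Prod>i\<in>set_mset N - {k}. count M' i choose count N' i)"
    if "set_mset N' \<subseteq> set_mset N" for M' N'
    using that True by (simp add: mset_choose_eq_prod[of "set_mset N"] prod.remove)
  have "mset_choose (add_mset k M) N = (Suc (count M k) choose Suc c) * ?P"
    using c by (subst split) (auto intro!: prod.cong)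
  moreover have "mset_choose M N = (count M k choose Suc c) * ?P" using c by (subst split) auto
  moreover have "mset_choose M (N - {#k#}) = (count M k choose c) * ?P"
  proof -
    have "count (N - {#k#}) i = count N i" if "i \<in> set_mset N - {k}" for i using that by auto
    moreover have "set_mset (N - {#k#}) \<subseteq> set_mset N" by (auto dest: in_diffD)
    ultimately show ?thesis using c by (simp add: split)
  qed
  ultimately show ?thesis using True by (simp add: distrib_right)
qed (auto simp: mset_choose_def intro!: prod.cong)

lemma sum_mset_choose_add_mset:
  fixes f :: "'a multiset \<Rightarrow> 'r::comm_semiring_1"
  shows "(\<Sum>N | N \<subseteq># add_mset k M. of_nat (mset_choose (add_mset k M) N) * f N)
    = (\<Sum>N | N \<subseteq># M. of_nat (mset_choose M N) * f N)
      + (\<Sum>N | N \<subseteq># M. of_nat (mset_choose M N) * f (add_mset k N))"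
proof -
  let ?U = "{N. N \<subseteq># add_mset k M}"
  have "(\<Sum>N\<in>?U. of_nat (mset_choose (add_mset k M) N) * f N)
    = (\<Sum>N\<in>?U. of_nat (mset_choose M N) * f N)
      + (\<Sum>N\<in>?U. if k \<in># N then of_nat (mset_choose M (N - {#k#})) * f N else 0)"
    unfolding sum.distrib[symmetric]
    by (intro sum.cong) (auto simp: mset_choose_add_mset distrib_right)
  also have "(\<Sum>N\<in>?U. of_nat (mset_choose M N) * f N)
    = (\<Sum>N | N \<subseteq># M. of_nat (mset_choose M N) * f N)"
    by (rule sum.mono_neutral_right[OF finite_submsets])
      (auto simp: mset_choose_eq_0 intro: subset_mset.order_trans)
  also have "(\<Sum>N\<in>?U. if k \<in># N then of_nat (mset_choose M (N - {#k#})) * f N else 0)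
    = (\<Sum>N\<in>{N \<in> ?U. k \<in># N}. of_nat (mset_choose M (N - {#k#})) * f N)"
    by (rule sum.inter_filter[OF finite_submsets, symmetric])
  also have "\<dots> = (\<Sum>N | N \<subseteq># M. of_nat (mset_choose M N) * f (add_mset k N))"
    by (rule sum.reindex_bij_witness[of _ "add_mset k" "\<lambda>N. N - {#k#}"])
      (auto simp: insert_subset_eq_iff subset_eq_diff_conv)
  finally show ?thesis .
qed

lemma sum_Pow_image_mset:
  fixes f :: "'b multiset \<Rightarrow> 'r::comm_semiring_1"
  assumes "finite R"
  shows "(\<Sum>R'\<in>Pow R. f (image_mset l (mset_set R')))
    = (\<Sum>N | N \<subseteq># image_mset l (mset_set R).
        of_nat (mset_choose (image_mset l (mset_set R)) N) * f N)"
  using assms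
proof (induction R arbitrary: f rule: finite_induct)
  case empty
  then show ?case by (simp add: mset_choose_def)
next
  case (insert r R)
  have "inj_on (insert r) (Pow R)"
    using insert.hyps(2) by (intro inj_onI) (metis Pow_iff insert_ident subsetD)
  moreover have "image_mset l (mset_set (insert r R'))
    = add_mset (l r) (image_mset l (mset_set R'))"
    if "R' \<in> Pow R" for R'
    using that insert.hyps finite_subset[of R' R] by (subst mset_set.insert) auto
  ultimately have "(\<Sum>R'\<in>insert r ` Pow R. f (image_mset l (mset_set R')))
    = (\<Sum>R'\<in>Pow R. f (add_mset (l r) (image_mset l (mset_set R'))))"
    by (simp add: sum.reindex)
  moreover have "(\<Sum>R'\<in>Pow (insert r R). f (image_mset l (mset_set R')))
    = (\<Sum>R'\<in>Pow R. f (image_mset l (mset_set R')))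
      + (\<Sum>R'\<in>insert r ` Pow R. f (image_mset l (mset_set R')))"
    unfolding Pow_insert using insert.hyps by (intro sum.union_disjoint) auto
  ultimately show ?case
    using insert.IH[of f] insert.IH[of "\<lambda>N. f (add_mset (l r) N)"] insert.hyps
    by (simp add: sum_mset_choose_add_mset)
qed

section \<open>Averages over cycle types\<close>

definition type_weight :: "nat multiset \<Rightarrow> 'a::field_char_0 fps" where
  "type_weight M = fps_const (1 / of_nat (z_mset M)) * (\<Prod>k\<in>#M. inverse (1 - fps_X ^ k))"

lemma mset_choose_type_weight:
  assumes "N \<subseteq># M" "0 \<notin># M"
  shows "of_nat (mset_choose M N) * type_weight M
    = (type_weight N * type_weight (M - N) :: 'a::field_char_0 fps)"
proof -
  let ?p = "\<lambda>M. \<Prod>k\<in>#M. inverse (1 - fps_X ^ k :: 'a fps)"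
  have "0 \<notin># N" "0 \<notin># M - N" using assms by (auto dest: mset_subset_eqD in_diffD)
  then have "z_mset N \<noteq> 0" "z_mset (M - N) \<noteq> 0" "mset_choose M N \<noteq> 0"
    using z_mset_pos assms(2) z_mset_eq_mset_choose[OF assms(1)] z_mset_pos[of M] by fastforce+
  then have "of_nat (mset_choose M N) * (1 / of_nat (z_mset M))
    = (1 / of_nat (z_mset N)) * (1 / of_nat (z_mset (M - N)) :: 'a)"
    unfolding z_mset_eq_mset_choose[OF assms(1)] by (simp add: field_simps)
  then have "of_nat (mset_choose M N) * fps_const (1 / of_nat (z_mset M))
    = fps_const (1 / of_nat (z_mset N)) * fps_const (1 / of_nat (z_mset (M - N)) :: 'a)"
    by (simp only: fps_of_nat[symmetric] fps_const_mult)
  moreover have "?p M = ?p N * ?p (M - N)"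
    using assms(1) by (metis image_mset_union prod_mset.union subset_mset.add_diff_inverse)
  ultimately show ?thesis
    unfolding type_weight_def by (simp only: mult.assoc[symmetric]) (simp only: mult_ac)
qed

lemma sum_mset_choose_type_weight:
  fixes \<phi> :: "nat multiset \<Rightarrow> 'a::field_char_0 fps"
  assumes "k \<le> m"
  shows "(\<Sum>M\<in>mset_partitions m. type_weight M *
      (\<Sum>N | N \<subseteq># M \<and> sum_mset N = k. of_nat (mset_choose M N) * \<phi> N))
    = (\<Sum>M\<in>mset_partitions (m - k). type_weight M) * (\<Sum>N\<in>mset_partitions k. type_weight N * \<phi> N)"
proof -
  let ?L = "SIGMA M:mset_partitions m. {N. N \<subseteq># M \<and> sum_mset N = k}"
  have fin: "finite {N. N \<subseteq># M \<and> sum_mset N = k}" for M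
    by (rule finite_subset[OF _ finite_submsets[of M]]) auto
  have "(\<Sum>M\<in>mset_partitions m. type_weight M *
      (\<Sum>N | N \<subseteq># M \<and> sum_mset N = k. of_nat (mset_choose M N) * \<phi> N))
    = (\<Sum>M\<in>mset_partitions m. \<Sum>N | N \<subseteq># M \<and> sum_mset N = k.
        type_weight N * type_weight (M - N) * \<phi> N)"
    unfolding sum_distrib_left
    by (intro sum.cong refl) (auto simp: mset_partitions_def mult_ac
      simp flip: mset_choose_type_weight)
  also have "\<dots> = (\<Sum>(M, N)\<in>?L. type_weight N * type_weight (M - N) * \<phi> N)"
    using fin by (intro sum.Sigma) (auto simp: finite_mset_partitions)
  also have "\<dots> = (\<Sum>(M, N)\<in>mset_partitions (m - k) \<times> mset_partitions k.
      type_weight N * type_weight M * \<phi> N)"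
    using assms mset_partitions_submset
    by (intro sum.reindex_bij_witness[of _ "\<lambda>(M, N). (M + N, N)" "\<lambda>(M, N). (M - N, N)"])
      (auto simp: mset_partitions_def)
  also have "\<dots> = (\<Sum>M\<in>mset_partitions (m - k). type_weight M)
    * (\<Sum>N\<in>mset_partitions k. type_weight N * \<phi> N)"
    unfolding sum_product sum.cartesian_product by (intro sum.cong refl) (auto simp: mult_ac)
  finally show ?thesis .
qed

lemma sum_mset_eq_sum_count: "sum_mset M = (\<Sum>k\<in>set_mset M. k * count M k)" for M :: "nat multiset"
proof (induction M)
  case (add x M)
  have "(\<Sum>k\<in>set_mset (add_mset x M). k * count (add_mset x M) k)
    = (\<Sum>k\<in>insert x (set_mset M). k * count M k)
      + (\<Sum>k\<in>insert x (set_mset M). if k = x then k else 0)"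
    unfolding sum.distrib[symmetric] by (intro sum.cong) auto
  also have "(\<Sum>k\<in>insert x (set_mset M). k * count M k) = (\<Sum>k\<in>set_mset M. k * count M k)"
    by (intro sum.mono_neutral_right) (auto simp: not_in_iff)
  finally show ?case using add by simp
qed simp

lemma type_weight_singleton: "0 < k \<Longrightarrow> of_nat k * type_weight {#k#} = inverse (1 - fps_X ^ k)"
  by (simp add: type_weight_def z_mset_def fps_const_mult mult.assoc[symmetric] flip: fps_of_nat)

lemma sum_mset_type_weight:
  assumes M: "0 \<notin># M"
  shows "of_nat (sum_mset M) * type_weight M
    = (\<Sum>k\<in>set_mset M. inverse (1 - fps_X ^ k) * type_weight (M - {#k#}))"
proof -
  have "of_nat (k * count M k) * type_weight M = inverse (1 - fps_X ^ k) * type_weight (M - {#k#})"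
    if "k \<in># M" for k
  proof -
    have "0 < k" using M that by (metis neq0_conv)
    then show ?thesis
      using mset_choose_type_weight[of "{#k#}" M] that M
      by (simp add: mset_choose_singleton mult.assoc flip: type_weight_singleton)
  qed
  then show ?thesis
    unfolding sum_mset_eq_sum_count[of M] of_nat_sum sum_distrib_right by (intro sum.cong) auto
qed

lemma sum_mset_partitions_remove:
  "(\<Sum>M\<in>mset_partitions m. \<Sum>k\<in>set_mset M. g k (M - {#k#}))
    = (\<Sum>k=1..m. \<Sum>N\<in>mset_partitions (m - k). g k N)"
proof -
  have "(\<Sum>M\<in>mset_partitions m. \<Sum>k\<in>set_mset M. g k (M - {#k#}))
    = (\<Sum>(M, k)\<in>(SIGMA M:mset_partitions m. set_mset M). g k (M - {#k#}))"
    by (rule sum.Sigma) (auto simp: finite_mset_partitions)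
  also have "\<dots> = (\<Sum>(k, N)\<in>(SIGMA k:{1..m}. mset_partitions (m - k)). g k N)"
  proof (rule sum.reindex_bij_witness[of _ "\<lambda>(k, N). (add_mset k N, k)" "\<lambda>(M, k). (k, M - {#k#})"])
    fix p assume "p \<in> (SIGMA M:mset_partitions m. set_mset M)"
    then obtain M k where p: "p = (M, k)" "M \<in> mset_partitions m" "k \<in># M" by auto
    then have "1 \<le> k" "k \<le> m"
      using member_le_sum_mset[of k M]
      by (auto simp: mset_partitions_def Suc_le_eq intro: Suc_leI gr0I)
    moreover have "M - {#k#} \<in> mset_partitions (m - k)"
      using mset_partitions_submset(2)[OF p(2), of "{#k#}" k] p(3) by simp
    ultimately show "(case p of (M, k) \<Rightarrow> (k, M - {#k#}))
      \<in> (SIGMA k:{1..m}. mset_partitions (m - k))"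
      using p(1) by simp
  qed (auto simp: mset_partitions_def)
  also have "\<dots> = (\<Sum>k=1..m. \<Sum>N\<in>mset_partitions (m - k). g k N)"
    by (rule sum.Sigma[symmetric]) (auto simp: finite_mset_partitions)
  finally show ?thesis .
qed

theorem sum_type_weight: "(\<Sum>M\<in>mset_partitions m. type_weight M) = inverse_qpoch m"
proof (induction m rule: less_induct)
  case (less m)
  show ?case
  proof (cases "m = 0")
    case True
    then show ?thesis by (simp add: mset_partitions_0 type_weight_def z_mset_def)
  next
    case False
    have "of_nat m * (\<Sum>M\<in>mset_partitions m. type_weight M :: 'a fps)
      = (\<Sum>M\<in>mset_partitions m. \<Sum>k\<in>set_mset M. inverse (1 - fps_X ^ k) * type_weight (M - {#k#}))"
      unfolding sum_distrib_left
      by (intro sum.cong refl) (auto simp: mset_partitions_def simp flip: sum_mset_type_weight)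
    also have "\<dots> = (\<Sum>k=1..m. inverse (1 - fps_X ^ k) * inverse_qpoch (m - k))"
      unfolding sum_mset_partitions_remove[of "\<lambda>k N. inverse (1 - fps_X ^ k) * type_weight N" m]
      using less by (intro sum.cong refl) (simp flip: sum_distrib_left)
    also have "\<dots> = of_nat m * inverse_qpoch m" by (rule newton_identity)
    finally show ?thesis using False by simp
  qed
qed

definition type_average :: "nat \<Rightarrow> (nat multiset \<Rightarrow> 'a fps) \<Rightarrow> 'a::field_char_0 fps" where
  "type_average m \<phi> = (\<Sum>M\<in>mset_partitions m. type_weight M * \<phi> M)"

lemma type_average_cong:
  "(\<And>M. M \<in> mset_partitions m \<Longrightarrow> \<phi> M = \<psi> M) \<Longrightarrow> type_average m \<phi> = type_average m \<psi>"
  by (simp add: type_average_def)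

lemma type_average_const: "type_average m (\<lambda>M. c) = inverse_qpoch m * c"
  by (simp add: type_average_def sum_type_weight flip: sum_distrib_right)

lemma type_average_add: "type_average m (\<lambda>M. \<phi> M + \<psi> M) = type_average m \<phi> + type_average m \<psi>"
  by (simp add: type_average_def distrib_left sum.distrib)

lemma type_average_sum: "type_average m (\<lambda>M. \<Sum>i\<in>I. c i * \<phi> i M)
  = (\<Sum>i\<in>I. c i * type_average m (\<phi> i))"
  by (simp add: type_average_def sum_distrib_left sum.swap[of _ I] mult.left_commute)

lemma type_average_mset_choose:
  assumes "k \<le> m"
  shows "type_average m (\<lambda>M. \<Sum>N | N \<subseteq># M \<and> sum_mset N = k. of_nat (mset_choose M N) * \<phi> N)
    = inverse_qpoch (m - k) * type_average k \<phi>"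
  unfolding type_average_def sum_mset_choose_type_weight[OF assms] sum_type_weight ..

section \<open>Cycle types of permutations\<close>

definition cycle_mset :: "('a \<Rightarrow> 'a) \<Rightarrow> 'a set \<Rightarrow> nat multiset" where
  "cycle_mset \<sigma> S = image_mset card (mset_set (orbit \<sigma> ` S))"

lemma invariant_orbit_subset:
  assumes "\<sigma> ` S \<subseteq> S" "x \<in> S"
  shows "orbit \<sigma> x \<subseteq> S"
proof
  fix y assume "y \<in> orbit \<sigma> x"
  then show "y \<in> S" by induct (use assms in auto)
qed

lemma cycle_mset_cong:
  assumes "\<sigma> ` S \<subseteq> S" "\<And>x. x \<in> S \<Longrightarrow> \<sigma> x = \<rho> x"
  shows "cycle_mset \<sigma> S = cycle_mset \<rho> S"
proof -
  have "orbit \<sigma> x = orbit \<rho> x" if "x \<in> S" for x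
    using assms by (intro orbit_cong0[OF that]) auto
  then show ?thesis by (simp add: cycle_mset_def)
qed

context
  fixes \<sigma> :: "'a \<Rightarrow> 'a"
  assumes \<sigma>: "permutation \<sigma>"
begin

lemma orbit_eq_if_mem: "y \<in> orbit \<sigma> x \<Longrightarrow> orbit \<sigma> y = orbit \<sigma> x"
  by (rule orbit_cyclic_eq3[OF cyclic_on_orbit'[OF \<sigma>]])

lemma Union_orbits:
  assumes "\<sigma> ` S \<subseteq> S"
  shows "\<Union> (orbit \<sigma> ` S) = S"
  using invariant_orbit_subset[OF assms] permutation_self_in_orbit[OF \<sigma>] by blast

lemma invariant_if_image_subset:
  assumes "finite S" "\<sigma> ` S \<subseteq> S"
  shows "\<sigma> ` S = S"
  using assms bij_is_inj[OF permutation_bijective[OF \<sigma>]]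
  by (intro endo_inj_surj) (auto intro: inj_on_subset)

lemma pairwise_disjnt_orbits: "pairwise disjnt (orbit \<sigma> ` S)"
proof (rule pairwiseI)
  fix C D assume "C \<in> orbit \<sigma> ` S" "D \<in> orbit \<sigma> ` S" "C \<noteq> D"
  then show "disjnt C D" unfolding disjnt_iff by (metis imageE orbit_eq_if_mem)
qed

lemma sum_cycle_mset:
  assumes "\<sigma> ` S \<subseteq> S" "finite S"
  shows "sum_mset (cycle_mset \<sigma> S) = card S"
proof -
  have "sum_mset (cycle_mset \<sigma> S) = (\<Sum>C\<in>orbit \<sigma> ` S. card C)"
    by (simp add: cycle_mset_def sum_unfold_sum_mset)
  also have "\<dots> = card (\<Union> (orbit \<sigma> ` S))"
    using finite_orbit[OF permutation_self_in_orbit[OF \<sigma>]] pairwise_disjnt_orbits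
    by (intro card_Union_disjoint[symmetric]) auto
  finally show ?thesis by (simp add: Union_orbits[OF assms(1)])
qed

lemma cycle_mset_Un_disjoint:
  assumes "\<sigma> ` S \<subseteq> S" "\<sigma> ` T \<subseteq> T" "finite S" "finite T" "S \<inter> T = {}"
  shows "cycle_mset \<sigma> (S \<union> T) = cycle_mset \<sigma> S + cycle_mset \<sigma> T"
proof -
  have "orbit \<sigma> ` S \<inter> orbit \<sigma> ` T = {}"
  proof (rule ccontr)
    assume "orbit \<sigma> ` S \<inter> orbit \<sigma> ` T \<noteq> {}"
    then obtain x y where "x \<in> S" "y \<in> T" "orbit \<sigma> x = orbit \<sigma> y" by auto
    then have "x \<in> T"
      using permutation_self_in_orbit[OF \<sigma>, of x] invariant_orbit_subset[OF assms(2)] by auto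
    then show False using \<open>x \<in> S\<close> assms(5) by blast
  qed
  then show ?thesis using assms(3,4) by (simp add: cycle_mset_def image_Un mset_set_Union)
qed

lemma bij_betw_invariant_subsets:
  assumes A: "finite A" "\<sigma> ` A = A"
  shows "bij_betw (\<lambda>S. orbit \<sigma> ` S) {S. S \<subseteq> A \<and> \<sigma> ` S = S} (Pow (orbit \<sigma> ` A))"
proof (rule bij_betw_byWitness[where f' = Union])
  show "\<forall>S\<in>{S. S \<subseteq> A \<and> \<sigma> ` S = S}. \<Union> (orbit \<sigma> ` S) = S" using Union_orbits by auto
  show "\<forall>R\<in>Pow (orbit \<sigma> ` A). orbit \<sigma> ` \<Union> R = R"
  proof (intro ballI equalityI subsetI)
    fix R C assume R: "R \<in> Pow (orbit \<sigma> ` A)"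
    show "C \<in> R" if mem: "C \<in> orbit \<sigma> ` \<Union> R"
    proof -
      obtain y D where y: "C = orbit \<sigma> y" "y \<in> D" "D \<in> R" using mem by blast
      moreover obtain x where "D = orbit \<sigma> x" using y(3) R by auto
      ultimately show ?thesis using orbit_eq_if_mem by metis
    qed
    show "C \<in> orbit \<sigma> ` \<Union> R" if mem: "C \<in> R"
    proof -
      obtain x where "C = orbit \<sigma> x" using mem R by auto
      then show ?thesis using mem permutation_self_in_orbit[OF \<sigma>, of x] by blast
    qed
  qed
  show "Union ` Pow (orbit \<sigma> ` A) \<subseteq> {S. S \<subseteq> A \<and> \<sigma> ` S = S}"
  proof
    fix S assume "S \<in> Union ` Pow (orbit \<sigma> ` A)"
    then obtain R where R: "S = \<Union> R" "R \<subseteq> orbit \<sigma> ` A" by auto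
    then have "S \<subseteq> A" using invariant_orbit_subset[of \<sigma> A] A(2) by blast
    moreover have "\<sigma> ` S \<subseteq> S" using R orbit.step[of _ \<sigma>] by blast
    ultimately show "S \<in> {S. S \<subseteq> A \<and> \<sigma> ` S = S}"
      using invariant_if_image_subset finite_subset[OF _ A(1)] by blast
  qed
qed auto

lemma sum_invariant_subsets:
  fixes f :: "nat multiset \<Rightarrow> 'r::comm_semiring_1"
  assumes A: "finite A" "\<sigma> ` A = A"
  shows "(\<Sum>S | S \<subseteq> A \<and> \<sigma> ` S = S \<and> card S = k. f (cycle_mset \<sigma> S))
    = (\<Sum>N | N \<subseteq># cycle_mset \<sigma> A \<and> sum_mset N = k. of_nat (mset_choose (cycle_mset \<sigma> A) N) * f N)"
proof -
  define g where "g N = (if sum_mset N = k then f N else 0)" for N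
  have "(\<Sum>S | S \<subseteq> A \<and> \<sigma> ` S = S \<and> card S = k. f (cycle_mset \<sigma> S))
    = (\<Sum>S | S \<subseteq> A \<and> \<sigma> ` S = S. g (cycle_mset \<sigma> S))"
    using A(1) sum_cycle_mset finite_subset[OF _ A(1)]
    by (intro sum.mono_neutral_cong_left) (auto simp: g_def)
  also have "\<dots> = (\<Sum>R\<in>Pow (orbit \<sigma> ` A). g (image_mset card (mset_set R)))"
    unfolding cycle_mset_def by (rule sum.reindex_bij_betw[OF bij_betw_invariant_subsets[OF A]])
  also have "\<dots> = (\<Sum>N | N \<subseteq># cycle_mset \<sigma> A. of_nat (mset_choose (cycle_mset \<sigma> A) N) * g N)"
    unfolding cycle_mset_def using A(1) by (intro sum_Pow_image_mset) auto
  also have "\<dots> = (\<Sum>N | N \<subseteq># cycle_mset \<sigma> A \<and> sum_mset N = k.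
      of_nat (mset_choose (cycle_mset \<sigma> A) N) * f N)"
    by (rule sum.mono_neutral_cong_right[OF finite_submsets]) (auto simp: g_def)
  finally show ?thesis .
qed

end

lemma orbit_cycle_of_list:
  assumes "distinct cs" "x \<in> set cs"
  shows "orbit (cycle_of_list cs) x = set cs"
proof -
  have first: "orbit (cycle_of_list cs) (cs ! 0) = set cs"
  proof
    let ?\<rho> = "cycle_of_list cs"
    have ne: "cs \<noteq> []" using assms(2) by auto
    show "orbit ?\<rho> (cs ! 0) \<subseteq> set cs"
      using permutes_orbit_subset[OF cycle_permutes[of cs] nth_mem] ne by simp
    show "set cs \<subseteq> orbit ?\<rho> (cs ! 0)"
    proof
      fix y assume "y \<in> set cs"
      then obtain i where i: "i < length cs" "y = cs ! i" by (metis in_set_conv_nth)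
      have "(?\<rho> ^^ i) (cs ! 0) = map (?\<rho> ^^ i) cs ! 0" using ne by simp
      also have "\<dots> = y" using ne i by (simp add: cyclic_rotation[OF assms(1)] nth_rotate)
      finally show "y \<in> orbit ?\<rho> (cs ! 0)"
        using funpow_in_orbit permutation_self_in_orbit[OF permutation_of_cycle] by metis
    qed
  qed
  then have "x \<in> orbit (cycle_of_list cs) (cs ! 0)" using assms(2) by simp
  from orbit_eq_if_mem[OF permutation_of_cycle this] show ?thesis by (simp add: first)
qed

lemma ex_permutes_cycle_mset:
  assumes "0 \<notin># M" "finite A" "card A = sum_mset M"
  shows "\<exists>\<sigma>. \<sigma> permutes A \<and> cycle_mset \<sigma> A = M"
  using assms
proof (induction M arbitrary: A)
  case empty
  then show ?case by (intro exI[of _ id]) (auto simp: cycle_mset_def permutes_id)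
next
  case (add k M)
  obtain C where C: "C \<subseteq> A" "card C = k" "finite C"
    using obtain_subset_with_card_n[of k A] add.prems(3) by auto
  obtain cs where cs: "set cs = C" "distinct cs" using finite_distinct_list[OF C(3)] by blast
  let ?\<rho> = "cycle_of_list cs"
  have \<rho>: "?\<rho> permutes C" using cycle_permutes[of cs] cs(1) by simp
  have "C \<noteq> {}" using C(2) add.prems(1) by auto
  moreover have "orbit ?\<rho> x = C" if "x \<in> C" for x
    using orbit_cycle_of_list[OF cs(2)] cs(1) that by simp
  ultimately have "orbit ?\<rho> ` C = {C}" by force
  then have \<rho>_type: "cycle_mset ?\<rho> C = {#k#}" using C(2) by (simp add: cycle_mset_def)
  have "card (A - C) = sum_mset M" using C add.prems(3) by (simp add: card_Diff_subset)
  then obtain \<tau> where \<tau>: "\<tau> permutes (A - C)" "cycle_mset \<tau> (A - C) = M"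
    using add.IH[of "A - C"] add.prems(1,2) by auto
  let ?\<sigma> = "?\<rho> \<circ> \<tau>"
  have perm: "?\<sigma> permutes A"
    using C(1) by (intro permutes_compose permutes_subset[OF \<tau>(1)] permutes_subset[OF \<rho>]) auto
  have on_C: "?\<rho> x = ?\<sigma> x" if "x \<in> C" for x using that permutes_not_in[OF \<tau>(1), of x] by simp
  have on_diff: "\<tau> x = ?\<sigma> x" if "x \<in> A - C" for x
    using that permutes_in_image[OF \<tau>(1), of x] permutes_not_in[OF \<rho>, of "\<tau> x"] by simp
  have "?\<sigma> ` C = ?\<rho> ` C" "?\<sigma> ` (A - C) = \<tau> ` (A - C)"
    using on_C on_diff by (auto intro!: image_cong)
  then have images: "?\<rho> ` C = C" "?\<sigma> ` C = C" "\<tau> ` (A - C) = A - C" "?\<sigma> ` (A - C) = A - C"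
    using permutes_image[OF \<rho>] permutes_image[OF \<tau>(1)] by simp_all
  have "permutation ?\<sigma>" using perm add.prems(2) by (auto simp: permutation_permutes)
  then have "cycle_mset ?\<sigma> (C \<union> (A - C)) = cycle_mset ?\<sigma> C + cycle_mset ?\<sigma> (A - C)"
    using images C(3) add.prems(2) by (intro cycle_mset_Un_disjoint) auto
  also have "\<dots> = cycle_mset ?\<rho> C + cycle_mset \<tau> (A - C)"
    by (simp only: cycle_mset_cong[OF equalityD1[OF images(1)] on_C]
        cycle_mset_cong[OF equalityD1[OF images(3)] on_diff])
  finally have "cycle_mset ?\<sigma> A = add_mset k M" using C(1) \<rho>_type \<tau>(2) by (simp add: Un_absorb1)
  then show ?case using perm by blast
qed

lemma rev_sort_eq:
  assumes "sorted_wrt (\<ge>) (\<mu> :: 'a::linorder list)"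
  shows "rev (sort \<mu>) = \<mu>"
proof -
  have "sorted (rev \<mu>)" using assms by (simp add: sorted_wrt_rev)
  then have "sort \<mu> = rev \<mu>" by (intro properties_for_sort) auto
  then show ?thesis by simp
qed

lemma bij_betw_mset_partitions: "bij_betw mset (partitions n) (mset_partitions n)"
proof (rule bij_betw_byWitness[where f' = "\<lambda>M. rev (sorted_list_of_multiset M)"])
  show "\<forall>\<mu>\<in>partitions n. rev (sorted_list_of_multiset (mset \<mu>)) = \<mu>"
    by (simp add: rev_sort_eq partitions_def)
  show "(\<lambda>M. rev (sorted_list_of_multiset M)) ` mset_partitions n \<subseteq> partitions n"
  proof
    fix \<mu> assume "\<mu> \<in> (\<lambda>M. rev (sorted_list_of_multiset M)) ` mset_partitions n"
    then obtain M where M: "M \<in> mset_partitions n" "\<mu> = rev (sorted_list_of_multiset M)" by blast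
    have "sorted_wrt (\<ge>) \<mu>" using M by (simp add: sorted_wrt_rev)
    moreover have "mset \<mu> = M" using M by simp
    then have "sum_list \<mu> = n" "0 \<notin> set \<mu>"
      using M(1) by (auto simp: mset_partitions_def sum_mset_sum_list simp flip: set_mset_mset)
    ultimately show "\<mu> \<in> partitions n" by (simp add: partitions_def)
  qed
qed (auto simp: partitions_def mset_partitions_def sum_mset_sum_list)

lemma perm_of_type:
  assumes "\<mu> \<in> partitions n"
  shows "perm_of_type n \<mu> permutes {1..n}" "cycle_mset (perm_of_type n \<mu>) {1..n} = mset \<mu>"
proof -
  have \<mu>: "0 \<notin># mset \<mu>" "sum_mset (mset \<mu>) = n" "sorted_wrt (\<ge>) \<mu>"
    using assms by (auto simp: partitions_def sum_mset_sum_list)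
  have type: "cycle_type n \<rho> = rev (sorted_list_of_multiset (cycle_mset \<rho> {1..n}))" for \<rho>
    by (simp add: cycle_type_def cycle_mset_def)
  have "\<exists>\<sigma>. \<sigma> permutes {1..n} \<and> cycle_type n \<sigma> = \<mu>"
    using ex_permutes_cycle_mset[OF \<mu>(1), of "{1..n}"] \<mu>(2) rev_sort_eq[OF \<mu>(3)]
    by (auto simp: type)
  from someI_ex[OF this]
  have perm: "perm_of_type n \<mu> permutes {1..n}" "cycle_type n (perm_of_type n \<mu>) = \<mu>"
    by (auto simp: perm_of_type_def)
  then show "perm_of_type n \<mu> permutes {1..n}" by blast
  have "mset (cycle_type n (perm_of_type n \<mu>)) = mset \<mu>" using perm(2) by simp
  then show "cycle_mset (perm_of_type n \<mu>) {1..n} = mset \<mu>" unfolding type by simp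
qed

lemma principal_specialization_mult_power_sum_partition:
  assumes "0 \<notin> set \<mu>" "0 \<notin> set \<nu>"
  shows "fps_const (a / (of_nat (z_partition \<mu>) * of_nat (z_partition \<nu>))) *
      principal_specialization
        (series_mult (power_sum_partition XVar \<mu>) (power_sum_partition YVar \<nu>))
    = type_weight (mset \<mu>) * (type_weight (mset \<nu>) * fps_const a)"
proof -
  have z: "z_partition \<rho> = z_mset (mset \<rho>)" for \<rho>
    by (simp add: z_partition_def z_mset_def count_mset)
  have const: "fps_const (a / (b * c)) = fps_const (1 / b) * fps_const (1 / c) * fps_const a"
    for b c :: complex
    by simp
  have "principal_specialization
      (series_mult (power_sum_partition XVar \<mu>) (power_sum_partition YVar \<nu>))
    = (\<Prod>k\<in>#mset \<mu>. inverse (1 - fps_X ^ k)) * (\<Prod>k\<in>#mset \<nu>. inverse (1 - fps_X ^ k))"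
    using assms principal_specialization_mult[OF degree_le_power_sum_partition
        degree_le_power_sum_partition]
    by (simp add: principal_specialization_power_sum_partition)
  then show ?thesis unfolding const z type_weight_def by (simp only: mult_ac)
qed

theorem principal_specialization_frobenius_char:
  assumes \<chi>: "\<And>\<mu> \<nu>. \<mu> \<in> partitions m \<Longrightarrow> \<nu> \<in> partitions n \<Longrightarrow>
    \<chi> (perm_of_type m \<mu>) (perm_of_type n \<nu>) = \<Phi> (mset \<mu>) (mset \<nu>)"
  shows "principal_specialization (frobenius_char m n \<chi>)
    = type_average m (\<lambda>M. type_average n (\<lambda>N. fps_const (\<Phi> M N)))"
proof -
  let ?I = "partitions m \<times> partitions n"
  let ?c = "\<lambda>(\<mu>, \<nu>). \<chi> (perm_of_type m \<mu>) (perm_of_type n \<nu>)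
    / (of_nat (z_partition \<mu>) * of_nat (z_partition \<nu>))"
  let ?s = "\<lambda>(\<mu>, \<nu>). series_mult (power_sum_partition XVar \<mu>) (power_sum_partition YVar \<nu>)"
  have fin: "finite (partitions k)" for k
    using bij_betw_finite[OF bij_betw_mset_partitions] finite_mset_partitions by blast
  have deg: "degree_le (m + n) (?s p)" if "p \<in> ?I" for p
    using that degree_le_mult[OF degree_le_power_sum_partition degree_le_power_sum_partition]
    by (auto simp: partitions_def)
  have "principal_specialization (frobenius_char m n \<chi>)
    = principal_specialization (\<lambda>M. \<Sum>p\<in>?I. ?c p * ?s p M)"
    by (simp add: frobenius_char_def sum.cartesian_product split_beta)
  also have "\<dots> = (\<Sum>p\<in>?I. fps_const (?c p) * principal_specialization (?s p))"
    using fin deg by (intro principal_specialization_sum) auto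
  also have "\<dots> = (\<Sum>(\<mu>, \<nu>)\<in>?I.
      type_weight (mset \<mu>) * (type_weight (mset \<nu>) * fps_const (\<Phi> (mset \<mu>) (mset \<nu>))))"
  proof (rule sum.cong[OF refl])
    fix p assume "p \<in> ?I"
    then obtain \<mu> \<nu> where p: "p = (\<mu>, \<nu>)" "\<mu> \<in> partitions m" "\<nu> \<in> partitions n" by blast
    then have "0 \<notin> set \<mu>" "0 \<notin> set \<nu>" by (auto simp: partitions_def)
    then show "fps_const (?c p) * principal_specialization (?s p)
      = (case p of (\<mu>, \<nu>) \<Rightarrow>
          type_weight (mset \<mu>) * (type_weight (mset \<nu>) * fps_const (\<Phi> (mset \<mu>) (mset \<nu>))))"
      unfolding p(1) split_conv \<chi>[OF p(2,3)]
      by (rule principal_specialization_mult_power_sum_partition)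
  qed
  also have "\<dots> = (\<Sum>\<mu>\<in>partitions m. \<Sum>\<nu>\<in>partitions n.
      type_weight (mset \<mu>) * (type_weight (mset \<nu>) * fps_const (\<Phi> (mset \<mu>) (mset \<nu>))))"
    by (simp add: sum.cartesian_product)
  also have "\<dots> = type_average m (\<lambda>M. type_average n (\<lambda>N. fps_const (\<Phi> M N)))"
    unfolding type_average_def sum_distrib_left
    by (simp add: sum.reindex_bij_betw[OF bij_betw_mset_partitions, symmetric])
  finally show ?thesis .
qed

section \<open>Signed sums over chains\<close>

lemma segre_interior_below:
  assumes fin: "finite A" "finite B" and x: "x \<in> segre_interior A B"
  shows "y \<in> segre_interior (fst x) (snd x) \<longleftrightarrow> y \<in> segre_interior A B \<and> y < x"
proof
  assume "y \<in> segre_interior (fst x) (snd x)"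
  then have y: "fst y \<subseteq> fst x" "snd y \<subseteq> snd x" "card (fst y) = card (snd y)" "0 < card (fst y)"
      "card (fst y) < card (fst x)"
    by (simp_all add: segre_interior_iff)
  have "fst y \<subseteq> A" "snd y \<subseteq> B" "card (fst y) < card A"
    using y x unfolding segre_interior_iff by (blast, blast, linarith)
  moreover have "y \<le> x" "y \<noteq> x" using y by (auto simp: less_eq_prod_def)
  ultimately show "y \<in> segre_interior A B \<and> y < x" using y by (simp add: segre_interior_iff)
next
  assume y: "y \<in> segre_interior A B \<and> y < x"
  then have "fst y \<subset> fst x" "snd y \<subset> snd x" "card (fst y) < card (fst x)"
    using segre_lattice_less[OF fin, of y x] subsetD[OF segre_interior_subset] x by blast+
  then show "y \<in> segre_interior (fst x) (snd x)"
    using y by (simp add: segre_interior_iff psubset_imp_subset)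
qed

lemma all_simplices_snoc:
  assumes "finite A" "finite B" "x \<in> segre_interior A B"
  shows "c @ [x] \<in> all_simplices (segre_interior A B)
    \<longleftrightarrow> c \<in> all_simplices (segre_interior (fst x) (snd x))"
proof -
  have "set c \<subseteq> segre_interior (fst x) (snd x) \<longleftrightarrow> set c \<subseteq> segre_interior A B \<and> (\<forall>y\<in>set c. y < x)"
    using segre_interior_below[OF assms] by blast
  then show ?thesis using assms(3) by (auto simp: all_simplices_def sorted_wrt_append)
qed

lemma sum_all_simplices_last:
  fixes f :: "('a set \<times> 'b set) list \<Rightarrow> 'r::comm_monoid_add"
  assumes fin: "finite A" "finite B"
  shows "(\<Sum>c\<in>all_simplices (segre_interior A B). f c)
    = f [] + (\<Sum>x\<in>segre_interior A B. \<Sum>c\<in>all_simplices (segre_interior (fst x) (snd x)).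
      f (c @ [x]))"
proof -
  let ?S = "\<lambda>A B. all_simplices (segre_interior A B)"
  have fin_int: "finite (segre_interior A B)" using fin by (rule finite_segre_interior)
  have fin_below: "finite (?S (fst x) (snd x))" if "x \<in> segre_interior A B" for x
    using that segre_lattice_finite[OF fin] segre_interior_subset
    by (intro finite_all_simplices finite_segre_interior) blast+
  have "(\<Sum>c\<in>?S A B. f c) = f [] + (\<Sum>c\<in>?S A B - {[]}. f c)"
    using finite_all_simplices[OF fin_int] by (intro sum.remove) (auto simp: all_simplices_def)
  also have "(\<Sum>c\<in>?S A B - {[]}. f c)
    = (\<Sum>(x, c)\<in>(SIGMA x:segre_interior A B. ?S (fst x) (snd x)). f (c @ [x]))"
  proof (rule sum.reindex_bij_witness[of _ "\<lambda>(x, c). c @ [x]" "\<lambda>xs. (last xs, butlast xs)"])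
    fix xs assume xs: "xs \<in> ?S A B - {[]}"
    then have "last xs \<in> segre_interior A B"
      using last_in_set[of xs] by (auto simp: all_simplices_def)
    then show "(last xs, butlast xs) \<in> (SIGMA x:segre_interior A B. ?S (fst x) (snd x))"
      using xs all_simplices_snoc[OF fin, of "last xs" "butlast xs"] by simp
  qed (use all_simplices_snoc[OF fin] in auto)
  also have "\<dots> = (\<Sum>x\<in>segre_interior A B. \<Sum>c\<in>?S (fst x) (snd x). f (c @ [x]))"
    using fin_int fin_below by (intro sum.Sigma[symmetric]) auto
  finally show ?thesis .
qed

lemma sum_segre_interior:
  fixes f :: "'a set \<Rightarrow> 'b set \<Rightarrow> 'r::comm_monoid_add"
  assumes "finite A" "finite B"
  shows "(\<Sum>x\<in>segre_interior A B. f (fst x) (snd x))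
    = (\<Sum>a\<in>{1..<card A}. \<Sum>S | S \<subseteq> A \<and> card S = a. \<Sum>T | T \<subseteq> B \<and> card T = a. f S T)"
proof -
  let ?level = "\<lambda>a. {S. S \<subseteq> A \<and> card S = a} \<times> {T. T \<subseteq> B \<and> card T = a}"
  have "segre_interior A B = (\<Union>a\<in>{1..<card A}. ?level a)" by (auto simp: segre_interior_iff)
  then have "(\<Sum>x\<in>segre_interior A B. f (fst x) (snd x))
    = (\<Sum>a\<in>{1..<card A}. \<Sum>x\<in>?level a. f (fst x) (snd x))"
    using assms by (simp only:) (intro sum.UNION_disjoint, auto)
  then show ?thesis by (simp add: sum.cartesian_product split_beta)
qed

definition signed_chain_sum ::
    "('a set \<Rightarrow> 'b set \<Rightarrow> ('a set \<times> 'b set) list \<Rightarrow> 'r::comm_ring_1) \<Rightarrow> 'a set \<Rightarrow> 'b set \<Rightarrow> 'r" where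
  "signed_chain_sum wt A B
    = (\<Sum>c\<in>all_simplices (segre_interior A B). (-1) ^ (card A + 1 + length c) * wt A B c)"

lemma signed_chain_sum_rec:
  assumes fin: "finite A" "finite B" and Nil: "wt A B [] = 1"
    and snoc: "\<And>x c. x \<in> segre_interior A B \<Longrightarrow> c \<in> all_simplices (segre_interior (fst x) (snd x)) \<Longrightarrow>
      wt A B (c @ [x]) = \<kappa> (fst x) * \<kappa>' (snd x) * wt (fst x) (snd x) c"
  shows "signed_chain_sum wt A B = (-1) ^ (card A + 1) + (\<Sum>a\<in>{1..<card A}. (-1) ^ (card A + a + 1) *
    (\<Sum>S | S \<subseteq> A \<and> card S = a. \<Sum>T | T \<subseteq> B \<and> card T = a. \<kappa> S * \<kappa>' T * signed_chain_sum wt S T))"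
proof -
  let ?term = "\<lambda>S T. (-1) ^ (card A + card S + 1) * (\<kappa> S * \<kappa>' T * signed_chain_sum wt S T)"
  have "(-1) ^ (card A + 1 + length (c @ [x])) * wt A B (c @ [x])
    = (-1) ^ (card A + card (fst x) + 1) * (\<kappa> (fst x) * \<kappa>' (snd x) *
        ((-1) ^ (card (fst x) + 1 + length c) * wt (fst x) (snd x) c))"
    if "x \<in> segre_interior A B" "c \<in> all_simplices (segre_interior (fst x) (snd x))" for x c
    unfolding snoc[OF that] by (simp add: power_add mult_ac)
  then have "signed_chain_sum wt A B
    = (-1) ^ (card A + 1) + (\<Sum>x\<in>segre_interior A B. ?term (fst x) (snd x))"
    unfolding signed_chain_sum_def sum_all_simplices_last[OF fin] sum_distrib_left
    by (simp add: Nil)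
  also have "\<dots> = (-1) ^ (card A + 1) + (\<Sum>a\<in>{1..<card A}. (-1) ^ (card A + a + 1) *
    (\<Sum>S | S \<subseteq> A \<and> card S = a. \<Sum>T | T \<subseteq> B \<and> card T = a. \<kappa> S * \<kappa>' T * signed_chain_sum wt S T))"
    unfolding sum_segre_interior[OF fin, of ?term] sum_distrib_left
    by (intro arg_cong2[of _ _ _ _ "(+)"] sum.cong refl) auto
  finally show ?thesis .
qed

text \<open>For positive \<open>m\<close>, \<open>(-1) ^ m * segre_series m\<close> is the coefficient of \<open>t ^ m\<close> in the reciprocal
  of \<open>\<Sum>a. (inverse_qpoch a)\<^sup>2 * t ^ a\<close>.\<close>

function segre_series :: "nat \<Rightarrow> 'a::field fps" where
  "segre_series m = (-1) ^ (m + 1) * (inverse_qpoch m)\<^sup>2 +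
     (\<Sum>a\<in>{1..<m}. (-1) ^ (m + a + 1) * ((inverse_qpoch (m - a))\<^sup>2 * segre_series a))"
  by pat_completeness auto
termination by (relation "measure id") auto

declare segre_series.simps [simp del]

section \<open>Chains weighted by inversions\<close>

lemma cut_inversions_subset_Un:
  assumes "S \<subseteq> U" "U \<subseteq> A"
  shows "cut_inversions A S \<union> cut_inversions A U = cut_inversions U S \<union> cut_inversions A U"
  using assms by (auto simp: cut_inversions_def)

lemma card_UN_pair_inversions_snoc:
  fixes A :: "'a::linorder set" and B :: "'b::linorder set"
  assumes fin: "finite A" "finite B" and x: "x \<in> segre_interior A B"
    and simplex: "c \<in> all_simplices (segre_interior (fst x) (snd x))"
  shows "card (\<Union> (pair_inversions A B ` set (c @ [x])))
    = card (cut_inversions A (fst x)) + card (cut_inversions B (snd x))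
      + card (\<Union> (pair_inversions (fst x) (snd x) ` set c))"
proof -
  have sub: "fst x \<subseteq> A" "snd x \<subseteq> B" using x by (auto simp: segre_interior_iff)
  have c_sub: "fst e \<subseteq> fst x" "snd e \<subseteq> snd x" if "e \<in> set c" for e
    using all_simplicesD(2)[OF simplex] that by (auto simp: segre_interior_iff dest!: subsetD)
  have "pair_inversions A B e \<union> pair_inversions A B x
    = pair_inversions (fst x) (snd x) e \<union> pair_inversions A B x" if "e \<in> set c" for e
    using cut_inversions_subset_Un[OF c_sub(1)[OF that] sub(1)]
      cut_inversions_subset_Un[OF c_sub(2)[OF that] sub(2)]
    unfolding pair_inversions_def by blast
  then have "\<Union> (pair_inversions A B ` set (c @ [x]))
    = pair_inversions A B x \<union> \<Union> (pair_inversions (fst x) (snd x) ` set c)"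
    by auto
  moreover have "pair_inversions A B x \<inter> \<Union> (pair_inversions (fst x) (snd x) ` set c) = {}"
    by (auto simp: pair_inversions_def cut_inversions_def)
  moreover have "finite (cut_inversions A (fst x))" "finite (cut_inversions B (snd x))"
    using fin sub by (auto intro: finite_cut_inversions)
  moreover have "finite (pair_inversions (fst x) (snd x) e)" if "e \<in> set c" for e
    using c_sub[OF that] finite_subset[OF sub(1) fin(1)] finite_subset[OF sub(2) fin(2)]
    by (simp add: pair_inversions_def finite_cut_inversions)
  ultimately show ?thesis
    by (simp add: card_Un_disjoint card_Plus pair_inversions_def)
qed

definition inversion_weight ::
    "'a::linorder set \<Rightarrow> 'b::linorder set \<Rightarrow> ('a set \<times> 'b set) list \<Rightarrow> 'r::field fps" where
  "inversion_weight A B c = fps_X ^ card (\<Union> (pair_inversions A B ` set c))"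

theorem signed_chain_sum_inversion_weight:
  fixes A :: "'a::linorder set" and B :: "'b::linorder set"
  assumes "finite A" "finite B" "card A = card B"
  shows "signed_chain_sum inversion_weight A B
    = (qpoch (card A))\<^sup>2 * (segre_series (card A) :: 'r::field fps)"
  using assms
proof (induction "card A" arbitrary: A B rule: less_induct)
  case less
  let ?m = "card A" and ?h = "inverse_qpoch :: nat \<Rightarrow> 'r fps"
  have IH: "signed_chain_sum inversion_weight S T = (qpoch a)\<^sup>2 * (segre_series a :: 'r fps)"
    if "a \<in> {1..<?m}" "S \<subseteq> A" "card S = a" "T \<subseteq> B" "card T = a" for a S T
    using that less.hyps[of S T] finite_subset[OF that(2) less.prems(1)]
      finite_subset[OF that(4) less.prems(2)]
    by simp
  have "(\<Sum>S | S \<subseteq> A \<and> card S = a. \<Sum>T | T \<subseteq> B \<and> card T = a. fps_X ^ card (cut_inversions A S) *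
      fps_X ^ card (cut_inversions B T) * signed_chain_sum inversion_weight S T)
    = (qpoch ?m)\<^sup>2 * ((?h (?m - a))\<^sup>2 * segre_series a)" if a: "a \<in> {1..<?m}" for a
  proof -
    have "(\<Sum>S | S \<subseteq> A \<and> card S = a. \<Sum>T | T \<subseteq> B \<and> card T = a. fps_X ^ card (cut_inversions A S) *
        fps_X ^ card (cut_inversions B T) * signed_chain_sum inversion_weight S T)
      = (\<Sum>S | S \<subseteq> A \<and> card S = a. \<Sum>T | T \<subseteq> B \<and> card T = a. fps_X ^ card (cut_inversions A S) *
        fps_X ^ card (cut_inversions B T) * ((qpoch a)\<^sup>2 * (segre_series a :: 'r fps)))"
      by (intro sum.cong refl) (simp add: IH[OF a])
    also have "\<dots> = qbinomial ?m a * qbinomial ?m a * ((qpoch a)\<^sup>2 * segre_series a)"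
      using sum_subsets_cut_inversions[OF less.prems(1), of a, where 'a = 'r]
        sum_subsets_cut_inversions[OF less.prems(2), of a, where 'a = 'r] less.prems(3)
      by (simp flip: sum_distrib_left sum_distrib_right)
    also have "\<dots> = (qpoch a * ?h a)\<^sup>2 * ((qpoch ?m)\<^sup>2 * ((?h (?m - a))\<^sup>2 * segre_series a))"
      using a by (simp add: qbinomial_def power2_eq_square mult_ac del: qpoch_inverse_qpoch)
    finally show ?thesis by simp
  qed
  then have "signed_chain_sum inversion_weight A B
    = (-1) ^ (?m + 1) + (\<Sum>a\<in>{1..<?m}. (-1) ^ (?m + a + 1) *
      ((qpoch ?m)\<^sup>2 * ((?h (?m - a))\<^sup>2 * segre_series a)))"
    using less.prems(1,2)
    by (subst signed_chain_sum_rec[where \<kappa> = "\<lambda>S. fps_X ^ card (cut_inversions A S)"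
          and \<kappa>' = "\<lambda>T. fps_X ^ card (cut_inversions B T)"])
      (simp_all add: inversion_weight_def card_UN_pair_inversions_snoc power_add del: set_append)
  also have "(-1) ^ (?m + 1) = (qpoch ?m * ?h ?m)\<^sup>2 * (-1) ^ (?m + 1)" by simp
  also have "\<dots> = (qpoch ?m)\<^sup>2 * ((-1) ^ (?m + 1) * (?h ?m)\<^sup>2)"
    by (simp only: power_mult_distrib mult_ac)
  finally show ?case
    unfolding segre_series.simps[of ?m] distrib_left sum_distrib_left by (simp only: mult_ac)
qed

theorem W_poly_eq_segre_series:
  assumes "1 \<le> n"
  shows "W_poly n = (qpoch n)\<^sup>2 * segre_series n"
proof -
  have "W_poly n = signed_chain_sum inversion_weight {1..n} {1..n}"
    using boolean.sum_all_simplices_eq_sum_critical_chains[of n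
      "\<lambda>I. fps_X ^ card I :: complex fps"] assms
    by (simp add: W_poly_eq_sum_critical_chains signed_chain_sum_def inversion_weight_def
      boolean.separated_def
      del: One_nat_def)
  then show ?thesis by (simp add: signed_chain_sum_inversion_weight)
qed

section \<open>Chains fixed by a pair of permutations\<close>

function fixed_chain_sum :: "nat multiset \<Rightarrow> nat multiset \<Rightarrow> int" where
  "fixed_chain_sum M N = (-1) ^ (sum_mset M + 1)
    + (\<Sum>a\<in>{1..<sum_mset M}. (-1) ^ (sum_mset M + a + 1) *
     (\<Sum>A | A \<subseteq># M \<and> sum_mset A = a. int (mset_choose M A) *
       (\<Sum>B | B \<subseteq># N \<and> sum_mset B = a. int (mset_choose N B) * fixed_chain_sum A B)))"
  by pat_completeness auto
termination by (relation "measure (\<lambda>(M, N). sum_mset M)") auto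

declare fixed_chain_sum.simps [simp del]

lemma type_average_fixed_chain_sum:
  "type_average m (\<lambda>M. type_average m (\<lambda>N. of_int (fixed_chain_sum M N))) = segre_series m"
proof (induction m rule: less_induct)
  case (less m)
  let ?h = "inverse_qpoch :: nat \<Rightarrow> 'a fps" and ?s = "\<lambda>a. (-1) ^ (m + a + 1) :: 'a fps"
  let ?\<Phi> = "\<lambda>M N. of_int (fixed_chain_sum M N) :: 'a fps"
  let ?sub = "\<lambda>M a \<phi>. \<Sum>A | A \<subseteq># M \<and> sum_mset A = a. of_nat (mset_choose M A) * \<phi> A :: 'a fps"
  have average: "type_average m (\<lambda>M. ?sub M a \<phi>) = ?h (m - a) * type_average a \<phi>"
    if "a \<in> {1..<m}" for a and \<phi> :: "nat multiset \<Rightarrow> 'a fps"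
    using that by (simp add: type_average_mset_choose)
  have inner: "type_average m (\<lambda>N. ?\<Phi> M N)
      = ?h m * (-1) ^ (m + 1)
        + (\<Sum>a\<in>{1..<m}. ?s a * ?h (m - a) * ?sub M a (\<lambda>A. type_average a (?\<Phi> A)))"
    if "M \<in> mset_partitions m" for M
  proof -
    have "?\<Phi> M = (\<lambda>N. (-1) ^ (m + 1) + (\<Sum>a\<in>{1..<m}. ?s a * ?sub M a (\<lambda>A. ?sub N a (?\<Phi> A))))"
      using that by (subst fixed_chain_sum.simps[abs_def]) (simp add: mset_partitions_def)
    then have "type_average m (?\<Phi> M) = ?h m * (-1) ^ (m + 1)
        + (\<Sum>a\<in>{1..<m}. ?s a * ?sub M a (\<lambda>A. type_average m (\<lambda>N. ?sub N a (?\<Phi> A))))"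
      by (simp only: type_average_add type_average_const type_average_sum)
    also have "\<dots> = ?h m * (-1) ^ (m + 1)
        + (\<Sum>a\<in>{1..<m}. ?s a * ?h (m - a) * ?sub M a (\<lambda>A. type_average a (?\<Phi> A)))"
    proof (intro arg_cong2[of _ _ _ _ "(+)"] sum.cong refl)
      fix a assume a: "a \<in> {1..<m}"
      show "?s a * ?sub M a (\<lambda>A. type_average m (\<lambda>N. ?sub N a (?\<Phi> A)))
        = ?s a * ?h (m - a) * ?sub M a (\<lambda>A. type_average a (?\<Phi> A))"
        unfolding average[OF a] sum_distrib_left by (intro sum.cong refl) (simp only: mult_ac)
    qed
    finally show ?thesis .
  qed
  have "type_average m (\<lambda>M. type_average m (\<lambda>N. ?\<Phi> M N)) = ?h m * (?h m * (-1) ^ (m + 1))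
      + (\<Sum>a\<in>{1..<m}. ?s a * ?h (m - a) * type_average m (\<lambda>M. ?sub M a (\<lambda>A. type_average a (?\<Phi> A))))"
    by (simp only: type_average_cong[OF inner] type_average_add type_average_const type_average_sum)
  also have "\<dots> = ?h m * (?h m * (-1) ^ (m + 1))
    + (\<Sum>a\<in>{1..<m}. ?s a * ?h (m - a) * (?h (m - a) * segre_series a))"
    using less by (intro arg_cong2[of _ _ _ _ "(+)"] sum.cong refl) (simp add: average)
  finally show ?case by (simp add: segre_series.simps[of m] power2_eq_square mult_ac)
qed

definition fixed_weight ::
    "(nat \<Rightarrow> nat) \<Rightarrow> (nat \<Rightarrow> nat) \<Rightarrow> nat set \<Rightarrow> nat set \<Rightarrow> (nat set \<times> nat set) list \<Rightarrow> int" where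
  "fixed_weight \<sigma> \<tau> A B c = of_bool (map (segre_action \<sigma> \<tau>) c = c)"

lemma segre_action_fixed_iff:
  "segre_action \<sigma> \<tau> x = x \<longleftrightarrow> \<sigma> ` fst x = fst x \<and> \<tau> ` snd x = snd x"
  by (cases x) (simp add: segre_action_def)

lemma sum_of_bool_invariant:
  fixes g :: "'a set \<Rightarrow> 'r::semiring_1"
  assumes "finite A"
  shows "(\<Sum>S | S \<subseteq> A \<and> card S = a. of_bool (\<sigma> ` S = S) * g S)
    = (\<Sum>S | S \<subseteq> A \<and> \<sigma> ` S = S \<and> card S = a. g S)"
  using assms by (intro sum.mono_neutral_cong_right) auto

theorem signed_chain_sum_fixed_weight:
  assumes \<sigma>: "permutation \<sigma>" and \<tau>: "permutation \<tau>"
    and "finite A" "finite B" "card A = card B" "\<sigma> ` A = A" "\<tau> ` B = B"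
  shows "signed_chain_sum (fixed_weight \<sigma> \<tau>) A B
    = fixed_chain_sum (cycle_mset \<sigma> A) (cycle_mset \<tau> B)"
  using assms(3-)
proof (induction "card A" arbitrary: A B rule: less_induct)
  case less
  let ?F = "signed_chain_sum (fixed_weight \<sigma> \<tau>)" and ?M = "cycle_mset \<sigma> A" and ?N = "cycle_mset \<tau> B"
  have sum_M: "sum_mset ?M = card A" using sum_cycle_mset[OF \<sigma>] less.prems by simp
  have level: "(\<Sum>S | S \<subseteq> A \<and> card S = a. \<Sum>T | T \<subseteq> B \<and> card T = a.
      of_bool (\<sigma> ` S = S) * of_bool (\<tau> ` T = T) * ?F S T)
    = (\<Sum>M' | M' \<subseteq># ?M \<and> sum_mset M' = a. int (mset_choose ?M M') *
        (\<Sum>N' | N' \<subseteq># ?N \<and> sum_mset N' = a. int (mset_choose ?N N') * fixed_chain_sum M' N'))"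
    if a: "a \<in> {1..<card A}" for a
  proof -
    have "(\<Sum>S | S \<subseteq> A \<and> card S = a. \<Sum>T | T \<subseteq> B \<and> card T = a.
        of_bool (\<sigma> ` S = S) * of_bool (\<tau> ` T = T) * ?F S T)
      = (\<Sum>S | S \<subseteq> A \<and> \<sigma> ` S = S \<and> card S = a. \<Sum>T | T \<subseteq> B \<and> \<tau> ` T = T \<and> card T = a. ?F S T)"
      by (simp only: mult.assoc sum_distrib_left[symmetric] sum_of_bool_invariant[OF less.prems(1)]
          sum_of_bool_invariant[OF less.prems(2)])
    also have "\<dots> = (\<Sum>S | S \<subseteq> A \<and> \<sigma> ` S = S \<and> card S = a. \<Sum>T | T \<subseteq> B \<and> \<tau> ` T = T \<and> card T = a.
        fixed_chain_sum (cycle_mset \<sigma> S) (cycle_mset \<tau> T))"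
    proof (intro sum.cong refl)
      fix S T assume "S \<in> {S. S \<subseteq> A \<and> \<sigma> ` S = S \<and> card S = a}"
        "T \<in> {T. T \<subseteq> B \<and> \<tau> ` T = T \<and> card T = a}"
      then show "?F S T = fixed_chain_sum (cycle_mset \<sigma> S) (cycle_mset \<tau> T)"
        using less.hyps[of S T] a finite_subset less.prems(1,2) by auto
    qed
    finally show ?thesis
      using less.prems sum_invariant_subsets[OF \<sigma>, of A "\<lambda>M'. \<Sum>N' | N' \<subseteq># ?N \<and> sum_mset N' = a.
          int (mset_choose ?N N') * fixed_chain_sum M' N'" a]
      by (simp add: sum_invariant_subsets[OF \<tau>])
  qed
  show ?case
    using less.prems(1,2) level sum_M
    by (subst signed_chain_sum_rec[where \<kappa> = "\<lambda>S. of_bool (\<sigma> ` S = S)"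
          and \<kappa>' = "\<lambda>T. of_bool (\<tau> ` T = T)"])
      (auto simp: fixed_weight_def segre_action_fixed_iff fixed_chain_sum.simps[of ?M ?N])
qed

lemma segre_action_automorphism:
  assumes \<sigma>: "\<sigma> permutes A" and \<tau>: "\<tau> permutes B" and fin: "finite A" "finite B"
  shows "finite_poset_automorphism (segre_interior A B) (segre_action \<sigma> \<tau>)"
proof
  let ?P = "segre_interior A B" and ?f = "segre_action \<sigma> \<tau>"
  show fin_P: "finite ?P" using fin by (rule finite_segre_interior)
  have inj: "inj \<sigma>" "inj \<tau>" using \<sigma> \<tau> by (auto intro: permutes_inj)
  have f: "fst (?f x) = \<sigma> ` fst x" "snd (?f x) = \<tau> ` snd x" for x
    by (simp_all add: segre_action_def split_beta)
  have inj_f: "inj ?f"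
    using inj by (auto intro!: injI prod_eqI simp: prod_eq_iff f inj_image_eq_iff)
  have "?f x \<in> ?P" if "x \<in> ?P" for x
    using that image_mono[of "fst x" A \<sigma>] image_mono[of "snd x" B \<tau>] permutes_image[OF \<sigma>]
      permutes_image[OF \<tau>] inj
    by (simp add: segre_interior_iff f card_image inj_on_subset)
  then show "bij_betw ?f ?P ?P"
    using endo_inj_surj[OF fin_P image_subsetI] inj_on_subset[OF inj_f subset_UNIV]
    by (simp add: bij_betw_def)
  show "strict_mono_on ?P ?f"
  proof (rule strict_mono_onI)
    fix x y :: "nat set \<times> nat set" assume "x < y"
    then have "?f x \<noteq> ?f y" using inj_eq[OF inj_f] by simp
    moreover have "?f x \<le> ?f y" using \<open>x < y\<close> by (auto simp: less_le less_eq_prod_def f)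
    ultimately show "?f x < ?f y" by simp
  qed
qed

lemma segre_proper_part_eq_interior:
  assumes "1 \<le> n"
  shows "segre_proper_part n = segre_interior {1..n} {1..n}"
proof (intro equalityI subsetI)
  fix x assume x: "x \<in> segre_interior {1..n} {1..n}"
  then show "x \<in> segre_proper_part n"
    by (cases x) (auto simp: segre_interior_iff segre_proper_part_def segre_poset_def)
next
  fix x assume "x \<in> segre_proper_part n"
  then have x: "fst x \<subseteq> {1..n}" "snd x \<subseteq> {1..n}" "card (fst x) = card (snd x)"
    "x \<noteq> ({}, {})" "x \<noteq> ({1..n}, {1..n})"
    by (auto simp: segre_proper_part_def segre_poset_def)
  have fin: "finite (fst x)" "finite (snd x)" using x(1,2) finite_subset by auto
  have "card (fst x) \<noteq> 0" using x fin by (cases x) auto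
  moreover have "card (fst x) \<noteq> n"
    using x card_subset_eq[of "{1..n}" "fst x"] card_subset_eq[of "{1..n}" "snd x"]
    by (cases x) auto
  moreover have "card (fst x) \<le> n" using card_mono[OF _ x(1)] by simp
  ultimately show "x \<in> segre_interior {1..n} {1..n}" using x by (simp add: segre_interior_iff)
qed

theorem top_homology_character_eq_fixed_chain_sum:
  assumes n: "1 \<le> n" and \<sigma>: "\<sigma> permutes {1..n}" and \<tau>: "\<tau> permutes {1..n}"
  shows "top_homology_character n \<sigma> \<tau>
    = of_int (fixed_chain_sum (cycle_mset \<sigma> {1..n}) (cycle_mset \<tau> {1..n}))"
proof -
  let ?P = "segre_interior {1..n} {1..n}" and ?f = "segre_action \<sigma> \<tau>"
  interpret finite_poset_automorphism ?P ?f
    using segre_action_automorphism[OF \<sigma> \<tau>] by simp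
  have "top_homology_character n \<sigma> \<tau>
    = linear_trace (reduced_homology ?P (int (n - 1) - 1)) (homology_map ?f)"
    using n by (simp add: top_homology_character_def segre_proper_part_eq_interior of_nat_diff)
  also have "\<dots> = (\<Sum>c | c \<in> all_simplices ?P \<and> map ?f c = c. (-1) ^ (n - 1 + length c))"
    using n boolean.simplices_segre_interior_eq_empty[of n] boolean.exact_at_segre_interior[of _ n]
    by (intro hopf_trace) (simp_all del: One_nat_def)
  also have "\<dots> = (\<Sum>c\<in>all_simplices ?P. (-1) ^ (n + 1 + length c) * of_bool (map ?f c = c))"
    using n finite_all_simplices[OF finite_P]
    by (intro sum.mono_neutral_cong_left) (auto simp: power_add power_diff)
  also have "\<dots> = of_int (signed_chain_sum (fixed_weight \<sigma> \<tau>) {1..n} {1..n})"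
    by (simp add: signed_chain_sum_def fixed_weight_def)
  also have "signed_chain_sum (fixed_weight \<sigma> \<tau>) {1..n} {1..n}
    = fixed_chain_sum (cycle_mset \<sigma> {1..n}) (cycle_mset \<tau> {1..n})"
    using \<sigma> \<tau>
    by (intro signed_chain_sum_fixed_weight) (auto simp: permutes_image permutation_permutes)
  finally show ?thesis .
qed

theorem theorem4p9:
  fixes n :: nat
  assumes "n \<ge> 1"
  shows "principal_specialization (frobenius_char n n (top_homology_character n))
    = W_poly n / (\<Prod>i=1..n. (1 - fps_X ^ i)\<^sup>2)"
proof -
  have "top_homology_character n (perm_of_type n \<mu>) (perm_of_type n \<nu>)
    = of_int (fixed_chain_sum (mset \<mu>) (mset \<nu>))"
    if "\<mu> \<in> partitions n" "\<nu> \<in> partitions n" for \<mu> \<nu>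
    using top_homology_character_eq_fixed_chain_sum[OF assms] perm_of_type[OF that(1)]
      perm_of_type[OF that(2)]
    by simp
  then have "principal_specialization (frobenius_char n n (top_homology_character n))
    = type_average n (\<lambda>M. type_average n (\<lambda>N. fps_const (of_int (fixed_chain_sum M N))))"
    by (rule principal_specialization_frobenius_char)
  also have "\<dots> = segre_series n"
    using type_average_fixed_chain_sum[of n] by (simp add: fps_of_int)
  also have "\<dots> = W_poly n / (qpoch n)\<^sup>2"
    by (simp add: W_poly_eq_segre_series[OF assms])
  also have "(qpoch n)\<^sup>2 = (\<Prod>i=1..n. (1 - fps_X ^ i :: complex fps)\<^sup>2)"
    by (simp add: qpoch_def prod_power_distrib)
  finally show ?thesis .
qed

end
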